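(* Let $(X_n)_{n\ge0}$ be a Markov chain satisfying the minorization, drift and strong aperiodicity conditions stated in the context (the atomic case), with constants $b,\lambda,K$ and functions/sets $V,C$. Then $(X_n)$ is geometrically ergodic, i.e. there are $\varrho<1$ and $M<\infty$ with $\|P^ng-\int g\,d\pi\|_V\le M\varrho^n\|g\|_V$ for all $g\in B_V$ and $n\ge1$. Moreover, for each of the two pairs $(r_0,K_0(\cdot))$ defined in the context, $$\rho_V\le r_0^{-1},$$ and for every $1<r<r_0$ $$M_1(r)\le \frac{2r\lambda}{1-\lambda}+\frac{r\lambda(K-1)}{(1-\lambda)^2}+\frac{r(K-\lambda)}{1-\lambda}K_0(r).$$
   Context: Setting. $(X_n)_{n\ge0}$ is a time-homogeneous Markov chain on a measurable space $(\mathcal S,\mathcal B)$ with one-step transition probability $\mathbf P(x,\cdot)$ and a unique stationary probability measure $\pi$; $Pf(x)=\int f(y)\mathbf P(x,dy)$. Conditions (atomic case): (1) Minorization: there are $C\in\mathcal B$ and a probability measure $\nu$ on $(\mathcal S,\mathcal B)$ with $\mathbf P(x,A)=\nu(A)$ for all $x\in C$, $A\in\mathcal B$ (so $C$ is an atom). (2) Drift: there are a measurable $V:\mathcal S\to[1,\infty)$ and constants $0<\lambda<1$, $K<\infty$ with $PV(x)\le\lambda V(x)$ for $x\notin C$ and $PV(x)\le K$ for $x\in C$. (3) Strong aperiodicity: $\nu(C)\ge b>0$, where $b<1$. Norms. $\|f\|_V=\sup_{x}|f(x)|/V(x)$; $B_V$ is the Banach space of measurable $f$ with $\|f\|_V<\infty$.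 $\rho_V$ is the spectral radius of $P-1\otimes\pi$ on $B_V$, where $(1\otimes\pi)g=\int g\,d\pi$. For $r>1$, $M_1(r)$ is the smallest constant $M$ such that $\|P^ng-\int g\,d\pi\|_V\le M r^{-n}\sup_x|g(x)|$ for all bounded measurable $g$ and all $n\ge1$. Pairs $(r_0,K_0)$. Put $R=\lambda^{-1}$, $L=\lambda^{-1}K$, $N=\frac{L-1}{R-1}$, and for $\alpha>0$ $$D(\alpha)=\frac{|1+\frac{b}{1-b}(1-e^{\frac{i\pi}{1+\alpha}})|-1}{|1-e^{\frac{i\pi}{1+\alpha}}|},\qquad \kappa(\alpha)=\frac{\log\frac{N-1}{(1-b)\alpha}}{\log R},\qquad \alpha_0=\frac{\log\frac{L-bR}{(1-b)R}}{\log R}.$$ First pair (using the value of $\pi(C)$, assumed $<1$): with $\alpha=(\pi(C)^{-1}-1)/(1-b)$, $$r_0=\min\Big\{R,\Big(1+\tfrac{D(\alpha)}{\alpha}\Big)^{1/\kappa(\alpha)}\Big\},\qquad K_0(r)=\frac{\pi(C)(r^{\kappa(\alpha)}-1)}{(r-1)(\alpha^{-1}D(\alpha)-r^{\kappa(\alpha)}+1)}.$$ Second pair (not using $\pi(C)$; it is assumed that $\alpha_0\ge1$ so that the range of $\alpha$ is non-empty): $$r_0=\min\Big\{R,\min_{1\le\alpha\le\alpha_0}\Big(1+\tfrac{D(\alpha)}{\alpha}\Big)^{1/\kappa(\alpha)}\Big\},\qquad K_0(r)=\max_{1\le\alpha\le\alpha_0}\frac{r^{\kappa(\alpha)}-1}{(r-1)(\alpha^{-1}D(\alpha)-r^{\kappa(\alpha)}+1)}.$$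 *)

theory Defs
  imports "HOL-Probability.Probability"
begin

section \<open>Kernels, the weighted supremum norm and geometric ergodicity\<close>

definition markov_op ::
  "('a \<Rightarrow> 'a measure) \<Rightarrow> ('a \<Rightarrow> 'b) \<Rightarrow> 'a \<Rightarrow> 'b::{banach, second_countable_topology}" where
  "markov_op P f x = (\<integral>y. f y \<partial>(P x))"

definition stationary :: "'a measure \<Rightarrow> ('a \<Rightarrow> 'a measure) \<Rightarrow> 'a measure \<Rightarrow> bool" where
  "stationary S P \<mu> \<longleftrightarrow> prob_space \<mu> \<and> sets \<mu> = sets S \<and>
     (\<forall>A\<in>sets S. emeasure \<mu> A = (\<integral>\<^sup>+ x. emeasure (P x) A \<partial>\<mu>))"

text \<open>The norms take values in the extended reals, so that no supremum has an unspecified value.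
  They and \<open>BV\<close> are polymorphic in the codomain: real-valued functions are used for the convergence
  estimates, complex-valued ones (the complexification of the real space) for spectral notions.\<close>

definition sup_norm :: "'a measure \<Rightarrow> ('a \<Rightarrow> 'b::real_normed_vector) \<Rightarrow> ereal" where
  "sup_norm S f = (SUP x\<in>space S. ereal (norm (f x)))"

definition V_norm :: "'a measure \<Rightarrow> ('a \<Rightarrow> real) \<Rightarrow> ('a \<Rightarrow> 'b::real_normed_vector) \<Rightarrow> ereal" where
  "V_norm S V f = (SUP x\<in>space S. ereal (norm (f x) / V x))"

definition BV :: "'a measure \<Rightarrow> ('a \<Rightarrow> real) \<Rightarrow> ('a \<Rightarrow> 'b::real_normed_vector) set" where
  "BV S V = {f \<in> borel_measurable S. V_norm S V f < \<infinity>}"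

definition geometrically_ergodic ::
  "'a measure \<Rightarrow> ('a \<Rightarrow> 'a measure) \<Rightarrow> 'a measure \<Rightarrow> ('a \<Rightarrow> real) \<Rightarrow> bool" where
  "geometrically_ergodic S P \<mu> V \<longleftrightarrow>
     (\<exists>\<rho> M :: real. 0 \<le> \<rho> \<and> \<rho> < 1 \<and>
        (\<forall>g\<in>(BV S V :: ('a \<Rightarrow> real) set). \<forall>n\<ge>1.
           V_norm S V (\<lambda>x. (markov_op P ^^ n) g x - (\<integral>y. g y \<partial>\<mu>))
             \<le> ereal (M * \<rho> ^ n) * V_norm S V g))"

text \<open>The infimum below is attained (the admissible set is closed), so it is the smallest admissible
  constant; its value is \<open>\<infinity>\<close> if there is no finite one.\<close>

definition M1 ::
  "'a measure \<Rightarrow> ('a \<Rightarrow> 'a measure) \<Rightarrow> 'a measure \<Rightarrow> ('a \<Rightarrow> real) \<Rightarrow> real \<Rightarrow> ereal" where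
  "M1 S P \<mu> V r = Inf {M :: ereal.
     \<forall>g\<in>(borel_measurable S :: ('a \<Rightarrow> real) set). sup_norm S g < \<infinity> \<longrightarrow>
       (\<forall>n\<ge>1. V_norm S V (\<lambda>x. (markov_op P ^^ n) g x - (\<integral>y. g y \<partial>\<mu>))
                \<le> M * ereal (1 / r ^ n) * sup_norm S g)}"

section \<open>Spectral radius on the weighted space\<close>

text \<open>Elements of \<open>BV\<close> are identified when they agree on \<open>space S\<close>. The operator \<open>z I - T\<close> is
  invertible if it has a bounded two-sided inverse \<open>A\<close> on \<open>BV\<close>; linearity of \<open>A\<close> on \<open>space S\<close>
  follows from that of \<open>T\<close>.\<close>

definition BV_resolvent_set ::
  "'a measure \<Rightarrow> ('a \<Rightarrow> real) \<Rightarrow> (('a \<Rightarrow> complex) \<Rightarrow> 'a \<Rightarrow> complex) \<Rightarrow> complex set" where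
  "BV_resolvent_set S V T = {z. \<exists>A.
     (\<forall>h\<in>BV S V. A h \<in> BV S V) \<and>
     (\<exists>c. \<forall>h\<in>BV S V. V_norm S V (A h) \<le> ereal c * V_norm S V h) \<and>
     (\<forall>h\<in>BV S V. \<forall>x\<in>space S. z * A h x - T (A h) x = h x) \<and>
     (\<forall>f\<in>BV S V. \<forall>x\<in>space S. A (\<lambda>y. z * f y - T f y) x = f x)}"

definition BV_spectrum ::
  "'a measure \<Rightarrow> ('a \<Rightarrow> real) \<Rightarrow> (('a \<Rightarrow> complex) \<Rightarrow> 'a \<Rightarrow> complex) \<Rightarrow> complex set" where
  "BV_spectrum S V T = - BV_resolvent_set S V T"

definition BV_spectral_radius ::
  "'a measure \<Rightarrow> ('a \<Rightarrow> real) \<Rightarrow> (('a \<Rightarrow> complex) \<Rightarrow> 'a \<Rightarrow> complex) \<Rightarrow> ereal" where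
  "BV_spectral_radius S V T = (SUP z\<in>BV_spectrum S V T. ereal (cmod z))"

definition rho_V ::
  "'a measure \<Rightarrow> ('a \<Rightarrow> 'a measure) \<Rightarrow> 'a measure \<Rightarrow> ('a \<Rightarrow> real) \<Rightarrow> ereal" where
  "rho_V S P \<mu> V =
     BV_spectral_radius S V (\<lambda>g x. markov_op P g x - (\<integral>y. g y \<partial>\<mu>))"

section \<open>The constants\<close>

text \<open>The drift constant \<open>\<lambda>\<close> is called \<open>l\<close>.\<close>

definition R_const :: "real \<Rightarrow> real" where
  "R_const l = inverse l"

definition L_const :: "real \<Rightarrow> real \<Rightarrow> real" where
  "L_const l K = inverse l * K"

definition N_const :: "real \<Rightarrow> real \<Rightarrow> real" where
  "N_const l K = (L_const l K - 1) / (R_const l - 1)"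

definition D_fun :: "real \<Rightarrow> real \<Rightarrow> real" where
  "D_fun b \<alpha> =
     (cmod (1 + complex_of_real (b / (1 - b)) * (1 - exp (\<i> * complex_of_real (pi / (1 + \<alpha>))))) - 1)
     / cmod (1 - exp (\<i> * complex_of_real (pi / (1 + \<alpha>))))"

definition kappa :: "real \<Rightarrow> real \<Rightarrow> real \<Rightarrow> real \<Rightarrow> real" where
  "kappa b l K \<alpha> = ln ((N_const l K - 1) / ((1 - b) * \<alpha>)) / ln (R_const l)"

definition alpha0 :: "real \<Rightarrow> real \<Rightarrow> real \<Rightarrow> real" where
  "alpha0 b l K =
     ln ((L_const l K - b * R_const l) / ((1 - b) * R_const l)) / ln (R_const l)"

text \<open>First pair; the argument \<open>p\<close> is the value of \<open>\<pi>(C)\<close>.\<close>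

definition alpha_pi :: "real \<Rightarrow> real \<Rightarrow> real" where
  "alpha_pi b p = (inverse p - 1) / (1 - b)"

definition r0_pi :: "real \<Rightarrow> real \<Rightarrow> real \<Rightarrow> real \<Rightarrow> real" where
  "r0_pi b l K p = (let \<alpha> = alpha_pi b p in
     min (R_const l) ((1 + D_fun b \<alpha> / \<alpha>) powr (1 / kappa b l K \<alpha>)))"

definition K0_pi :: "real \<Rightarrow> real \<Rightarrow> real \<Rightarrow> real \<Rightarrow> real \<Rightarrow> real" where
  "K0_pi b l K p r = (let \<alpha> = alpha_pi b p; k = kappa b l K \<alpha> in
     p * (r powr k - 1) / ((r - 1) * (D_fun b \<alpha> / \<alpha> - r powr k + 1)))"

text \<open>Second pair. For \<open>1 \<le> \<alpha>\<^sub>0\<close> (and, in \<open>K0_opt\<close>, for \<open>1 < r < r\<^sub>0\<close>) the functions below are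
  continuous on the compact interval \<open>[1, \<alpha>\<^sub>0]\<close>, so the infimum is a minimum and the supremum a
  maximum.\<close>

definition r0_opt :: "real \<Rightarrow> real \<Rightarrow> real \<Rightarrow> real" where
  "r0_opt b l K =
     min (R_const l)
       (INF \<alpha>\<in>{1..alpha0 b l K}. (1 + D_fun b \<alpha> / \<alpha>) powr (1 / kappa b l K \<alpha>))"

definition K0_opt :: "real \<Rightarrow> real \<Rightarrow> real \<Rightarrow> real \<Rightarrow> real" where
  "K0_opt b l K r =
     (SUP \<alpha>\<in>{1..alpha0 b l K}.
        (r powr kappa b l K \<alpha> - 1)
        / ((r - 1) * (D_fun b \<alpha> / \<alpha> - r powr kappa b l K \<alpha> + 1)))"

definition M1_bound :: "real \<Rightarrow> real \<Rightarrow> real \<Rightarrow> real \<Rightarrow> real" where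
  "M1_bound l K K0 r =
     2 * r * l / (1 - l) + r * l * (K - 1) / (1 - l)\<^sup>2 + r * (K - l) / (1 - l) * K0"

end

theory Submission
  imports Defs "HOL-Complex_Analysis.Complex_Analysis"
begin

text \<open>Write \<open>J\<close> for the kernel \<open>P\<close> killed on the atom, \<open>J f = 1\<^bsub>S - C\<^esub> P f\<close>, and \<open>\<pi>\<close> for the stationary measure \<open>\<mu>\<close>. All rows of \<open>P\<close> in \<open>C\<close> are equal
to \<open>\<nu>\<close>, so \<open>P = J + 1\<^sub>C \<otimes> \<nu>\<close>, and iterating this identity expresses \<open>P\<^sup>n g\<close> through \<open>J\<^sup>n g\<close>, the hitting
probabilities \<open>J\<^sup>k 1\<^sub>C\<close> and the numbers \<open>w\<^sub>m = \<nu>(P\<^sup>m g)\<close> (\<open>markov_op_pow_decomp\<close>). The \<open>w\<^sub>m\<close> solve the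
renewal equation for the law \<open>q\<^sub>k = \<nu>(J\<^sup>k 1\<^sub>C) = Pr(\<tau> = k + 1)\<close> of the return time \<open>\<tau>\<close> to \<open>C\<close>; hence
\<open>w\<^sub>m = \<Sum>\<^sub>j u\<^sub>m\<^sub>-\<^sub>j \<nu>(J\<^sup>j g)\<close> with \<open>u\<close> the renewal sequence of \<open>q\<close>, while stationarity gives
\<open>\<pi>(g) = \<pi>(C) \<Sum>\<^sub>j \<nu>(J\<^sup>j g)\<close>. The drift condition says that \<open>V \<ge> 1\<^sub>C + R J V\<close> with \<open>R = 1 / l\<close>, which bounds all
killed quantities with weights \<open>R\<^sup>n\<close>. So the convergence of \<open>P\<^sup>n g\<close> is reduced to a bound
\<open>\<bar>u\<^sub>n - \<pi>(C)\<bar> r\<^sup>n \<le> K\<^sub>0\<close> (\<open>markov_op_pow_error\<close>, \<open>V_convergence\<close>, \<open>bounded_convergence\<close>).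

That bound is an explicit version of Kendall's theorem. Let \<open>c\<^sub>n = Pr(\<tau> > n)\<close>, \<open>c(z) = \<Sum> c\<^sub>n z\<^sup>n\<close> and
\<open>A = c(1) - 1\<close>. Then \<open>\<Sum> (u\<^sub>n - \<pi>(C)) z\<^sup>n = (1 / c(z) - 1 / c(1)) / (1 - z)\<close>, and Cauchy's inequality on
\<open>\<bar>z\<bar> = r\<close> needs a lower bound for \<open>\<bar>c\<bar>\<close>. On the unit circle \<open>\<bar>c\<bar> \<ge> (1 - b) D(\<alpha>)\<close> if \<open>A = (1 - b) \<alpha>\<close>
(\<open>c_gf_circle\<close>), and moving radially to \<open>\<bar>z\<bar> = r\<close> costs at most \<open>c(r) - c(1) \<le> A (r\<^sup>\<kappa> - 1)\<close>, by
interpolation between \<open>c(1) - 1 = A\<close> and \<open>c(R) - 1 \<le> N - 1\<close>. This yields the first pair.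

For the second pair \<open>\<alpha>\<close> is only known to satisfy \<open>\<alpha> \<le> \<alpha>\<^sub>0\<close>, by Jensen's inequality. If \<open>\<alpha> \<ge> 1\<close>, the first
bound is, up to the factor \<open>\<pi>(C) \<le> 1\<close>, one of those over which the maximum is taken. If \<open>\<alpha> < 1\<close>, the
first bound cannot be compared with its value at \<open>\<alpha> = 1\<close>, as \<open>A (r\<^sup>\<kappa> - 1)\<close> is not monotone in \<open>A\<close>. But then \<open>c(r) - 1 < 1\<close>
for \<open>r < r\<^sub>0\<close>, the equation for \<open>u - \<pi>(C)\<close> is a contraction in the weighted supremum norm, and the resulting bound
is below the value of \<open>K\<^sub>0\<close> at \<open>\<alpha> = 1\<close> (\<open>renewal_seq_rate_short\<close>).

Finally \<open>\<parallel>P\<^sup>n g - \<pi>(g)\<parallel>\<^sub>V \<le> M r\<^sup>-\<^sup>n \<parallel>g\<parallel>\<^sub>V\<close> makes the Neumann series of \<open>P - 1 \<otimes> \<pi>\<close> converge outside the disc of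
radius \<open>1 / r\<close>, which bounds the spectral radius.\<close>

section \<open>Renewal sequences and Kendall's theorem\<close>

text \<open>Here \<open>q k\<close> is the probability of an inter-arrival time \<open>k + 1\<close>, so that arrival times are positive by
construction.\<close>

fun renewal_seq :: "(nat \<Rightarrow> real) \<Rightarrow> nat \<Rightarrow> real" where
  "renewal_seq q n = (if n = 0 then 1 else (\<Sum>k<n. q k * renewal_seq q (n - 1 - k)))"

declare renewal_seq.simps [simp del]

definition survival :: "(nat \<Rightarrow> real) \<Rightarrow> nat \<Rightarrow> real" where
  "survival q n = 1 - (\<Sum>k<n. q k)"

text \<open>The convolution of \<open>\<gamma>\<close> with the renewal sequence solves the renewal equation, by exchanging two sums;
the recursion leaves no other solution.\<close>

lemma renewal_equation_solution:
  fixes w \<gamma> :: "nat \<Rightarrow> 'b::real_vector"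
  assumes w: "\<And>n. w n = \<gamma> n + (\<Sum>k<n. q k *\<^sub>R w (n - 1 - k))"
  shows "w n = (\<Sum>j\<le>n. renewal_seq q (n - j) *\<^sub>R \<gamma> j)"
proof (induction n rule: less_induct)
  case (less n)
  have "(\<Sum>k<n. q k *\<^sub>R w (n - 1 - k))
      = (\<Sum>k<n. \<Sum>j<n-k. (q k * renewal_seq q (n - 1 - k - j)) *\<^sub>R \<gamma> j)"
  proof (rule sum.cong[OF refl])
    fix k assume k: "k \<in> {..<n}"
    then have e: "{..n - Suc k} = {..<n - k}" by auto
    show "q k *\<^sub>R w (n - 1 - k) = (\<Sum>j<n-k. (q k * renewal_seq q (n - 1 - k - j)) *\<^sub>R \<gamma> j)"
      using k by (subst less) (auto simp: e scaleR_right.sum)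
  qed
  also have "\<dots> = (\<Sum>j<n. \<Sum>k<n-j. (q k * renewal_seq q (n - j - 1 - k)) *\<^sub>R \<gamma> j)"
    unfolding sum.Sigma[OF finite_lessThan ballI[OF finite_lessThan]]
    by (rule sum.reindex_bij_witness[of _ "\<lambda>(a,b). (b,a)" "\<lambda>(a,b). (b,a)"])
       (auto simp: algebra_simps)
  also have "\<dots> = (\<Sum>j<n. renewal_seq q (n - j) *\<^sub>R \<gamma> j)"
  proof (rule sum.cong[OF refl])
    fix j assume "j \<in> {..<n}"
    then show "(\<Sum>k<n-j. (q k * renewal_seq q (n - j - 1 - k)) *\<^sub>R \<gamma> j) = renewal_seq q (n - j) *\<^sub>R \<gamma> j"
      by (subst renewal_seq.simps) (auto simp: scaleR_left.sum)
  qed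
  finally show ?case
    by (subst w) (simp add: lessThan_Suc_atMost[symmetric] renewal_seq.simps[of q 0] add.commute)
qed

text \<open>The constant \<open>1\<close> solves the renewal equation driven by the survival function: either no arrival has
happened by time \<open>n\<close>, or there was a last one.\<close>

lemma renewal_seq_conv_survival:
  "(\<Sum>j\<le>n. renewal_seq q (n - j) * survival q j) = 1"
proof -
  have "(\<lambda>_. 1::real) n = (\<Sum>j\<le>n. renewal_seq q (n - j) *\<^sub>R survival q j)"
    by (rule renewal_equation_solution) (auto simp: survival_def)
  then show ?thesis by simp
qed

text \<open>With \<open>T = c(1)\<close> and \<open>s\<^sub>n = \<Sum>\<^bsub>j>n\<^esub> c\<^sub>j\<close> one has \<open>S(z) (1 - z) = T - c(z)\<close>, and the power series \<open>W\<close> of \<open>u\<^sub>n - 1/T\<close> satisfies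
\<open>W c = S / T\<close>. So \<open>u\<^sub>n - 1/T\<close> is a Taylor coefficient of \<open>S / (T c)\<close>, which is holomorphic where \<open>c\<close> has no zeros. The
coefficients of \<open>S\<close> are nonnegative, so on \<open>\<bar>z\<bar> = r\<close> its modulus is largest at the real point \<open>r\<close>, where it is
\<open>(c(r) - T) / (r - 1)\<close>.\<close>

lemma kendall_cauchy_bound:
  fixes c u :: "nat \<Rightarrow> real"
  assumes c0: "c 0 = 1" and c_nonneg: "\<And>n. 0 \<le> c n"
    and summ: "summable (\<lambda>n. c n * R ^ n)" and r: "1 < r" "r < R"
    and ren: "\<And>n. (\<Sum>j\<le>n. u (n - j) * c j) = 1"
    and nz: "\<And>z::complex. cmod z \<le> r \<Longrightarrow> (\<Sum>n. of_real (c n) * z ^ n) \<noteq> 0"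
    and low: "\<And>z::complex. cmod z = r \<Longrightarrow> m \<le> cmod (\<Sum>n. of_real (c n) * z ^ n)"
    and m: "0 < m"
  shows "\<bar>u n - 1 / (\<Sum>n. c n)\<bar> * r ^ n
      \<le> 1 / (\<Sum>n. c n) * (((\<Sum>n. c n * r ^ n) - (\<Sum>n. c n)) / ((r - 1) * m))"
proof -
  define T where "T = (\<Sum>n. c n)"
  define p where "p = 1 / T"
  define s where "s n = T - (\<Sum>j\<le>n. c j)" for n
  define G :: "complex fps" where "G = Abs_fps (\<lambda>n. of_real (c n))"
  define F :: "complex fps" where "F = Abs_fps (\<lambda>n. of_real (s n))"
  define g where "g = eval_fps G"
  have sc: "summable (\<lambda>n. c n * x ^ n)" if "0 \<le> x" "x \<le> R" for x
    using that c_nonneg by (intro summable_comparison_test[OF _ summ])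
      (auto intro!: exI[of _ 0] mult_left_mono power_mono)
  have sc1: "summable c" using sc[of 1] r by simp
  have T1: "1 \<le> T" unfolding T_def using sum_le_suminf[OF sc1, of "{0}"] c0 c_nonneg by simp
  have s_tail: "s n = (\<Sum>j. c (j + Suc n))" for n
    using suminf_split_initial_segment[OF sc1, of "Suc n"]
    by (simp add: s_def T_def lessThan_Suc_atMost)
  have s_nonneg: "0 \<le> s n" for n
    unfolding s_tail by (intro suminf_nonneg summable_ignore_initial_segment sc1 c_nonneg)
  have s_le: "s n * R ^ n \<le> (\<Sum>j. c j * R ^ j)" for n
  proof -
    have "s n * R ^ n = (\<Sum>j. c (j + Suc n) * R ^ n)"
      unfolding s_tail by (intro suminf_mult2 summable_ignore_initial_segment sc1)
    also have "\<dots> \<le> (\<Sum>j. c (j + Suc n) * R ^ (j + Suc n))"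
      using r c_nonneg summable_ignore_initial_segment[OF summ, of "Suc n"]
      by (intro suminf_le mult_left_mono power_increasing summable_mult2
          summable_ignore_initial_segment[OF sc1]) auto
    also have "\<dots> \<le> (\<Sum>j. c j * R ^ j)"
    proof -
      have "0 \<le> (\<Sum>j<Suc n. c j * R ^ j)"
        using r c_nonneg by (intro sum_nonneg mult_nonneg_nonneg) auto
      then show ?thesis
        using suminf_split_initial_segment[OF summ, of "Suc n"] by linarith
    qed
    finally show ?thesis .
  qed
  have radG: "fps_conv_radius G \<ge> ereal R"
  proof -
    have "summable (\<lambda>n. norm (fps_nth G n * of_real R ^ n))"
      using summ c_nonneg r by (simp add: G_def norm_mult norm_power)
    then have "conv_radius (fps_nth G) \<ge> ereal (norm (of_real R :: complex))"
      by (rule conv_radius_geI[OF summable_norm_cancel])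
    with r show ?thesis by (simp add: fps_conv_radius_def)
  qed
  have ssum: "summable (\<lambda>n. s n * x ^ n)" if "0 \<le> x" "x < R" for x
  proof (rule summable_comparison_test')
    show "summable (\<lambda>n. (\<Sum>j. c j * R ^ j) * (x / R) ^ n)"
      using that r by (intro summable_mult summable_geometric) (auto simp: divide_simps)
    show "norm (s n * x ^ n) \<le> (\<Sum>j. c j * R ^ j) * (x / R) ^ n" if "n \<ge> 0" for n
    proof -
      have "s n * x ^ n = (s n * R ^ n) * (x / R) ^ n" using r by (simp add: power_divide)
      also have "\<dots> \<le> (\<Sum>j. c j * R ^ j) * (x / R) ^ n"
        using \<open>0 \<le> x\<close> r by (intro mult_right_mono s_le) auto
      finally show ?thesis using s_nonneg[of n] \<open>0 \<le> x\<close> by simp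
    qed
  qed
  have radF: "fps_conv_radius F \<ge> ereal x" if "0 \<le> x" "x < R" for x
  proof -
    have "summable (\<lambda>n. norm (fps_nth F n * of_real x ^ n))"
      using ssum[OF that] s_nonneg that by (simp add: F_def norm_mult norm_power)
    then have "conv_radius (fps_nth F) \<ge> ereal (norm (of_real x :: complex))"
      by (rule conv_radius_geI[OF summable_norm_cancel])
    with that show ?thesis by (simp add: fps_conv_radius_def)
  qed
  define r' where "r' = (r + R) / 2"
  have r': "r < r'" "r' < R" "0 \<le> r'" using r by (auto simp: r'_def)
  have inF: "ereal (cmod z) < fps_conv_radius F" if "cmod z \<le> r" for z
    using less_le_trans[OF _ radF[OF r'(3,2)], of "ereal (cmod z)"] that r' by simp
  have inG: "ereal (cmod z) < fps_conv_radius G" if "cmod z \<le> r" for z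
    using less_le_trans[OF _ radG, of "ereal (cmod z)"] that r by simp
  have geq: "g z = (\<Sum>n. of_real (c n) * z ^ n)" for z
    by (simp add: g_def G_def eval_fps_def)
  \<comment> \<open>The identity \<open>S(z) (1 - z) = T - c(z)\<close>, read off from the coefficients.\<close>
  have FX: "F * (1 - fps_X) = fps_const (of_real T) - G"
  proof (rule fps_ext)
    fix n show "fps_nth (F * (1 - fps_X)) n = fps_nth (fps_const (of_real T) - G) n"
      by (cases n) (simp_all add: F_def G_def s_def c0 algebra_simps)
  qed
  have Feq: "eval_fps F z * (1 - z) = of_real T - g z" if "cmod z \<le> r" for z
  proof -
    have "eval_fps (F * (1 - fps_X)) z = eval_fps F z * eval_fps (1 - fps_X) z"
      using inF[OF that] fps_conv_radius_diff[of "1::complex fps" fps_X] by (intro eval_fps_mult) auto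
    moreover have "eval_fps (1 - fps_X) z = 1 - z" 
      by (subst eval_fps_diff) auto
    moreover have "eval_fps (fps_const (of_real T) - G) z = of_real T - g z"
      using inG[OF that] by (subst eval_fps_diff) (auto simp: g_def)
    ultimately show ?thesis by (simp add: FX)
  qed
  have Fr: "(\<Sum>n. s n * r ^ n) = ((\<Sum>n. c n * r ^ n) - T) / (r - 1)"
  proof -
    have "eval_fps F (of_real r) = of_real (\<Sum>n. s n * r ^ n)"
      using r ssum[of r] by (simp add: eval_fps_def F_def suminf_of_real flip: of_real_mult of_real_power)
    moreover have "g (of_real r) = of_real (\<Sum>n. c n * r ^ n)"
      using r sc[of r] by (simp add: geq suminf_of_real flip: of_real_mult of_real_power)
    ultimately have "of_real ((\<Sum>n. s n * r ^ n) * (1 - r)) = (of_real (T - (\<Sum>n. c n * r ^ n)) :: complex)"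
      using Feq[of "of_real r"] r by simp
    then have "(\<Sum>n. s n * r ^ n) * (1 - r) = T - (\<Sum>n. c n * r ^ n)"
      using of_real_eq_iff by blast
    then show ?thesis using r by (simp add: field_simps)
  qed
  have F_le: "cmod (eval_fps F z) \<le> ((\<Sum>n. c n * r ^ n) - T) / (r - 1)" if "cmod z = r" for z
  proof -
    have "cmod (eval_fps F z) \<le> (\<Sum>n. norm (fps_nth F n * z ^ n))"
      unfolding eval_fps_def using ssum[of r] r that s_nonneg
      by (intro summable_norm) (simp add: F_def norm_mult norm_power)
    also have "\<dots> = (\<Sum>n. s n * r ^ n)" using that s_nonneg by (simp add: F_def norm_mult norm_power)
    finally show ?thesis by (simp add: Fr)
  qed
  define h where "h z = of_real p * eval_fps F z * inverse (g z)" for z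
  define H where "H = fps_const (of_real p) * F * inverse G"
  have G0: "fps_nth G 0 = 1" by (simp add: G_def c0)
  have hasG: "g has_fps_expansion G"
    unfolding g_def using less_le_trans[OF _ radG, of 0] r by (simp add: has_fps_expansion_def zero_ereal_def)
  have hasF: "eval_fps F has_fps_expansion F"
    using less_le_trans[OF _ radF[OF r'(3,2)], of 0] r r' by (simp add: has_fps_expansion_def zero_ereal_def)
  have hasH: "h has_fps_expansion H"
    unfolding h_def H_def using G0 by (intro has_fps_expansion_mult has_fps_expansion_inverse has_fps_expansion_const hasG hasF) auto
  have HG: "H * G = fps_const (of_real p) * F"
    unfolding H_def using inverse_mult_eq_1[of G] G0 by (simp add: mult.assoc)
  define W :: "complex fps" where "W = Abs_fps (\<lambda>n. of_real (u n - p))"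
  have "W * G = fps_const (of_real p) * F"
  proof (rule fps_ext)
    fix n
    have "(\<Sum>i\<le>n. (u i - p) * c (n - i)) = (\<Sum>i\<le>n. (u (n - i) - p) * c i)"
      by (rule sum.reindex_bij_witness[of _ "\<lambda>i. n - i" "\<lambda>i. n - i"]) auto
    also have "\<dots> = 1 - p * (\<Sum>i\<le>n. c i)"
      by (simp add: algebra_simps sum_subtractf ren[simplified mult.commute] sum_distrib_left)
    also have "\<dots> = p * s n" using T1 by (simp add: s_def p_def algebra_simps)
    finally show "fps_nth (W * G) n = fps_nth (fps_const (of_real p) * F) n"
      unfolding fps_mult_left_const_nth
      by (simp add: W_def G_def F_def fps_mult_nth atLeast0AtMost flip: of_real_mult of_real_sum of_real_diff)
  qed
  then have "W * G = H * G" using HG by simp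
  moreover have "G \<noteq> 0" using G0 by auto
  ultimately have WH: "W = H" by simp
  have coeff: "fps_nth H n = (deriv ^^ n) h 0 / fact n"
    using fps_nth_fps_expansion[OF hasH] .
  define X where "X = p * (((\<Sum>n. c n * r ^ n) - T) / ((r - 1) * m))"
  have "norm ((deriv ^^ n) h 0) \<le> fact n * X / r ^ n"
  proof (rule Cauchy_inequality)
    have hol: "eval_fps F holomorphic_on cball 0 r" "g holomorphic_on cball 0 r"
      unfolding g_def using inF inG by (auto intro!: holomorphic_on_eval_fps simp: subset_iff in_eball_iff)
    then have "h holomorphic_on cball 0 r"
      unfolding h_def using nz
      by (intro holomorphic_on_mult holomorphic_on_inverse holomorphic_on_const hol) (simp add: geq)
    then show "h holomorphic_on ball 0 r" "continuous_on (cball 0 r) h"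
      by (auto intro: holomorphic_on_subset holomorphic_on_imp_continuous_on)
    fix z :: complex assume "norm (0 - z) = r"
    then have z: "cmod z = r" by simp
    have "norm (h z) = p * cmod (eval_fps F z) / cmod (g z)"
      using T1 by (simp add: h_def norm_mult norm_inverse divide_inverse p_def)
    also have "\<dots> \<le> p * (((\<Sum>n. c n * r ^ n) - T) / (r - 1)) / m"
      using F_le[OF z] low[OF z] m T1 unfolding geq p_def
      by (intro frac_le mult_left_mono mult_nonneg_nonneg order_trans[OF norm_ge_zero F_le[OF z]]) auto
    finally show "norm (h z) \<le> X" by (simp add: X_def)
  qed (use r in auto)
  then have "norm (fps_nth H n) * r ^ n \<le> X"
    using r by (simp add: coeff norm_divide pos_divide_le_eq pos_le_divide_eq mult_ac)
  then show ?thesis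
    unfolding WH[symmetric] by (simp add: X_def W_def p_def T_def flip: of_real_diff)
qed

section \<open>A lower bound for one minus a return generating function on the unit circle\<close>

lemma concave_on_sin: "concave_on {0..pi} (sin :: real \<Rightarrow> real)"
  unfolding concave_on_def
proof (rule f''_ge0_imp_convex[where f' = "\<lambda>x. - cos x" and f'' = "sin"])
  show "((\<lambda>x. - sin x) has_real_derivative - cos x) (at x)" for x :: real
    by (auto intro!: derivative_eq_intros)
  show "((\<lambda>x. - cos x) has_real_derivative sin x) (at x)" for x :: real
    by (auto intro!: derivative_eq_intros)
qed (auto intro: sin_ge_zero)

text \<open>Concavity of the sine on \<open>[0, \<pi>]\<close>, where it vanishes at \<open>0\<close>.\<close>

lemma sin_scale_ge:
  assumes "0 \<le> k" "k \<le> 1" "0 \<le> x" "x \<le> pi"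
  shows "k * sin x \<le> sin (k * x)"
  using concave_onD[OF concave_on_sin, of k 0 x] assms by simp

text \<open>For \<open>\<beta> = b / (1 - b)\<close>, \<open>e = \<beta> (1 + \<beta>)\<close> and \<open>s = \<bar>1 - z\<bar>\<close> with \<open>\<bar>z\<bar> = 1\<close>, this is \<open>\<bar>1 + \<beta> (1 - z)\<bar> - 1\<close>, the numerator
of \<open>D(\<alpha>)\<close>.\<close>

definition sqrt_excess :: "real \<Rightarrow> real \<Rightarrow> real" where
  "sqrt_excess e s = sqrt (1 + e * s\<^sup>2) - 1"

text \<open>\<open>D\<close> as a function of the chord length: the quotient is \<open>e / (\<surd>(1/s\<^sup>2 + e) + 1/s)\<close>, whose denominator
decreases in \<open>s\<close>.\<close>

lemma sqrt_excess_ratio_mono: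
  assumes "0 \<le> e" "0 < s" "s \<le> t"
  shows "sqrt_excess e s / s \<le> sqrt_excess e t / t"
proof -
  define h where "h = (\<lambda>x. sqrt (1 / x\<^sup>2 + e) - 1 / x)"
  have h: "sqrt_excess e x / x = h x" if "0 < x" for x
  proof -
    have "sqrt (1 + e * x\<^sup>2) = x * sqrt (1 / x\<^sup>2 + e)"
    proof -
      have "1 + e * x\<^sup>2 = x\<^sup>2 * (1 / x\<^sup>2 + e)" using that by (simp add: field_simps)
      then show ?thesis using that by (metis abs_of_pos real_sqrt_abs real_sqrt_mult)
    qed
    then show ?thesis using that by (simp add: h_def sqrt_excess_def diff_divide_distrib)
  qed
  have "h s \<le> h t"
  proof (cases "e = 0")
    case True then show ?thesis using assms by (simp add: h_def real_sqrt_divide)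
  next
    case False
    have 1: "h x = e / (sqrt (1 / x\<^sup>2 + e) + 1 / x)" if "0 < x" for x
    proof -
      have "sqrt (1 / x\<^sup>2 + e) + 1 / x > 0" using that assms by (intro add_nonneg_pos) auto
      moreover have "h x * (sqrt (1 / x\<^sup>2 + e) + 1 / x) = e"
        using that assms by (simp add: h_def algebra_simps power2_eq_square)
      ultimately show ?thesis by (simp add: field_simps)
    qed
    have p: "0 < sqrt (1 / t\<^sup>2 + e) + 1 / t" using assms by (intro add_nonneg_pos) auto
    have "sqrt (1 / t\<^sup>2 + e) \<le> sqrt (1 / s\<^sup>2 + e)" "1 / t \<le> 1 / s"
      using assms by (auto intro!: frac_le power_mono)
    then have "sqrt (1 / t\<^sup>2 + e) + 1 / t \<le> sqrt (1 / s\<^sup>2 + e) + 1 / s" by (intro add_mono) auto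
    then show ?thesis using p assms by (simp add: 1) (intro divide_left_mono mult_pos_pos, auto)
  qed
  then show ?thesis using assms by (simp add: h)
qed

text \<open>The modulus depends on the angle only through the chord \<open>\<bar>1 - cis \<phi>\<bar> = 2 \<bar>sin (\<phi>/2)\<bar>\<close>.\<close>

lemma norm_one_plus_tangent:
  "cmod (1 + of_real \<beta> * (1 - cis \<phi>)) = sqrt (1 + \<beta> * (1 + \<beta>) * (2 * sin (\<phi> / 2))\<^sup>2)"
proof -
  have c: "cos \<phi> = 1 - 2 * (sin (\<phi>/2))\<^sup>2" using cos_double_sin[of "\<phi>/2"] by simp
  have "(1 + \<beta> * (1 - cos \<phi>))\<^sup>2 + (\<beta> * sin \<phi>)\<^sup>2
     = 1 + \<beta> * (1 + \<beta>) * (2 * (1 - cos \<phi>)) + \<beta>\<^sup>2 * ((cos \<phi>)\<^sup>2 + (sin \<phi>)\<^sup>2 - 1)"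
    by algebra
  also have "\<dots> = 1 + \<beta> * (1 + \<beta>) * (2 * sin (\<phi> / 2))\<^sup>2"
    by (simp only: sin_cos_squared_add2) (simp add: c power2_eq_square)
  finally show ?thesis by (simp add: cmod_def)
qed

lemma norm_one_minus_cis: "cmod (1 - cis \<phi>) = \<bar>2 * sin (\<phi> / 2)\<bar>"
  using dist_exp_i_1[of \<phi>] by (simp add: cis_conv_exp norm_minus_commute)

lemma D_fun_closed_form:
  fixes b \<alpha> :: real
  assumes "b < 1" "0 < \<alpha>"
  shows "D_fun b \<alpha> = sqrt_excess (b / (1 - b)\<^sup>2) (2 * sin (pi / (1 + \<alpha>) / 2)) / (2 * sin (pi / (1 + \<alpha>) / 2))"
proof -
  let ?\<phi> = "pi / (1 + \<alpha>)"
  have "0 < sin (?\<phi> / 2)" using assms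
    by (intro sin_gt_zero) (auto simp: divide_simps intro!: add_pos_pos mult_pos_pos)
  moreover have "b / (1 - b) * (1 + b / (1 - b)) = b / (1 - b)\<^sup>2"
    using assms by (simp add: field_simps power2_eq_square)
  ultimately show ?thesis
    unfolding D_fun_def cis_conv_exp[symmetric] norm_one_plus_tangent norm_one_minus_cis
    by (simp add: sqrt_excess_def cis_conv_exp)
qed

lemma half_angle_pos:
  assumes "0 < (\<alpha>::real)" shows "0 < sin (pi / (1 + \<alpha>) / 2)"
  using assms by (intro sin_gt_zero) (auto simp: divide_simps intro!: add_pos_pos mult_pos_pos)

lemma D_fun_pos:
  assumes "0 < b" "b < 1" "0 < \<alpha>" shows "0 < D_fun b \<alpha>"
  using assms half_angle_pos[of \<alpha>]
  by (simp add: D_fun_closed_form sqrt_excess_def divide_simps)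

text \<open>\<open>\<bar>1 + \<beta> (1 - z)\<bar> \<le> 1 + \<beta> \<bar>1 - z\<bar>\<close>, so \<open>D(\<alpha>) \<le> \<beta> = b / (1 - b)\<close>.\<close>

lemma D_fun_le: 
  assumes "0 < b" "b < 1" "0 < \<alpha>" shows "(1 - b) * D_fun b \<alpha> \<le> b"
proof -
  define \<beta> where "\<beta> = b / (1 - b)"
  define s where "s = 2 * sin (pi / (1 + \<alpha>) / 2)"
  have s: "0 < s" "s \<le> 2" using half_angle_pos[of \<alpha>] assms by (auto simp: s_def)
  have b0: "0 < \<beta>" using assms by (simp add: \<beta>_def)
  have "b / (1 - b)\<^sup>2 = \<beta> + \<beta>\<^sup>2"
    using assms by (simp add: \<beta>_def divide_simps) (simp add: algebra_simps power2_eq_square)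
  then have "1 + b / (1 - b)\<^sup>2 * s\<^sup>2 = 1 + \<beta> * s\<^sup>2 + \<beta>\<^sup>2 * s\<^sup>2"
    by (simp add: algebra_simps)
  also have "\<dots> \<le> (1 + \<beta> * s)\<^sup>2"
    using s b0 mult_left_mono[of s 2 "\<beta> * s"] by (simp add: power2_eq_square algebra_simps)
  finally have "sqrt (1 + b / (1 - b)\<^sup>2 * s\<^sup>2) \<le> 1 + \<beta> * s"
    using b0 s by (intro real_le_lsqrt) auto
  then have "sqrt_excess (b / (1 - b)\<^sup>2) s / s \<le> \<beta>"
    using s by (simp add: sqrt_excess_def pos_divide_le_eq)
  then have "D_fun b \<alpha> \<le> \<beta>"
    using D_fun_closed_form[OF assms(2,3)] by (simp only: s_def)
  then show ?thesis using assms by (simp add: \<beta>_def field_simps)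
qed


text \<open>\<open>h t\<close> is the inner product of the vector \<open>(\<rho>x, - \<rho>y)\<close> in the fourth quadrant with the unit vector of angle
\<open>t\<close>. Starting from the angle \<open>\<theta>/2\<close>, it does not exceed \<open>h (\<theta>/2)\<close> as long as one turns by at most
\<open>\<pi> - \<theta>\<close>, and it never exceeds \<open>\<rho>\<close>. Both facts together give an affine bound in the number \<open>j\<close> of steps, which
can be averaged knowing only the mean of \<open>j\<close>.\<close>

lemma projection_le_affine:
  fixes \<theta> \<rho>x \<rho>y :: real and j :: nat
  assumes th: "0 < \<theta>" "\<theta> < pi" and rho: "0 \<le> \<rho>x" "0 \<le> \<rho>y"
  defines "h \<equiv> \<lambda>t. \<rho>x * cos t - \<rho>y * sin t" and "\<rho> \<equiv> sqrt (\<rho>x\<^sup>2 + \<rho>y\<^sup>2)"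
  shows "h (real j * \<theta> + \<theta> / 2) \<le> h (\<theta> / 2) + (\<rho> - h (\<theta> / 2)) * (real j * \<theta> / (pi - \<theta>))"
    and "h t \<le> \<rho>"
proof -
  have h_le: "h t \<le> \<rho>" for t
  proof -
    have "(h t)\<^sup>2 + (\<rho>x * sin t + \<rho>y * cos t)\<^sup>2 = (\<rho>x\<^sup>2 + \<rho>y\<^sup>2) * ((sin t)\<^sup>2 + (cos t)\<^sup>2)"
      unfolding h_def by algebra
    then have "(h t)\<^sup>2 + (\<rho>x * sin t + \<rho>y * cos t)\<^sup>2 = \<rho>x\<^sup>2 + \<rho>y\<^sup>2"
      by (simp only: sin_cos_squared_add mult_1_right)
    then have "(h t)\<^sup>2 \<le> \<rho>x\<^sup>2 + \<rho>y\<^sup>2"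
      using zero_le_power2[of "\<rho>x * sin t + \<rho>y * cos t"] by linarith
    then show ?thesis unfolding \<rho>_def by (rule real_le_rsqrt)
  qed
  then show "h t \<le> \<rho>" .
  define Y where "Y = real j * \<theta>"
  have Y0: "0 \<le> Y" using th by (simp add: Y_def)
  show "h (real j * \<theta> + \<theta> / 2) \<le> h (\<theta> / 2) + (\<rho> - h (\<theta> / 2)) * (real j * \<theta> / (pi - \<theta>))"
  proof (cases "Y \<le> pi - \<theta>")
    case True
    have "h (Y + \<theta> / 2) - h (\<theta> / 2) = - 2 * sin (Y / 2) * (\<rho>x * sin ((Y + \<theta>) / 2) + \<rho>y * cos ((Y + \<theta>) / 2))"
    proof -
      have 1: "cos (Y + \<theta> / 2) - cos (\<theta> / 2) = - 2 * sin ((Y + \<theta>) / 2) * sin (Y / 2)"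
      proof -
        have "(Y + \<theta> / 2 + \<theta> / 2) / 2 = (Y + \<theta>) / 2" "(\<theta> / 2 - (Y + \<theta> / 2)) / 2 = - (Y / 2)"
          by (simp_all add: field_simps)
        then show ?thesis using cos_diff_cos[of "Y + \<theta> / 2" "\<theta> / 2"] by (simp only: sin_minus)
      qed
      have 2: "sin (Y + \<theta> / 2) - sin (\<theta> / 2) = 2 * sin (Y / 2) * cos ((Y + \<theta>) / 2)"
      proof -
        have "(Y + \<theta> / 2 + \<theta> / 2) / 2 = (Y + \<theta>) / 2" "(Y + \<theta> / 2 - \<theta> / 2) / 2 = Y / 2"
          by (simp_all add: field_simps)
        then show ?thesis using sin_diff_sin[of "Y + \<theta> / 2" "\<theta> / 2"] by (simp only:)
      qed
      have "h (Y + \<theta> / 2) - h (\<theta> / 2)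
        = \<rho>x * (cos (Y + \<theta> / 2) - cos (\<theta> / 2)) - \<rho>y * (sin (Y + \<theta> / 2) - sin (\<theta> / 2))"
        by (simp add: h_def algebra_simps)
      then show ?thesis unfolding 1 2 by (simp add: algebra_simps)
    qed
    moreover have "0 \<le> sin (Y / 2)" using Y0 True th by (intro sin_ge_zero) auto
    moreover have "0 \<le> sin ((Y + \<theta>) / 2)" using Y0 True th by (intro sin_ge_zero) auto
    moreover have "0 \<le> cos ((Y + \<theta>) / 2)" using Y0 True th by (intro cos_ge_zero) auto
    ultimately have "h (Y + \<theta> / 2) - h (\<theta> / 2) \<le> 0" using rho by (simp add: mult_nonneg_nonneg)
    moreover have "0 \<le> (\<rho> - h (\<theta> / 2)) * (Y / (pi - \<theta>))"
      using h_le[of "\<theta> / 2"] Y0 th by (intro mult_nonneg_nonneg) auto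
    ultimately show ?thesis by (simp add: Y_def)
  next
    case False
    then have "(\<rho> - h (\<theta> / 2)) * 1 \<le> (\<rho> - h (\<theta> / 2)) * (Y / (pi - \<theta>))"
      using h_le[of "\<theta> / 2"] th by (intro mult_left_mono) auto
    then show ?thesis using h_le[of "Y + \<theta> / 2"] by (simp add: Y_def)
  qed
qed

text \<open>Small angles, where the triangle inequality is too weak and the mean \<open>\<alpha>\<close> of \<open>g\<close> has to be used. After
rotation by \<open>- \<theta>/2\<close> the series becomes \<open>\<Sum>\<^sub>j g\<^sub>j cis (j \<theta> + \<theta>/2)\<close>; for it to come close to the point
\<open>1 + \<beta> (1 - z)\<close> a large part of the mass must have turned by more than \<open>\<pi> - \<theta>\<close>, and by Markov's inequality
this part is at most \<open>k = (1 + \<alpha>) \<theta> / \<pi>\<close>. Projecting on the direction of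
\<open>(\<rho>x, - \<rho>y) = (k cos (\<theta>/2), - (2 (1 + \<beta>) - k) sin (\<theta>/2))\<close> gives the lower bound \<open>\<rho> - k\<close>. This vector is the rotated
\<open>1 + \<beta> (1 - z)\<close> minus \<open>1 - k\<close> times \<open>cis (\<theta>/2)\<close>: it is the residual that remains when the mass \<open>1 - k\<close> stays at \<open>j = 0\<close>.\<close>

lemma norm_one_minus_return_gf_small_angle:
  fixes g :: "nat \<Rightarrow> real" and \<alpha> \<beta> \<theta> :: real
  assumes g: "\<And>j. 0 \<le> g j" "g sums 1" "(\<lambda>j. real j * g j) sums \<alpha>"
    and a: "0 < \<alpha>" and b0: "0 < \<beta>" and th: "0 < \<theta>" "(1 + \<alpha>) * \<theta> < pi"
  defines "k \<equiv> (1 + \<alpha>) * \<theta> / pi"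
  shows "sqrt (k\<^sup>2 + \<beta> * (1 + \<beta>) * (2 * sin (\<theta> / 2))\<^sup>2) - k
    \<le> cmod (1 + of_real \<beta> * (1 - cis \<theta>) - (\<Sum>j. of_real (g j) * cis \<theta> ^ Suc j))"
proof -
  define x where "x = cos (\<theta> / 2)"
  define y where "y = sin (\<theta> / 2)"
  have thpi: "\<theta> < pi" using th a by (smt (verit, best) mult_less_cancel_right2)
  have xy: "0 < x" "0 < y" "x\<^sup>2 + y\<^sup>2 = 1"
    unfolding x_def y_def using th thpi by (auto intro!: cos_gt_zero sin_gt_zero)
  have k: "0 < k" "k < 1" using th a by (auto simp: k_def divide_simps)
  define \<rho>x where "\<rho>x = k * x"
  define \<rho>y where "\<rho>y = (2 * (1 + \<beta>) - k) * y"
  define \<rho> where "\<rho> = sqrt (\<rho>x\<^sup>2 + \<rho>y\<^sup>2)"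
  define h where "h t = \<rho>x * cos t - \<rho>y * sin t" for t
  have rxy: "0 < \<rho>x" "0 < \<rho>y" using k xy b0 by (auto simp: \<rho>x_def \<rho>y_def)
  have rho_pos: "0 < \<rho>" unfolding \<rho>_def using rxy by (intro real_sqrt_gt_zero add_pos_pos) auto
  have rho2: "\<rho>\<^sup>2 = \<rho>x\<^sup>2 + \<rho>y\<^sup>2" by (simp add: \<rho>_def)
  define G where "G = (\<Sum>j. of_real (g j) * cis \<theta> ^ Suc j)"
  define U where "U = cis (- \<theta> / 2)"
  define c where "c = Complex \<rho>x \<rho>y"
  have sG: "summable (\<lambda>j. of_real (g j) * cis \<theta> ^ Suc j)"
    using g(1) sums_summable[OF g(2)] 
    by (intro summable_norm_cancel[where f = "\<lambda>j. of_real (g j) * cis \<theta> ^ Suc j"])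
       (simp add: norm_mult norm_power del: power_Suc)
  have term_eq: "Re (c * (of_real (g j) * cis \<theta> ^ Suc j * U)) = g j * h (real j * \<theta> + \<theta> / 2)" for j
  proof -
    have "cis \<theta> ^ Suc j * U = cis (real (Suc j) * \<theta> + - \<theta> / 2)"
      by (simp only: U_def Complex.DeMoivre cis_mult)
    also have "real (Suc j) * \<theta> + - \<theta> / 2 = real j * \<theta> + \<theta> / 2"
      by (simp add: field_simps)
    finally have "cis \<theta> ^ Suc j * U = cis (real j * \<theta> + \<theta> / 2)" .
    moreover have "c * (of_real (g j) * cis \<theta> ^ Suc j * U) = of_real (g j) * (c * (cis \<theta> ^ Suc j * U))"
      by (simp only: mult_ac)
    ultimately have e: "c * (of_real (g j) * cis \<theta> ^ Suc j * U) = of_real (g j) * (c * cis (real j * \<theta> + \<theta> / 2))"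
      by (simp only:)
    show ?thesis unfolding e by (simp add: c_def h_def)
  qed
  have sums_h: "(\<lambda>j. g j * h (real j * \<theta> + \<theta> / 2)) sums Re (c * (G * U))"
    unfolding term_eq[symmetric] G_def
    by (intro sums_Re sums_mult sums_mult2 summable_sums sG)
  have "Re (c * (G * U)) \<le> h (\<theta> / 2) * 1 + (\<rho> - h (\<theta> / 2)) * (\<theta> / (pi - \<theta>)) * \<alpha>"
  proof (rule sums_le[OF _ sums_h])
    show "(\<lambda>j. h (\<theta> / 2) * g j + (\<rho> - h (\<theta> / 2)) * (\<theta> / (pi - \<theta>)) * (real j * g j)) sums
       (h (\<theta> / 2) * 1 + (\<rho> - h (\<theta> / 2)) * (\<theta> / (pi - \<theta>)) * \<alpha>)"
      by (intro sums_add sums_mult g)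
    fix j
    have "g j * h (real j * \<theta> + \<theta> / 2) \<le> g j * (h (\<theta> / 2) + (\<rho> - h (\<theta> / 2)) * (real j * \<theta> / (pi - \<theta>)))"
      unfolding h_def \<rho>_def using th thpi rxy by (intro mult_left_mono projection_le_affine g) auto
    also have "\<dots> = h (\<theta> / 2) * g j + (\<rho> - h (\<theta> / 2)) * (\<theta> / (pi - \<theta>)) * (real j * g j)"
      unfolding times_divide_eq_right[symmetric, of "real j"] by (simp only: ring_distribs mult_ac)
    finally show "g j * h (real j * \<theta> + \<theta> / 2)
      \<le> h (\<theta> / 2) * g j + (\<rho> - h (\<theta> / 2)) * (\<theta> / (pi - \<theta>)) * (real j * g j)" .
  qed
  also have "\<dots> \<le> h (\<theta> / 2) + (\<rho> - h (\<theta> / 2)) * k"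
  proof -
    \<comment> \<open>Markov's inequality for turning by more than \<open>\<pi> - \<theta>\<close>: the bound \<open>\<alpha> \<theta> / (\<pi> - \<theta>)\<close> is at most \<open>k\<close>.\<close>
    have "k * (pi - \<theta>) = \<theta> * \<alpha> + \<theta> * (1 - k)" by (simp add: k_def field_simps)
    then have "\<theta> * \<alpha> \<le> k * (pi - \<theta>)" using k th by simp
    then have "\<theta> / (pi - \<theta>) * \<alpha> \<le> k" using thpi by (simp add: pos_divide_le_eq)
    moreover have "h (\<theta> / 2) \<le> \<rho>"
      unfolding h_def \<rho>_def using th thpi rxy by (intro projection_le_affine(2)[of \<theta>]) auto
    ultimately have "(\<rho> - h (\<theta> / 2)) * (\<theta> / (pi - \<theta>) * \<alpha>) \<le> (\<rho> - h (\<theta> / 2)) * k"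
      by (intro mult_left_mono) auto
    then show ?thesis by (simp add: mult.assoc)
  qed
  finally have G_le: "Re (c * (G * U)) \<le> (1 - k) * h (\<theta> / 2) + k * \<rho>" by (simp add: algebra_simps)
  have "(1 + of_real \<beta> * (1 - cis \<theta>)) * U = Complex x (- (1 + 2 * \<beta>) * y)"
  proof -
    have "cis \<theta> * U = cis (\<theta> / 2)" by (simp add: U_def cis_mult)
    then have "(1 + of_real \<beta> * (1 - cis \<theta>)) * U = U + of_real \<beta> * (U - cis (\<theta> / 2))"
      by (metis (no_types, opaque_lifting) distrib_right left_diff_distrib mult.assoc mult_1)
    also have "\<dots> = Complex x (- (1 + 2 * \<beta>) * y)"
      by (simp add: U_def complex_eq_iff x_def y_def algebra_simps)
    finally show ?thesis .
  qed
  then have "Re (c * ((1 + of_real \<beta> * (1 - cis \<theta>)) * U)) = \<rho>x * x + \<rho>y * ((1 + 2 * \<beta>) * y)"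
    by (simp add: c_def algebra_simps)
  moreover have "(1 + of_real \<beta> * (1 - cis \<theta>) - G) * U = (1 + of_real \<beta> * (1 - cis \<theta>)) * U - G * U"
    by (simp add: algebra_simps)
  ultimately have "\<rho>x * x + \<rho>y * ((1 + 2 * \<beta>) * y) - ((1 - k) * h (\<theta> / 2) + k * \<rho>)
    \<le> Re (c * ((1 + of_real \<beta> * (1 - cis \<theta>) - G) * U))"
    using G_le by (simp add: right_diff_distrib)
  also have "\<dots> \<le> cmod (c * ((1 + of_real \<beta> * (1 - cis \<theta>) - G) * U))" by (rule complex_Re_le_cmod)
  also have "\<dots> = \<rho> * cmod (1 + of_real \<beta> * (1 - cis \<theta>) - G)"
  proof -
    have "cmod c = \<rho>" "cmod U = 1" by (simp_all add: c_def \<rho>_def U_def cmod_def)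
    then show ?thesis by (simp only: norm_mult mult_1_right)
  qed
  finally have main: "\<rho>x * x + \<rho>y * ((1 + 2 * \<beta>) * y) - ((1 - k) * h (\<theta> / 2) + k * \<rho>)
    \<le> \<rho> * cmod (1 + of_real \<beta> * (1 - cis \<theta>) - G)" .
  have "\<rho>x * x + \<rho>y * ((1 + 2 * \<beta>) * y) - (1 - k) * h (\<theta> / 2) = \<rho>\<^sup>2"
    unfolding rho2 h_def x_def[symmetric] y_def[symmetric] unfolding \<rho>x_def \<rho>y_def
    by (simp add: algebra_simps power2_eq_square)
  with main have "\<rho> * (\<rho> - k) \<le> \<rho> * cmod (1 + of_real \<beta> * (1 - cis \<theta>) - G)"
    by (simp add: algebra_simps power2_eq_square)
  then have "\<rho> - k \<le> cmod (1 + of_real \<beta> * (1 - cis \<theta>) - G)" using rho_pos by simp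
  moreover have "sqrt (k\<^sup>2 + \<beta> * (1 + \<beta>) * (2 * y)\<^sup>2) \<le> \<rho>"
  proof -
    have "\<rho>x\<^sup>2 + \<rho>y\<^sup>2 = k\<^sup>2 * (x\<^sup>2 + y\<^sup>2) + (1 + \<beta>) * (1 + \<beta> - k) * (2 * y)\<^sup>2"
      unfolding \<rho>x_def \<rho>y_def by (simp add: algebra_simps power2_eq_square)
    moreover have "(1 + \<beta>) * \<beta> * (2 * y)\<^sup>2 \<le> (1 + \<beta>) * (1 + \<beta> - k) * (2 * y)\<^sup>2"
      using k b0 by (intro mult_right_mono mult_left_mono) auto
    ultimately show ?thesis unfolding \<rho>_def by (simp add: xy mult.commute)
  qed
  ultimately show ?thesis by (simp add: G_def y_def)
qed

text \<open>The atom \<open>b\<close> of \<open>q\<close> at \<open>0\<close> is split off, \<open>q = b \<delta>\<^sub>0 + (1 - b) g\<close>. If \<open>(1 + \<alpha>) \<theta> \<ge> \<pi>\<close>, the chord is at least the one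
that enters \<open>D(\<alpha>)\<close> and \<open>\<bar>\<Sum>\<^sub>j g\<^sub>j z\<^bsup>j+1\<^esup>\<bar> \<le> 1\<close> suffices. Otherwise the small-angle bound is \<open>k\<close> times the numerator of \<open>D\<close>
at the chord \<open>s / k\<close>, which is at least the chord of angle \<open>\<pi> / (1 + \<alpha>) = \<theta> / k\<close>.\<close>

lemma norm_one_minus_return_gf_ge:
  fixes q :: "nat \<Rightarrow> real" and \<alpha> b \<theta> :: real
  assumes b: "0 < b" "b < 1" "b \<le> q 0" and q: "\<And>j. 0 \<le> q j" "q sums 1" "(\<lambda>j. real j * q j) sums ((1 - b) * \<alpha>)"
    and a: "0 < \<alpha>" and th: "0 < \<theta>" "\<theta> \<le> pi"
  shows "(1 - b) * D_fun b \<alpha> * cmod (1 - cis \<theta>) \<le> cmod (1 - (\<Sum>j. of_real (q j) * cis \<theta> ^ Suc j))"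
proof -
  define g where "g j = (q j - (if j = 0 then b else 0)) / (1 - b)" for j
  define \<beta> where "\<beta> = b / (1 - b)"
  define e where "e = \<beta> * (1 + \<beta>)"
  define s where "s = 2 * sin (\<theta> / 2)"
  define s\<alpha> where "s\<alpha> = 2 * sin (pi / (1 + \<alpha>) / 2)"
  define G where "G = (\<Sum>j. of_real (g j) * cis \<theta> ^ Suc j)"
  have b0: "0 < \<beta>" using b by (simp add: \<beta>_def)
  have e0: "0 \<le> e" using b0 by (simp add: e_def)
  have g_nonneg: "0 \<le> g j" for j using b q by (simp add: g_def)
  have sing: "(\<lambda>j. if j = 0 then b else 0) sums b"
    using sums_single[of 0 "\<lambda>_. b"] by simp
  have g_sums: "g sums 1"
    using sums_divide[OF sums_diff[OF q(2) sing], of "1 - b"] b by (simp add: g_def[abs_def])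
  have g_mean: "(\<lambda>j. real j * g j) sums \<alpha>"
  proof -
    have "(\<lambda>j. real j * q j / (1 - b)) sums \<alpha>" using sums_divide[OF q(3), of "1 - b"] b by simp
    moreover have "(\<lambda>j. real j * g j) = (\<lambda>j. real j * q j / (1 - b))" by (auto simp: g_def)
    ultimately show ?thesis by simp
  qed
  have summ: "summable (\<lambda>j. of_real (f j) * cis \<theta> ^ Suc j)" if "\<And>j. 0 \<le> f j" "summable f" for f
    using that by (intro summable_norm_cancel[where f = "\<lambda>j. of_real (f j) * cis \<theta> ^ Suc j"])
       (simp add: norm_mult norm_power del: power_Suc)
  have Gsums: "(\<lambda>j. of_real (g j) * cis \<theta> ^ Suc j) sums G"
    unfolding G_def using summ[OF g_nonneg sums_summable[OF g_sums]] by (rule summable_sums)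
  have "(\<lambda>j. of_real (1 - b) * (of_real (g j) * cis \<theta> ^ Suc j) + (if j = 0 then of_real b * cis \<theta> else 0))
      sums (of_real (1 - b) * G + of_real b * cis \<theta>)"
    using sums_single[of 0 "\<lambda>_. of_real b * cis \<theta>"] by (intro sums_add sums_mult Gsums) auto
  moreover have "of_real (1 - b) * (of_real (g j) * cis \<theta> ^ Suc j) + (if j = 0 then of_real b * cis \<theta> else 0)
      = of_real (q j) * cis \<theta> ^ Suc j" for j
    using b by (auto simp: g_def field_simps simp flip: of_real_mult)
  ultimately have Q: "(\<Sum>j. of_real (q j) * cis \<theta> ^ Suc j) = of_real (1 - b) * G + of_real b * cis \<theta>"
    by (simp add: sums_iff)
  have "1 - (\<Sum>j. of_real (q j) * cis \<theta> ^ Suc j) = of_real (1 - b) * (1 + of_real \<beta> * (1 - cis \<theta>) - G)"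
    unfolding Q \<beta>_def using b by (simp add: field_simps)
  then have norm_eq: "cmod (1 - (\<Sum>j. of_real (q j) * cis \<theta> ^ Suc j))
     = (1 - b) * cmod (1 + of_real \<beta> * (1 - cis \<theta>) - G)"
    using b by (simp add: norm_mult flip: of_real_diff)
  have s: "0 < s" unfolding s_def using th by (simp add: sin_gt_zero)
  have sa: "0 < s\<alpha>" unfolding s\<alpha>_def using half_angle_pos[OF a] by simp
  have e_eq: "e = b / (1 - b)\<^sup>2" using b by (simp add: e_def \<beta>_def field_simps power2_eq_square)
  have D: "D_fun b \<alpha> = sqrt_excess e s\<alpha> / s\<alpha>"
    unfolding e_eq s\<alpha>_def using b a by (rule_tac D_fun_closed_form) auto
  have "D_fun b \<alpha> * s \<le> cmod (1 + of_real \<beta> * (1 - cis \<theta>) - G)"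
  proof (cases "pi \<le> (1 + \<alpha>) * \<theta>")
    case True
    define \<phi> where "\<phi> = pi / (1 + \<alpha>)"
    have "\<phi> \<le> \<theta>" "0 < \<phi>" using True a by (auto simp: \<phi>_def pos_divide_le_eq mult.commute)
    then have "sin (\<phi> / 2) \<le> sin (\<theta> / 2)"
      using th pi_gt_zero by (intro sin_monotone_2pi_le) linarith+
    then have "sin (pi / (1 + \<alpha>) / 2) \<le> sin (\<theta> / 2)" by (simp only: \<phi>_def)
    then have "s\<alpha> \<le> s" by (simp add: s_def s\<alpha>_def)
    then have "D_fun b \<alpha> \<le> sqrt_excess e s / s" unfolding D by (intro sqrt_excess_ratio_mono e0 sa)
    then have "D_fun b \<alpha> * s \<le> sqrt_excess e s" using s by (simp add: field_simps)
    also have "\<dots> = cmod (1 + of_real \<beta> * (1 - cis \<theta>)) - 1"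
      by (simp add: norm_one_plus_tangent sqrt_excess_def e_def s_def)
    also have "\<dots> \<le> cmod (1 + of_real \<beta> * (1 - cis \<theta>)) - cmod G"
    proof -
      have "cmod G \<le> (\<Sum>j. norm (of_real (g j) * cis \<theta> ^ Suc j))"
        unfolding G_def using g_nonneg sums_summable[OF g_sums]
        by (intro summable_norm) (simp add: norm_mult norm_power del: power_Suc)
      also have "\<dots> = (\<Sum>j. g j)"
        using g_nonneg by (simp add: norm_mult norm_power del: power_Suc)
      finally show ?thesis using g_sums by (simp add: sums_iff)
    qed
    also have "\<dots> \<le> cmod (1 + of_real \<beta> * (1 - cis \<theta>) - G)" by (rule norm_triangle_ineq2)
    finally show ?thesis .
  next
    case False
    define k where "k = (1 + \<alpha>) * \<theta> / pi"
    have k: "0 < k" "k < 1" using th a False by (auto simp: k_def divide_simps)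
    have "k * sin (pi / (1 + \<alpha>) / 2) \<le> sin (k * (pi / (1 + \<alpha>) / 2))"
      using k a by (intro sin_scale_ge) (auto simp: divide_simps)
    also have "k * (pi / (1 + \<alpha>) / 2) = \<theta> / 2"
    proof -
      define n where "n = 1 + \<alpha>"
      have "n \<noteq> 0" using a by (simp add: n_def)
      then show ?thesis unfolding k_def n_def[symmetric] by simp
    qed
    finally have "s\<alpha> \<le> s / k" using k by (simp add: s_def s\<alpha>_def field_simps)
    then have "D_fun b \<alpha> \<le> sqrt_excess e (s / k) / (s / k)" unfolding D by (intro sqrt_excess_ratio_mono e0 sa)
    then have "D_fun b \<alpha> * s \<le> k * sqrt_excess e (s / k)" using s k by (simp add: field_simps)
    also have "\<dots> = sqrt (k\<^sup>2 + e * s\<^sup>2) - k"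
    proof -
      have "k\<^sup>2 + e * s\<^sup>2 = k\<^sup>2 * (1 + e * (s / k)\<^sup>2)" using k by (simp add: field_simps)
      then have "sqrt (k\<^sup>2 + e * s\<^sup>2) = k * sqrt (1 + e * (s / k)\<^sup>2)"
        using k by (metis abs_of_pos real_sqrt_abs real_sqrt_mult)
      then show ?thesis by (simp add: sqrt_excess_def algebra_simps)
    qed
    also have "\<dots> \<le> cmod (1 + of_real \<beta> * (1 - cis \<theta>) - G)"
      unfolding k_def e_def s_def G_def using False
      by (intro norm_one_minus_return_gf_small_angle g_nonneg g_sums g_mean a b0 th) auto
    finally show ?thesis .
  qed
  then have "(1 - b) * (D_fun b \<alpha> * s) \<le> (1 - b) * cmod (1 + of_real \<beta> * (1 - cis \<theta>) - G)"
    using b by (intro mult_left_mono) auto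
  moreover have "cmod (1 - cis \<theta>) = s"
    using s by (simp only: norm_one_minus_cis s_def abs_of_pos)
  ultimately show ?thesis by (simp only: norm_eq mult.assoc)
qed

section \<open>Explicit convergence rates for aperiodic renewal sequences\<close>

text \<open>\<open>B\<close> is an upper bound of \<open>c(R) - 1\<close>; in the application it is the constant \<open>N - 1\<close>.\<close>

locale aperiodic_renewal =
  fixes q :: "nat \<Rightarrow> real" and R B b :: real
  assumes q_nonneg: "0 \<le> q k" and b: "0 < b" "b < 1" "b \<le> q 0" and R: "1 < R"
    and survival_nonneg: "0 \<le> survival q n"
    and weighted_tail: "(\<Sum>n<N. survival q (Suc n) * R ^ Suc n) \<le> B"
begin

abbreviation c :: "nat \<Rightarrow> real" where "c \<equiv> survival q"

text \<open>\<open>1 + A\<close> is the mean return time.\<close>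

definition A :: real where "A = (\<Sum>n. c (Suc n))"

definition c_gf :: "complex \<Rightarrow> complex" where "c_gf z = (\<Sum>n. of_real (c n) * z ^ n)"

lemma c_0 [simp]: "c 0 = 1" by (simp add: survival_def)

lemma q_eq: "q n = c n - c (Suc n)" by (simp add: survival_def)

lemma tail_summable_R: "summable (\<lambda>n. c (Suc n) * R ^ Suc n)"
  using weighted_tail survival_nonneg R by (intro summableI_nonneg_bounded[where x = B]) auto

lemma c_summable_R: "summable (\<lambda>n. c n * R ^ n)"
  using tail_summable_R by (subst summable_Suc_iff[symmetric])

lemma c_summable_norm:
  fixes z :: "'f::{real_normed_field, banach}"
  assumes "norm z \<le> R"
  shows "summable (\<lambda>n. norm (of_real (c n) * z ^ n))"
proof (rule summable_comparison_test'[OF c_summable_R])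
  show "norm (norm (of_real (c n) * z ^ n)) \<le> c n * R ^ n" if "n \<ge> 0" for n
    using assms survival_nonneg[of n] by (auto simp: norm_mult norm_power intro!: mult_left_mono power_mono)
qed

lemma c_summable: "norm (z::'f::{real_normed_field, banach}) \<le> R \<Longrightarrow> summable (\<lambda>n. of_real (c n) * z ^ n)"
  by (rule summable_norm_cancel) (rule c_summable_norm)

lemma c_summable_real: "0 \<le> r \<Longrightarrow> r \<le> R \<Longrightarrow> summable (\<lambda>n. c n * r ^ n)"
  using c_summable[of r] by simp

lemma summable_c: "summable c" using c_summable_real[of 1] R by simp

lemma suminf_c_power: "0 \<le> r \<Longrightarrow> r \<le> R \<Longrightarrow> (\<Sum>n. c n * r ^ n) = 1 + (\<Sum>n. c (Suc n) * r ^ Suc n)"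
  using suminf_split_head[OF c_summable_real] by simp

lemma suminf_c: "(\<Sum>n. c n) = 1 + A"
  using suminf_c_power[of 1] R by (simp add: A_def)

lemma A_nonneg: "0 \<le> A"
  unfolding A_def using summable_c survival_nonneg by (intro suminf_nonneg) (simp_all add: summable_Suc_iff)

lemma tail_R_le_B: "(\<Sum>n. c (Suc n) * R ^ Suc n) \<le> B"
  by (intro suminf_le_const tail_summable_R weighted_tail)

text \<open>For \<open>A > 0\<close> this says that \<open>ln (B / A) / ln R \<ge> 1\<close>, which is \<open>\<kappa>(\<alpha>) \<ge> 1\<close> for the true value of \<open>\<alpha>\<close>.\<close>

lemma RA_le_B: "R * A \<le> B"
proof -
  have s: "summable (\<lambda>n. c (Suc n))" using summable_c by (simp add: summable_Suc_iff)
  have "R * A = (\<Sum>n. R * c (Suc n))" unfolding A_def by (rule suminf_mult[OF s, symmetric])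
  also have "\<dots> \<le> (\<Sum>n. c (Suc n) * R ^ Suc n)"
  proof (intro suminf_le summable_mult s tail_summable_R)
    fix n show "R * c (Suc n) \<le> c (Suc n) * R ^ Suc n"
      using mult_left_mono[OF one_le_power[of R n], of "R * c (Suc n)"] R survival_nonneg[of "Suc n"]
      by (simp add: mult_ac)
  qed
  also have "\<dots> \<le> B" by (rule tail_R_le_B)
  finally show ?thesis .
qed

text \<open>Summation by parts: the generating function of the return time \<open>\<tau>\<close> is \<open>1 - (1 - z) c(z)\<close>.\<close>

lemma q_gf:
  fixes z :: "'f::{real_normed_field, banach}"
  assumes "norm z \<le> R"
  shows "(\<lambda>k. of_real (q k) * z ^ Suc k) sums (1 - (1 - z) * (\<Sum>n. of_real (c n) * z ^ n))"
proof -
  let ?C = "\<Sum>n. of_real (c n) * z ^ n"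
  have 1: "(\<lambda>n. of_real (c n) * z ^ n) sums ?C"
    by (intro summable_sums c_summable assms)
  then have "(\<lambda>n. of_real (c (Suc n)) * z ^ Suc n) sums (?C - of_real (c 0) * z ^ 0)"
    by (subst sums_Suc_iff) simp
  from sums_diff[OF sums_mult[OF 1, of z] this] show ?thesis
    by (simp add: q_eq algebra_simps)
qed

lemma q_sums: "q sums 1"
  using q_gf[of "1::real"] R by simp

lemma q_mean_sums: "(\<lambda>j. real j * q j) sums A"
proof -
  have eq: "(\<Sum>j<n. real j * q j) = (\<Sum>j<n. c (Suc j)) - real n * c n" for n
  proof (induction n)
    case (Suc n)
    have "real n * q n = real n * c n - real n * c (Suc n)"
      by (simp add: q_eq[of n] right_diff_distrib)
    then show ?case using Suc by (simp add: algebra_simps)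
  qed simp
  have "(\<lambda>n. c n * R ^ n) \<longlonglongrightarrow> 0" by (rule summable_LIMSEQ_zero[OF c_summable_R])
  moreover have "(\<lambda>n. real n * (1 / R) ^ n) \<longlonglongrightarrow> 0"
    using R by (intro powser_times_n_limit_0) auto
  ultimately have "(\<lambda>n. (c n * R ^ n) * (real n * (1 / R) ^ n)) \<longlonglongrightarrow> 0 * 0" by (rule tendsto_mult)
  moreover have "(c n * R ^ n) * (real n * (1 / R) ^ n) = real n * c n" for n
    using R by (simp add: power_divide)
  ultimately have "(\<lambda>n. real n * c n) \<longlonglongrightarrow> 0" by simp
  moreover have "(\<lambda>n. \<Sum>j<n. c (Suc j)) \<longlonglongrightarrow> A"
    unfolding A_def using summable_c by (intro summable_LIMSEQ) (simp add: summable_Suc_iff)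
  ultimately have "(\<lambda>n. (\<Sum>j<n. c (Suc j)) - real n * c n) \<longlonglongrightarrow> A - 0" by (intro tendsto_diff)
  then show ?thesis unfolding sums_def eq by simp
qed

text \<open>A zero of \<open>c\<close> would make the generating function of the return time equal to \<open>1\<close>, but its modulus is at
most \<open>\<bar>z\<bar>\<close>.\<close>

lemma c_gf_nonzero_inside:
  assumes "cmod z < 1" shows "c_gf z \<noteq> 0"
proof
  assume 0: "c_gf z = 0"
  have "(\<lambda>k. of_real (q k) * z ^ Suc k) sums 1"
    using q_gf[of z] assms R 0 by (simp add: c_gf_def)
  then have e: "(\<Sum>k. of_real (q k) * z ^ Suc k) = 1" by (simp add: sums_iff)
  have le: "norm (of_real (q k) * z ^ Suc k) \<le> cmod z * q k" for k
    using q_nonneg[of k] assms power_le_one[of "cmod z" k]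
    by (simp add: norm_mult norm_power mult_left_le mult_left_mono mult_ac)
  have sm: "summable (\<lambda>k. cmod z * q k)" by (intro summable_mult sums_summable[OF q_sums])
  have "1 = norm (\<Sum>k. of_real (q k) * z ^ Suc k)" unfolding e by simp
  also have "\<dots> \<le> (\<Sum>k. cmod z * q k)" by (rule norm_suminf_le[OF le sm])
  also have "\<dots> = cmod z" using sums_mult[OF q_sums, of "cmod z"] by (simp add: sums_iff)
  finally show False using assms by simp
qed

text \<open>\<open>\<bar>1 - z\<bar> \<bar>c(z)\<bar>\<close> is the quantity bounded in \<open>norm_one_minus_return_gf_ge\<close>; angles in the lower half plane
follow by conjugation, and at \<open>z = 1\<close> one has \<open>c(1) \<ge> 1 \<ge> b\<close>.\<close>

lemma c_gf_circle:
  assumes "cmod z = 1" "0 < \<alpha>" "A = (1 - b) * \<alpha>"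
  shows "(1 - b) * D_fun b \<alpha> \<le> cmod (c_gf z)"
proof (cases "z = 1")
  case True
  have "c_gf 1 = of_real (1 + A)"
    using summable_c by (simp add: c_gf_def suminf_of_real suminf_c[symmetric])
  then have "cmod (c_gf z) = 1 + A" using True A_nonneg by (metis abs_of_nonneg add_nonneg_nonneg norm_of_real zero_le_one)
  then show ?thesis using D_fun_le[of b \<alpha>] assms(2) b A_nonneg by simp
next
  case False
  have pos: "(1 - b) * D_fun b \<alpha> \<le> cmod (c_gf (cis \<theta>))" if th: "0 < \<theta>" "\<theta> \<le> pi" for \<theta>
  proof -
    have ne: "cmod (1 - cis \<theta>) > 0"
      unfolding norm_one_minus_cis using th sin_gt_zero[of "\<theta> / 2"] by simp
    have "(1 - b) * D_fun b \<alpha> * cmod (1 - cis \<theta>) \<le> cmod (1 - (\<Sum>j. of_real (q j) * cis \<theta> ^ Suc j))"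
      using q_nonneg q_sums q_mean_sums assms b th by (intro norm_one_minus_return_gf_ge) auto
    also have "(\<Sum>j. of_real (q j) * cis \<theta> ^ Suc j) = 1 - (1 - cis \<theta>) * c_gf (cis \<theta>)"
      using q_gf[of "cis \<theta>"] R by (simp add: c_gf_def sums_iff)
    finally have "(1 - b) * D_fun b \<alpha> * cmod (1 - cis \<theta>) \<le> cmod (c_gf (cis \<theta>)) * cmod (1 - cis \<theta>)"
      by (simp add: norm_mult mult.commute)
    then show ?thesis using ne by (simp only: mult_le_cancel_right_pos)
  qed
  define \<theta> where "\<theta> = Arg z"
  have "z \<noteq> 0" using assms by auto
  then have z: "z = cis \<theta>" using cis_Arg[of z] assms by (simp add: \<theta>_def sgn_eq)
  have th: "- pi < \<theta>" "\<theta> \<le> pi" using Arg_bounded by (auto simp: \<theta>_def)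
  show ?thesis
  proof (cases "\<theta> > 0")
    case True then show ?thesis using pos[of \<theta>] th z by simp
  next
    case le: False
    have "\<theta> \<noteq> 0" using False z by auto
    moreover have "c_gf (cis (- \<theta>)) = cnj (c_gf (cis \<theta>))"
      using sums_cnj[THEN iffD2, OF summable_sums[OF c_summable[of "cis \<theta>"]]] R
      by (simp add: c_gf_def sums_iff cis_cnj)
    ultimately show ?thesis using pos[of "- \<theta>"] th z le by simp
  qed
qed

text \<open>The coefficients of \<open>c\<close> are nonnegative, so moving along a ray from the unit circle to radius \<open>\<rho> \<le> r\<close> changes \<open>c\<close>
by at most \<open>c(r) - c(1)\<close>.\<close>

lemma c_gf_radial:
  assumes "cmod z = \<rho>" "1 \<le> \<rho>" "\<rho> \<le> r" "r \<le> R"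
  shows "cmod (c_gf (z / of_real \<rho>)) - ((\<Sum>n. c n * r ^ n) - (1 + A)) \<le> cmod (c_gf z)"
proof -
  let ?y = "z / of_real \<rho>"
  have y: "cmod ?y = 1" using assms by (simp add: norm_divide)
  have zs: "summable (\<lambda>n. of_real (c n) * z ^ n)" "summable (\<lambda>n. of_real (c n) * ?y ^ n)"
    using y assms R by (auto intro!: c_summable)
  have le: "norm (of_real (c n) * ?y ^ n - of_real (c n) * z ^ n) \<le> c n * r ^ n - c n" for n
  proof -
    have "of_real (c n) * ?y ^ n - of_real (c n) * z ^ n = of_real (c n) * (of_real (1 - \<rho> ^ n) * ?y ^ n)"
      using assms by (simp add: power_divide field_simps)
    then have "norm (of_real (c n) * ?y ^ n - of_real (c n) * z ^ n) = c n * \<bar>1 - \<rho> ^ n\<bar>"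
      using survival_nonneg[of n] by (simp only: norm_mult norm_power y norm_of_real) simp
    also have "\<dots> = c n * (\<rho> ^ n - 1)" using one_le_power[of \<rho> n] assms by simp
    also have "\<dots> \<le> c n * (r ^ n - 1)"
      using survival_nonneg[of n] assms by (intro mult_left_mono diff_right_mono power_mono) auto
    finally show ?thesis by (simp add: algebra_simps)
  qed
  have sr: "summable (\<lambda>n. c n * r ^ n)" using assms by (intro c_summable_real) auto
  have "c_gf ?y - c_gf z = (\<Sum>n. of_real (c n) * ?y ^ n - of_real (c n) * z ^ n)"
    unfolding c_gf_def by (intro suminf_diff zs)
  also have "cmod \<dots> \<le> (\<Sum>n. c n * r ^ n - c n)"
    by (intro norm_suminf_le[OF le] summable_diff sr summable_c)
  also have "\<dots> = (\<Sum>n. c n * r ^ n) - (1 + A)"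
    using suminf_diff[OF sr summable_c] by (simp add: suminf_c)
  finally show ?thesis using norm_triangle_ineq2[of "c_gf ?y" "c_gf z"] by linarith
qed

text \<open>The function \<open>c(r) - 1\<close> is log-convex in \<open>ln r\<close>, being \<open>A \<le> a\<close> at \<open>1\<close> and at most \<open>B\<close> at \<open>R\<close>. Applying Young's inequality
with the tangent point \<open>B / a\<close> to each power of \<open>r\<close>, instead of Hoelder's inequality to the sum, gives the
bound for every \<open>a \<ge> A\<close> at once.\<close>

lemma c_interpolation:
  assumes "0 < a" "A \<le> a" "0 < B" "1 < r" "r < R"
  shows "(\<Sum>n. c (Suc n) * r ^ Suc n) \<le> a * r powr (ln (B / a) / ln R)"
proof -
  define t where "t = B / a"
  define \<theta> where "\<theta> = ln r / ln R"
  have t: "0 < t" using assms by (simp add: t_def)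
  have th: "0 \<le> \<theta>" "\<theta> \<le> 1" using assms R by (auto simp: \<theta>_def)
  have r_pow: "r ^ n \<le> t powr \<theta> * (\<theta> * (R ^ n / t) + (1 - \<theta>))" for n
  proof -
    have "ln (R ^ n) * \<theta> = ln (r ^ n)" using assms R by (simp add: \<theta>_def ln_realpow)
    then have "(R ^ n) powr \<theta> = r ^ n" using assms R by (simp add: powr_def mult.commute)
    moreover have "(R ^ n) powr \<theta> = t powr \<theta> * (R ^ n / t) powr \<theta>"
      using t R by (simp add: powr_divide)
    moreover have "(R ^ n / t) powr \<theta> * 1 powr (1 - \<theta>) \<le> \<theta> * (R ^ n / t) + (1 - \<theta>) * 1"
      using th t R by (intro Youngs_inequality_0) auto
    ultimately show ?thesis by (metis mult_left_mono mult.right_neutral powr_ge_zero powr_one_eq_one)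
  qed
  have sA: "summable (\<lambda>n. c (Suc n))" using summable_c by (simp add: summable_Suc_iff)
  have "(\<Sum>n. c (Suc n) * r ^ Suc n)
      \<le> (\<Sum>n. t powr \<theta> * (\<theta> / t * (c (Suc n) * R ^ Suc n) + (1 - \<theta>) * c (Suc n)))"
  proof (intro suminf_le summable_mult summable_add sA tail_summable_R)
    show "summable (\<lambda>n. c (Suc n) * r ^ Suc n)"
      using c_summable_real[of r] assms by (subst summable_Suc_iff) auto
    fix n show "c (Suc n) * r ^ Suc n \<le> t powr \<theta> * (\<theta> / t * (c (Suc n) * R ^ Suc n) + (1 - \<theta>) * c (Suc n))"
      using mult_left_mono[OF r_pow[of "Suc n"] survival_nonneg[of "Suc n"]]
      by (simp add: algebra_simps)
  qed
  also have "\<dots> = t powr \<theta> * (\<theta> / t * (\<Sum>n. c (Suc n) * R ^ Suc n) + (1 - \<theta>) * A)"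
    unfolding A_def
    by (intro sums_unique[symmetric] sums_mult sums_add summable_sums sA tail_summable_R)
  also have "\<dots> \<le> t powr \<theta> * (\<theta> / t * B + (1 - \<theta>) * a)"
    using th t assms tail_R_le_B by (intro mult_left_mono add_mono) auto
  also have "\<theta> / t * B = \<theta> * a" using assms by (simp add: t_def)
  also have "\<theta> * a + (1 - \<theta>) * a = a" by (simp add: algebra_simps)
  also have "t powr \<theta> = r powr (ln (B / a) / ln R)"
    using t assms by (simp add: powr_def \<theta>_def t_def mult_ac)
  finally show ?thesis by (simp add: mult.commute)
qed

text \<open>Kendall's theorem with constants. For \<open>1 \<le> \<bar>z\<bar> \<le> r\<close> the bounds on the circle, along rays and on \<open>c(r) - c(1)\<close>
combine to \<open>\<bar>c(z)\<bar> \<ge> m = A (D(\<alpha>)/\<alpha> - r\<^sup>\<kappa> + 1) > 0\<close>.\<close>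

lemma renewal_seq_rate:
  assumes a: "0 < \<alpha>" and A: "A = (1 - b) * \<alpha>" and r: "1 < r" "r < R"
  defines "\<kappa> \<equiv> ln (B / ((1 - b) * \<alpha>)) / ln R"
  assumes small: "r powr \<kappa> < 1 + D_fun b \<alpha> / \<alpha>"
  shows "\<bar>renewal_seq q n - 1 / (1 + A)\<bar> * r ^ n
    \<le> 1 / (1 + A) * (r powr \<kappa> - 1) / ((r - 1) * (D_fun b \<alpha> / \<alpha> - r powr \<kappa> + 1))"
proof -
  define m where "m = A * (D_fun b \<alpha> / \<alpha> - r powr \<kappa> + 1)"
  have A0: "0 < A" using a A b by simp
  have B0: "0 < B" using mult_pos_pos[of R A] RA_le_B A0 R by linarith
  have m0: "0 < m" using small A0 by (simp add: m_def)
  have m_eq: "m = (1 - b) * D_fun b \<alpha> - A * (r powr \<kappa> - 1)"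
    using a by (simp add: m_def A field_simps)
  have cr: "(\<Sum>n. c n * r ^ n) - (1 + A) \<le> A * (r powr \<kappa> - 1)"
    using c_interpolation[OF A0 order_refl B0 r] r suminf_c_power[of r]
    by (simp add: \<kappa>_def A algebra_simps)
  have low: "m \<le> cmod (c_gf z)" if "1 \<le> cmod z" "cmod z \<le> r" for z
  proof -
    have "cmod (z / of_real (cmod z)) = 1" using that by (cases "z = 0") (auto simp: norm_divide)
    from c_gf_circle[OF this a A] c_gf_radial[OF refl that(1) that(2)] cr r
    show ?thesis by (simp add: m_eq)
  qed
  have "\<bar>renewal_seq q n - 1 / (\<Sum>n. c n)\<bar> * r ^ n
      \<le> 1 / (\<Sum>n. c n) * (((\<Sum>n. c n * r ^ n) - (\<Sum>n. c n)) / ((r - 1) * m))"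
  proof (rule kendall_cauchy_bound[where R = R])
    show "(\<Sum>n. of_real (c n) * z ^ n) \<noteq> 0" if "cmod z \<le> r" for z
      using low[of z] m0 that c_gf_nonzero_inside[of z] by (cases "cmod z < 1") (auto simp: c_gf_def)
    show "m \<le> cmod (\<Sum>n. of_real (c n) * z ^ n)" if "cmod z = r" for z
      using low[of z] that r by (simp add: c_gf_def)
  qed (use r m0 survival_nonneg c_summable_R renewal_seq_conv_survival in auto)
  also have "\<dots> \<le> 1 / (1 + A) * (A * (r powr \<kappa> - 1) / ((r - 1) * m))"
    unfolding suminf_c using cr m0 r A0 by (intro mult_left_mono divide_right_mono) auto
  also have "\<dots> = 1 / (1 + A) * (r powr \<kappa> - 1) / ((r - 1) * (D_fun b \<alpha> / \<alpha> - r powr \<kappa> + 1))"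
    using A0 by (simp add: m_def)
  finally show ?thesis by (simp add: suminf_c)
qed

text \<open>\<open>v = u - p\<close> satisfies \<open>v\<^sub>n = p \<Sum>\<^bsub>j>n\<^esub> c\<^sub>j - \<Sum>\<^bsub>j<n\<^esub> c\<^bsub>j+1\<^esub> v\<^bsub>n-j-1\<^esub>\<close>. In the norm \<open>sup\<^sub>n \<bar>v\<^sub>n\<bar> r\<^sup>n\<close> the first term is at most \<open>X / r\<close>
and the second operator has norm at most \<open>X < 1\<close>; \<open>X / (r (1 - X))\<close> is the fixed point of \<open>M \<mapsto> X / r + X M\<close>.\<close>

lemma renewal_seq_rate_contraction:
  assumes r: "1 < r" "r < R" and X: "(\<Sum>n. c (Suc n) * r ^ Suc n) \<le> X" "X < 1"
  shows "\<bar>renewal_seq q n - 1 / (1 + A)\<bar> * r ^ n \<le> X / (r * (1 - X))"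
proof -
  define p where "p = 1 / (1 + A)"
  define v where "v n = renewal_seq q n - p" for n
  have p: "0 < p" "p \<le> 1" using A_nonneg by (auto simp: p_def)
  have sr: "summable (\<lambda>n. c (Suc n) * r ^ Suc n)"
    using c_summable_real[of r] r by (subst summable_Suc_iff) auto
  have X0: "0 \<le> X" using survival_nonneg r by (intro order_trans[OF suminf_nonneg[OF sr] X(1)]) auto
  have conv: "v n = p * (\<Sum>j. c (j + Suc n)) - (\<Sum>j<n. c (Suc j) * v (n - Suc j))" for n
  proof -
    have "(\<Sum>j\<le>n. v (n - j) * c j) = 1 - p * (\<Sum>j\<le>n. c j)"
      using renewal_seq_conv_survival[of q n]
      by (simp add: v_def algebra_simps sum_subtractf sum_distrib_left)
    also have "\<dots> = p * (\<Sum>j. c (j + Suc n))"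
    proof -
      have "(\<Sum>j. c (j + Suc n)) = (1 + A) - (\<Sum>j\<le>n. c j)"
        using suminf_split_initial_segment[OF summable_c, of "Suc n"] by (simp add: suminf_c lessThan_Suc_atMost)
      then show ?thesis using A_nonneg by (simp add: p_def field_simps)
    qed
    finally show ?thesis
      by (simp only: sum.atMost_shift) (simp add: algebra_simps)
  qed
  have tail: "(\<Sum>j. c (j + Suc n)) * r ^ n \<le> X / r" for n
  proof -
    have s1: "summable (\<lambda>j. c (j + Suc n))" by (intro summable_ignore_initial_segment summable_c)
    have s2: "summable (\<lambda>j. c (Suc (j + n)) * r ^ Suc (j + n))"
      using summable_ignore_initial_segment[OF sr, of n] .
    have "(\<Sum>j. c (j + Suc n)) * r ^ Suc n = (\<Sum>j. c (j + Suc n) * r ^ Suc n)"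
      by (rule suminf_mult2[OF s1])
    also have "\<dots> \<le> (\<Sum>j. c (Suc (j + n)) * r ^ Suc (j + n))"
      using r survival_nonneg s2 by (intro suminf_le summable_mult2 s1) (auto intro!: mult_left_mono power_increasing)
    also have "\<dots> \<le> (\<Sum>n. c (Suc n) * r ^ Suc n)"
    proof -
      have "0 \<le> (\<Sum>j<n. c (Suc j) * r ^ Suc j)"
        using r survival_nonneg by (intro sum_nonneg mult_nonneg_nonneg) auto
      then show ?thesis using suminf_split_initial_segment[OF sr, of n] by linarith
    qed
    finally have "(\<Sum>j. c (j + Suc n)) * r ^ n * r \<le> X" using X(1) by (simp add: mult_ac)
    then show ?thesis using r by (simp add: pos_le_divide_eq)
  qed
  define M where "M = X / (r * (1 - X))"
  have M: "0 \<le> M" "X / r + X * M = M" using X0 X r by (auto simp: M_def field_simps)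
  have "\<bar>v n\<bar> * r ^ n \<le> M"
  proof (induction n rule: less_induct)
    case (less n)
    have "\<bar>v n\<bar> \<le> p * (\<Sum>j. c (j + Suc n)) + (\<Sum>j<n. c (Suc j) * \<bar>v (n - Suc j)\<bar>)"
    proof -
      have "0 \<le> (\<Sum>j. c (j + Suc n))"
        using survival_nonneg by (intro suminf_nonneg summable_ignore_initial_segment summable_c)
      moreover have "\<bar>\<Sum>j<n. c (Suc j) * v (n - Suc j)\<bar> \<le> (\<Sum>j<n. c (Suc j) * \<bar>v (n - Suc j)\<bar>)"
        using survival_nonneg by (intro order_trans[OF sum_abs]) (auto simp: abs_mult intro!: sum_mono)
      ultimately show ?thesis using p mult_nonneg_nonneg[of p "\<Sum>j. c (j + Suc n)"] by (subst conv) linarith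
    qed
    then have "\<bar>v n\<bar> * r ^ n \<le> (p * (\<Sum>j. c (j + Suc n)) + (\<Sum>j<n. c (Suc j) * \<bar>v (n - Suc j)\<bar>)) * r ^ n"
      using r by (intro mult_right_mono) auto
    also have "\<dots> = p * ((\<Sum>j. c (j + Suc n)) * r ^ n)
        + (\<Sum>j<n. c (Suc j) * r ^ Suc j * (\<bar>v (n - Suc j)\<bar> * r ^ (n - Suc j)))"
    proof -
      have "(\<Sum>j<n. c (Suc j) * \<bar>v (n - Suc j)\<bar>) * r ^ n
          = (\<Sum>j<n. c (Suc j) * r ^ Suc j * (\<bar>v (n - Suc j)\<bar> * r ^ (n - Suc j)))"
        unfolding sum_distrib_right
      proof (rule sum.cong[OF refl])
        fix j assume "j \<in> {..<n}"
        then have "r ^ n = r ^ Suc j * r ^ (n - Suc j)" unfolding power_add[symmetric] by simp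
        then show "c (Suc j) * \<bar>v (n - Suc j)\<bar> * r ^ n
            = c (Suc j) * r ^ Suc j * (\<bar>v (n - Suc j)\<bar> * r ^ (n - Suc j))" by (simp only: mult_ac)
      qed
      then show ?thesis by (simp add: algebra_simps)
    qed
    also have "\<dots> \<le> 1 * (X / r) + (\<Sum>j<n. c (Suc j) * r ^ Suc j * M)"
      using less r survival_nonneg tail[of n] p X0
      by (intro add_mono order_trans[OF mult_left_mono[OF tail] mult_right_mono] sum_mono mult_left_mono) auto
    also have "(\<Sum>j<n. c (Suc j) * r ^ Suc j * M) \<le> X * M"
      unfolding sum_distrib_right[symmetric] using M survival_nonneg r X
      by (intro mult_right_mono order_trans[OF sum_le_suminf[OF sr]]) auto
    finally show ?case using M by simp
  qed
  then show ?thesis by (simp add: v_def p_def M_def)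
qed

text \<open>Short mean return times, \<open>\<alpha> \<le> 1\<close>: the right-hand side is that of \<open>renewal_seq_rate\<close> at \<open>\<alpha> = 1\<close> without the factor
\<open>1 / (1 + A)\<close>. With \<open>X = (1 - b) r\<^sup>\<kappa>\<close> the contraction bound is smaller, since \<open>\<kappa> \<ge> 1\<close> gives
\<open>r\<^sup>\<kappa> / r \<le> (r\<^sup>\<kappa> - 1) / (r - 1)\<close> and \<open>(1 - b) D(1) \<le> b\<close> gives \<open>(1 - b) (D(1) + 1) \<le> 1\<close>.\<close>

lemma renewal_seq_rate_short:
  assumes A: "A \<le> 1 - b" and B: "(1 - b) * R \<le> B" and r: "1 < r" "r < R"
  defines "\<kappa> \<equiv> ln (B / (1 - b)) / ln R"
  assumes small: "r powr \<kappa> < 1 + D_fun b 1"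
  shows "\<bar>renewal_seq q n - 1 / (1 + A)\<bar> * r ^ n
    \<le> (r powr \<kappa> - 1) / ((r - 1) * (D_fun b 1 - r powr \<kappa> + 1))"
proof -
  define X where "X = (1 - b) * r powr \<kappa>"
  have B0: "0 < B" using mult_pos_pos[of "1 - b" R] B b R by linarith
  have "R \<le> B / (1 - b)" using B b by (simp add: field_simps)
  then have "1 \<le> \<kappa>" unfolding \<kappa>_def using R by simp
  then have rk: "r \<le> r powr \<kappa>" using powr_mono[of 1 \<kappa> r] r by simp
  have D: "(1 - b) * D_fun b 1 \<le> b" using b by (intro D_fun_le) auto
  have "X < (1 - b) * (1 + D_fun b 1)" using small b by (simp add: X_def)
  then have X1: "X < 1" using D by (simp add: algebra_simps)
  have "\<bar>renewal_seq q n - 1 / (1 + A)\<bar> * r ^ n \<le> X / (r * (1 - X))"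
  proof (rule renewal_seq_rate_contraction[OF r _ X1])
    show "(\<Sum>n. c (Suc n) * r ^ Suc n) \<le> X"
      unfolding X_def \<kappa>_def using b by (intro c_interpolation A B0 r) auto
  qed
  also have "\<dots> = (1 - b) * (r powr \<kappa> / r) / (1 - X)" by (simp add: X_def)
  also have "\<dots> \<le> (1 - b) * ((r powr \<kappa> - 1) / (r - 1)) / ((1 - b) * (D_fun b 1 - r powr \<kappa> + 1))"
  proof (rule frac_le)
    have "r powr \<kappa> / r \<le> (r powr \<kappa> - 1) / (r - 1)"
      using r rk by (simp add: divide_simps) (simp add: algebra_simps)
    then show "(1 - b) * (r powr \<kappa> / r) \<le> (1 - b) * ((r powr \<kappa> - 1) / (r - 1))"
      using b by (intro mult_left_mono) auto
    show "0 \<le> (1 - b) * ((r powr \<kappa> - 1) / (r - 1))" using b r rk by simp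
    show "0 < (1 - b) * (D_fun b 1 - r powr \<kappa> + 1)" using b small by simp
    show "(1 - b) * (D_fun b 1 - r powr \<kappa> + 1) \<le> 1 - X" using D by (simp add: X_def algebra_simps)
  qed
  also have "\<dots> = (r powr \<kappa> - 1) / ((r - 1) * (D_fun b 1 - r powr \<kappa> + 1))" using b by simp
  finally show ?thesis .
qed

text \<open>Jensen's inequality for \<open>k \<mapsto> R\<^sup>k\<close> and the law \<open>q\<close> with its atom \<open>b\<close> at \<open>0\<close> removed, which has mass \<open>1 - b\<close> and mean
\<open>\<alpha>\<close>; in the application \<open>1 + (R - 1) (1 + B)\<close> is the constant \<open>L\<close>.\<close>

lemma mean_excess_le:
  assumes A: "A = (1 - b) * \<alpha>"
  shows "(1 - b) * R powr (1 + \<alpha>) \<le> 1 + (R - 1) * (1 + B) - b * R"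
proof -
  define g where "g k = q k - (if k = 0 then b else 0)" for k
  have g0: "0 \<le> g k" for k using q_nonneg b by (auto simp: g_def)
  have sing: "(\<lambda>k. if k = 0 then x else 0) sums x" for x :: real
    using sums_single[of 0 "\<lambda>_. x"] by simp
  have g1: "g sums (1 - b)"
    unfolding g_def[abs_def] by (intro sums_diff q_sums sing)
  have g2: "(\<lambda>k. real k * g k) sums A"
  proof -
    have "(\<lambda>k. real k * g k) = (\<lambda>k. real k * q k)" by (auto simp: g_def)
    then show ?thesis using q_mean_sums by simp
  qed
  have "(\<lambda>k. q k * R ^ Suc k - (if k = 0 then b * R else 0)) sums (1 - (1 - R) * (\<Sum>n. c n * R ^ n) - b * R)"
    using q_gf[of R] R by (intro sums_diff sing) simp
  then have gR: "(\<lambda>k. g k * R ^ Suc k) sums (1 - (1 - R) * (\<Sum>n. c n * R ^ n) - b * R)"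
    by (rule sums_cong[THEN iffD1, rotated]) (auto simp: g_def algebra_simps)
  \<comment> \<open>The tangent of \<open>k \<mapsto> R\<^bsup>k+1\<^esup>\<close> at the mean \<open>\<alpha>\<close>.\<close>
  have tangent: "R powr (1 + \<alpha>) * (g k + ln R * (real k * g k) - ln R * \<alpha> * g k) \<le> g k * R ^ Suc k" for k
  proof -
    have "R powr (1 + \<alpha>) * (1 + (real k - \<alpha>) * ln R) \<le> R powr (1 + \<alpha>) * exp ((real k - \<alpha>) * ln R)"
      by (intro mult_left_mono exp_ge_add_one_self) auto
    also have "\<dots> = R powr real (Suc k)"
      using R by (simp add: powr_def exp_add[symmetric] algebra_simps)
    also have "\<dots> = R ^ Suc k" using R by (subst powr_realpow) auto
    finally have "g k * (R powr (1 + \<alpha>) * (1 + (real k - \<alpha>) * ln R)) \<le> g k * R ^ Suc k"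
      by (rule mult_left_mono[OF _ g0])
    then show ?thesis by (simp add: algebra_simps)
  qed
  have "R powr (1 + \<alpha>) * ((1 - b) + ln R * A - ln R * \<alpha> * (1 - b)) \<le> 1 - (1 - R) * (\<Sum>n. c n * R ^ n) - b * R"
    by (rule sums_le[OF tangent _ gR]) (intro sums_mult sums_add sums_diff g1 g2)
  also have "\<dots> \<le> 1 + (R - 1) * (1 + B) - b * R"
    using mult_left_mono[of "\<Sum>n. c n * R ^ n" "1 + B" "R - 1"] R tail_R_le_B suminf_c_power[of R]
    by (simp add: algebra_simps)
  finally show ?thesis by (simp add: A algebra_simps)
qed

end

section \<open>Splitting a chain at its atom\<close>

lemma norm_integral_le:
  fixes f :: "'a \<Rightarrow> 'b::{banach, second_countable_topology}"
  assumes "integrable M f" "integrable M (g :: 'a \<Rightarrow> real)" "\<And>x. x \<in> space M \<Longrightarrow> norm (f x) \<le> g x"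
  shows "norm (\<integral>x. f x \<partial>M) \<le> (\<integral>x. g x \<partial>M)"
  by (rule order_trans[OF integral_norm_bound integral_mono[OF integrable_norm[OF assms(1)] assms(2,3)]])

locale atomic_drift_chain =
  fixes S :: "'a measure" and P :: "'a \<Rightarrow> 'a measure" and \<nu> :: "'a measure"
    and C :: "'a set" and V :: "'a \<Rightarrow> real" and l K :: real
  assumes kernel: "P \<in> S \<rightarrow>\<^sub>M prob_algebra S"
    and C_meas: "C \<in> sets S" and C_nonempty: "C \<noteq> {}"
    and nu_prob: "prob_space \<nu>" and nu_sets: "sets \<nu> = sets S"
    and minorization: "\<And>x A. x \<in> C \<Longrightarrow> A \<in> sets S \<Longrightarrow> emeasure (P x) A = emeasure \<nu> A"
    and V_meas: "V \<in> borel_measurable S"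
    and V_ge_1: "\<And>x. x \<in> space S \<Longrightarrow> 1 \<le> V x"
    and l_range: "0 < l" "l < 1"
    and drift_out: "\<And>x. x \<in> space S - C \<Longrightarrow> (\<integral>\<^sup>+ y. ennreal (V y) \<partial>(P x)) \<le> ennreal (l * V x)"
    and drift_in: "\<And>x. x \<in> C \<Longrightarrow> (\<integral>\<^sup>+ y. ennreal (V y) \<partial>(P x)) \<le> ennreal K"
begin

lemma kernel_sub [measurable]: "P \<in> S \<rightarrow>\<^sub>M subprob_algebra S"
  by (rule measurable_prob_algebraD[OF kernel])

lemma P_prob: "x \<in> space S \<Longrightarrow> prob_space (P x)"
  and P_sets [simp]: "x \<in> space S \<Longrightarrow> sets (P x) = sets S"
  using measurable_space[OF kernel] by (auto simp: space_prob_algebra)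

lemma P_space [simp]: "x \<in> space S \<Longrightarrow> space (P x) = space S"
  by (rule sets_eq_imp_space_eq[OF P_sets])

lemma nu_space [simp]: "space \<nu> = space S" by (rule sets_eq_imp_space_eq[OF nu_sets])

lemma C_space: "x \<in> C \<Longrightarrow> x \<in> space S" using sets.sets_into_space[OF C_meas] by auto

lemma P_atom: "x \<in> C \<Longrightarrow> P x = \<nu>"
  using minorization C_space by (intro measure_eqI) (auto simp: nu_sets)

lemma borel_P: "x \<in> space S \<Longrightarrow> borel_measurable (P x) = borel_measurable S"
  by (intro measurable_cong_sets P_sets refl)

lemma V_pos: "x \<in> space S \<Longrightarrow> 0 < V x" using V_ge_1[of x] by simp

lemma integral_V_le:
  assumes M: "sets M = sets S" and le: "(\<integral>\<^sup>+ y. ennreal (V y) \<partial>M) \<le> ennreal c" and c: "0 \<le> c"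
  shows "integrable M V" "(\<integral>y. V y \<partial>M) \<le> c"
proof -
  have sp: "space M = space S" by (rule sets_eq_imp_space_eq[OF M])
  have nn: "AE y in M. 0 \<le> V y" using V_ge_1 sp by (intro AE_I2) force
  show i: "integrable M V"
  proof (rule integrableI_nonneg[OF _ nn])
    show "V \<in> borel_measurable M" using V_meas M by (simp cong: measurable_cong_sets)
    show "(\<integral>\<^sup>+ y. ennreal (V y) \<partial>M) < \<infinity>" using le by (rule le_less_trans) simp
  qed
  show "(\<integral>y. V y \<partial>M) \<le> c"
    using le nn_integral_eq_integral[OF i nn] c by (simp add: ennreal_le_iff)
qed

lemma
  shows K_ge_1: "1 \<le> K" and nu_V: "integrable \<nu> V" "(\<integral>y. V y \<partial>\<nu>) \<le> K"
proof -
  obtain x where x: "x \<in> C" using C_nonempty by auto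
  interpret nu: prob_space \<nu> by (rule nu_prob)
  have le: "(\<integral>\<^sup>+ y. ennreal (V y) \<partial>\<nu>) \<le> ennreal K" using drift_in[OF x] P_atom[OF x] by simp
  have "(\<integral>\<^sup>+ y. 1 \<partial>\<nu>) \<le> (\<integral>\<^sup>+ y. ennreal (V y) \<partial>\<nu>)"
    using V_ge_1 by (intro nn_integral_mono) simp
  then have "1 \<le> (\<integral>\<^sup>+ y. ennreal (V y) \<partial>\<nu>)" by (simp add: nu.emeasure_space_1 del: nu_space)
  from order_trans[OF this le] show "1 \<le> K" by (simp add: ennreal_ge_1)
  then show "integrable \<nu> V" "(\<integral>y. V y \<partial>\<nu>) \<le> K"
    using integral_V_le[OF nu_sets le] by auto
qed

lemma P_V: "x \<in> space S \<Longrightarrow> integrable (P x) V"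
  using integral_V_le(1)[OF P_sets drift_out] nu_V(1) P_atom[of x] l_range V_pos[of x]
  by (cases "x \<in> C") (auto simp: less_imp_le)

lemma markov_op_V_out: "x \<in> space S - C \<Longrightarrow> markov_op P V x \<le> l * V x"
  using integral_V_le(2)[OF P_sets drift_out, of x] l_range V_pos[of x]
  by (auto simp: less_imp_le markov_op_def)

text \<open>Membership in the weighted space with an explicit bound \<open>G\<close> of the norm. Such functions are integrable for all
measures that occur.\<close>

definition dominated :: "('a \<Rightarrow> 'b::{banach, second_countable_topology}) \<Rightarrow> real \<Rightarrow> bool" where
  "dominated g G \<longleftrightarrow> g \<in> borel_measurable S \<and> 0 \<le> G \<and> (\<forall>x\<in>space S. norm (g x) \<le> G * V x)"

lemma dominatedD:
  assumes "dominated g G"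
  shows "g \<in> borel_measurable S" "0 \<le> G" "x \<in> space S \<Longrightarrow> norm (g x) \<le> G * V x"
  using assms by (auto simp: dominated_def)

lemma dominated_integrable:
  assumes g: "dominated g G" and M: "sets M = sets S" "integrable M V"
  shows "integrable M g" "norm (\<integral>y. g y \<partial>M) \<le> G * (\<integral>y. V y \<partial>M)"
proof -
  have sp: "space M = space S" by (rule sets_eq_imp_space_eq[OF M(1)])
  have le: "AE y in M. norm (g y) \<le> G * V y" using dominatedD(3)[OF g] by (intro AE_I2) (simp add: sp)
  show i: "integrable M g"
  proof (rule Bochner_Integration.integrable_bound)
    show "integrable M (\<lambda>y. G * V y)" using M by simp
    show "g \<in> borel_measurable M" using dominatedD(1)[OF g] M by (simp cong: measurable_cong_sets)
    show "AE y in M. norm (g y) \<le> norm (G * V y)" using le by eventually_elim auto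
  qed
  have "norm (\<integral>y. g y \<partial>M) \<le> (\<integral>y. G * V y \<partial>M)"
    using M dominatedD(3)[OF g] by (intro norm_integral_le[OF i]) (auto simp: sp)
  then show "norm (\<integral>y. g y \<partial>M) \<le> G * (\<integral>y. V y \<partial>M)" by simp
qed

lemma dominated_P: "dominated g G \<Longrightarrow> x \<in> space S \<Longrightarrow> integrable (P x) g"
  using dominated_integrable(1) P_sets P_V by blast

lemma dominated_nu: "dominated g G \<Longrightarrow> integrable \<nu> g"
  and norm_nu_le: "dominated g G \<Longrightarrow> norm (\<integral>y. g y \<partial>\<nu>) \<le> G * K"
proof -
  assume g: "dominated g G"
  show "integrable \<nu> g" by (rule dominated_integrable(1)[OF g nu_sets nu_V(1)])
  show "norm (\<integral>y. g y \<partial>\<nu>) \<le> G * K"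
    using dominated_integrable(2)[OF g nu_sets nu_V(1)] mult_left_mono[OF nu_V(2) dominatedD(2)[OF g]] by linarith
qed

lemma markov_op_measurable [measurable]:
  assumes [measurable]: "g \<in> borel_measurable S" shows "markov_op P g \<in> borel_measurable S"
proof -
  have "(\<lambda>x. integral\<^sup>L (P x) g) \<in> borel_measurable S" by measurable
  then show ?thesis by (simp add: markov_op_def[abs_def])
qed

lemma dominated_const: "dominated (\<lambda>_. a) (norm a)"
  unfolding dominated_def using V_ge_1 by (auto simp: mult_le_cancel_left1)

lemma dominated_add:
  "dominated g G \<Longrightarrow> dominated h H \<Longrightarrow> dominated (\<lambda>x. g x + h x) (G + H)"
  unfolding dominated_def by (force simp: algebra_simps intro: norm_triangle_le)

lemma dominated_diff:
  "dominated g G \<Longrightarrow> dominated h H \<Longrightarrow> dominated (\<lambda>x. g x - h x) (G + H)"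
  unfolding dominated_def by (force simp: algebra_simps intro: norm_triangle_le_diff)

lemma dominated_scaleR_right:
  fixes g :: "'a \<Rightarrow> real"
  assumes "dominated g G" shows "dominated (\<lambda>x. g x *\<^sub>R a) (G * norm a)"
  unfolding dominated_def
proof (intro conjI ballI)
  show "(\<lambda>x. g x *\<^sub>R a) \<in> borel_measurable S" using dominatedD(1)[OF assms] by measurable
  show "0 \<le> G * norm a" using dominatedD(2)[OF assms] by simp
  fix x assume "x \<in> space S"
  from mult_right_mono[OF dominatedD(3)[OF assms this], of "norm a"]
  show "norm (g x *\<^sub>R a) \<le> G * norm a * V x" by (simp add: mult_ac)
qed

lemma dominated_cmult:
  assumes "dominated (g :: 'a \<Rightarrow> real) G" "0 \<le> a" shows "dominated (\<lambda>x. a * g x) (a * G)"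
  using dominated_scaleR_right[OF assms(1), of a] assms(2) by (simp add: mult.commute)

lemma dominated_indicator: "dominated (indicator C :: 'a \<Rightarrow> real) 1"
  unfolding dominated_def using V_ge_1 C_meas by (auto split: split_indicator simp: V_pos less_imp_le)

lemma dominated_V: "dominated V 1"
  unfolding dominated_def using V_meas V_pos by (force simp: less_imp_le)

lemma dominated_sum:
  assumes "\<And>i. i \<in> I \<Longrightarrow> dominated (g i) (G i)"
  shows "dominated (\<lambda>x. \<Sum>i\<in>I. g i x) (\<Sum>i\<in>I. G i)"
  using assms
  by (induction I rule: infinite_finite_induct) (auto intro!: dominated_add dominated_const[of 0, simplified])

definition J :: "('a \<Rightarrow> 'b::{banach, second_countable_topology}) \<Rightarrow> 'a \<Rightarrow> 'b" where
  "J g x = (if x \<in> C then 0 else markov_op P g x)"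

lemma markov_op_eq:
  fixes g :: "'a \<Rightarrow> 'b::{banach, second_countable_topology}"
  shows "markov_op P g x = J g x + indicator C x *\<^sub>R (\<integral>y. g y \<partial>\<nu>)"
  using P_atom[of x] by (auto simp: J_def markov_op_def)

lemma J_measurable [measurable]:
  "g \<in> borel_measurable S \<Longrightarrow> J g \<in> borel_measurable S"
proof -
  assume [measurable]: "g \<in> borel_measurable S"
  note C_meas[measurable]
  have "(\<lambda>x. indicator (space S - C) x *\<^sub>R markov_op P g x) \<in> borel_measurable S" by measurable
  then show ?thesis
    by (rule measurable_cong[THEN iffD1, rotated]) (auto simp: J_def)
qed

lemma norm_J_le:
  assumes g: "dominated g G" and h: "dominated (h :: 'a \<Rightarrow> real) H"
    and le: "\<And>x. x \<in> space S \<Longrightarrow> norm (g x) \<le> h x" and x: "x \<in> space S"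
  shows "norm (J g x) \<le> J h x"
  using dominated_P[OF g x] dominated_P[OF h x] le x
  by (auto simp: J_def markov_op_def intro!: norm_integral_le)

lemma J_mono:
  assumes g: "dominated (g :: 'a \<Rightarrow> real) G" and h: "dominated (h :: 'a \<Rightarrow> real) H"
    and le: "\<And>x. x \<in> space S \<Longrightarrow> g x \<le> h x" and x: "x \<in> space S"
  shows "J g x \<le> J h x"
  using dominated_P[OF g x] dominated_P[OF h x] le x
  by (auto simp: J_def markov_op_def intro!: integral_mono)

lemma J_V_le: "x \<in> space S \<Longrightarrow> J V x \<le> l * V x"
  using markov_op_V_out[of x] l_range V_pos[of x] by (auto simp: J_def)

lemma J_scale: "J (\<lambda>x. a * g x) x = a * J g x" for a :: real
  by (simp add: J_def markov_op_def)

lemma dominated_J: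
  assumes g: "dominated g G" shows "dominated (J g) (l * G)"
  unfolding dominated_def
proof (intro conjI ballI)
  show "J g \<in> borel_measurable S" using dominatedD(1)[OF g] by measurable
  show "0 \<le> l * G" using l_range dominatedD(2)[OF g] by simp
  fix x assume x: "x \<in> space S"
  have "dominated (\<lambda>x. G * V x) G"
    using dominatedD(2)[OF g] V_meas V_pos unfolding dominated_def by (auto simp: abs_mult less_imp_le)
  then have "norm (J g x) \<le> J (\<lambda>x. G * V x) x" using norm_J_le[OF g _ dominatedD(3)[OF g] x] by blast
  also have "\<dots> \<le> G * (l * V x)" unfolding J_scale using J_V_le[OF x] dominatedD(2)[OF g] by (rule mult_left_mono)
  finally show "norm (J g x) \<le> l * G * V x" by (simp add: mult_ac)
qed

lemma dominated_J_pow: "dominated g G \<Longrightarrow> dominated ((J ^^ n) g) (l ^ n * G)"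
proof (induction n)
  case (Suc n)
  then show ?case using dominated_J[OF Suc.IH] by (simp add: mult.assoc)
qed simp

lemma dominated_markov_op:
  assumes g: "dominated g G" shows "dominated (markov_op P g) (l * G + norm (\<integral>y. g y \<partial>\<nu>))"
proof -
  have "dominated (\<lambda>x. J g x + indicator C x *\<^sub>R (\<integral>y. g y \<partial>\<nu>)) (l * G + 1 * norm (\<integral>y. g y \<partial>\<nu>))"
    by (intro dominated_add dominated_J[OF g] dominated_scaleR_right dominated_indicator)
  then show ?thesis by (simp add: markov_op_eq[symmetric])
qed

lemma dominated_markov_op_pow:
  assumes "dominated g G" obtains H where "dominated ((markov_op P ^^ n) g) H"
proof -
  have "\<exists>H. dominated ((markov_op P ^^ n) g) H"
    using assms by (induction n) (auto dest: dominated_markov_op)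
  then show ?thesis using that by blast
qed

lemma norm_J_pow_le:
  assumes g: "dominated g G" and h: "dominated (h :: 'a \<Rightarrow> real) H"
    and le: "\<And>x. x \<in> space S \<Longrightarrow> norm (g x) \<le> h x" and x: "x \<in> space S"
  shows "norm ((J ^^ n) g x) \<le> (J ^^ n) h x"
  using x
proof (induction n arbitrary: x)
  case (Suc n)
  show ?case using norm_J_le[OF dominated_J_pow[OF g] dominated_J_pow[OF h] Suc.IH Suc.prems] by simp
qed (use le in simp)

text \<open>With \<open>\<sigma> \<ge> 0\<close> the first hitting time of \<open>C\<close>, \<open>hit n x = Pr\<^sub>x(\<sigma> = n)\<close> and \<open>avoid n x = Pr\<^sub>x(\<sigma> \<ge> n)\<close>. A chain that leaves
the atom has law \<open>\<nu>\<close> at time \<open>1\<close>, so \<open>ret n\<close> is the probability that it returns at time \<open>n + 1\<close>.\<close>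

definition hit :: "nat \<Rightarrow> 'a \<Rightarrow> real" where "hit n = (J ^^ n) (indicator C)"

definition ret :: "nat \<Rightarrow> real" where "ret n = (\<integral>x. hit n x \<partial>\<nu>)"

definition avoid :: "nat \<Rightarrow> 'a \<Rightarrow> real" where "avoid n = (J ^^ n) (\<lambda>_. 1)"

lemma dominated_hit: "dominated (hit n) (l ^ n)"
  using dominated_J_pow[OF dominated_indicator, of n] by (simp add: hit_def)

lemma dominated_avoid: "dominated (avoid n) (l ^ n)"
  using dominated_J_pow[OF dominated_const[of "1::real"], of n] by (simp add: avoid_def)

lemma hit_Suc: "hit (Suc n) = J (hit n)" and avoid_Suc: "avoid (Suc n) = J (avoid n)"
  by (simp_all add: hit_def avoid_def)

lemma hit_0: "hit 0 = indicator C" and avoid_0: "avoid 0 = (\<lambda>_. 1)"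
  by (simp_all add: hit_def avoid_def)

lemma J_sum:
  fixes g :: "'i \<Rightarrow> 'a \<Rightarrow> 'b::{banach, second_countable_topology}"
  assumes "\<And>i. i \<in> I \<Longrightarrow> dominated (g i) (G i)" "x \<in> space S"
  shows "J (\<lambda>y. \<Sum>i\<in>I. g i y) x = (\<Sum>i\<in>I. J (g i) x)"
  using assms dominated_P unfolding J_def markov_op_def
  by (auto intro!: Bochner_Integration.integral_sum)

lemma J_cong: "(\<And>y. y \<in> space S \<Longrightarrow> f y = g y) \<Longrightarrow> x \<in> space S \<Longrightarrow> J f x = J g x"
  unfolding J_def markov_op_def by (auto intro!: Bochner_Integration.integral_cong)

lemma hit_nonneg: "x \<in> space S \<Longrightarrow> 0 \<le> hit n x"
  and avoid_nonneg: "x \<in> space S \<Longrightarrow> 0 \<le> avoid n x"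
proof -
  have "0 \<le> (J ^^ n) h x" if "\<And>x. 0 \<le> h x" "x \<in> space S" for h :: "'a \<Rightarrow> real" and x
    using that(2)
    by (induction n arbitrary: x) (auto simp: that(1) J_def markov_op_def intro!: Bochner_Integration.integral_nonneg)
  then show "x \<in> space S \<Longrightarrow> 0 \<le> hit n x" "x \<in> space S \<Longrightarrow> 0 \<le> avoid n x"
    by (auto simp: hit_def avoid_def)
qed

lemma J_add:
  assumes "dominated g G" "dominated h H" "x \<in> space S"
  shows "J (\<lambda>y. g y + h y) x = J g x + J h x"
  using dominated_P[OF assms(1,3)] dominated_P[OF assms(2,3)]
  unfolding J_def markov_op_def by (auto intro!: Bochner_Integration.integral_add)

lemma J_diff:
  assumes "dominated g G" "dominated h H" "x \<in> space S"
  shows "J (\<lambda>y. g y - h y) x = J g x - J h x"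
  using dominated_P[OF assms(1,3)] dominated_P[OF assms(2,3)]
  unfolding J_def markov_op_def by (auto intro!: Bochner_Integration.integral_diff)

lemma J_1: "x \<in> space S \<Longrightarrow> J (\<lambda>_. 1) x = 1 - (indicator C x :: real)"
  using prob_space.prob_space[OF P_prob] by (auto simp: J_def markov_op_def)

text \<open>\<open>J 1 = 1 - 1\<^sub>C\<close>, iterated.\<close>

lemma avoid_eq: "x \<in> space S \<Longrightarrow> avoid n x = 1 - (\<Sum>k<n. hit k x)"
proof (induction n arbitrary: x)
  case (Suc n)
  have "avoid (Suc n) x = J (\<lambda>y. 1 - (\<Sum>k<n. hit k y)) x"
    unfolding avoid_Suc using Suc by (intro J_cong) auto
  also have "\<dots> = J (\<lambda>_. 1) x - J (\<lambda>y. \<Sum>k<n. hit k y) x"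
    by (rule J_diff[OF dominated_const[of "1::real"] dominated_sum[OF dominated_hit] Suc.prems])
  also have "\<dots> = 1 - indicator C x - (\<Sum>k<n. hit (Suc k) x)"
    using Suc J_sum[OF dominated_hit] by (simp add: J_1 hit_Suc)
  also have "\<dots> = 1 - (\<Sum>k<Suc n. hit k x)"
    unfolding sum.lessThan_Suc_shift by (simp add: hit_0)
  finally show ?case .
qed (simp add: avoid_0)

definition R :: real where "R = 1 / l"

lemma R: "1 < R" "R * l = 1" using l_range by (auto simp: R_def)

text \<open>The drift condition in the form in which it is iterated: \<open>1\<^sub>C + R J V \<le> V\<close>. On \<open>C\<close> the killed part vanishes and
\<open>V \<ge> 1\<close>; off \<open>C\<close> one has \<open>R P V \<le> V\<close>.\<close>

lemma V_supersolution:
  assumes g: "dominated (g :: 'a \<Rightarrow> real) G" and le: "\<And>y. y \<in> space S \<Longrightarrow> g y \<le> V y" and x: "x \<in> space S"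
  shows "indicator C x + R * J g x \<le> V x"
proof -
  have "R * J g x \<le> R * (l * V x)"
    using J_mono[OF g dominated_V le x] J_V_le[OF x] R by (intro mult_left_mono) auto
  also have "\<dots> = V x" using R by (simp flip: mult.assoc)
  finally show ?thesis using V_ge_1[OF x] by (cases "x \<in> C") (auto simp: J_def)
qed

lemma J_weighted_sum:
  assumes h: "\<And>k. dominated (h k) (H k)" and x: "x \<in> space S"
  shows "R * J (\<lambda>y. \<Sum>k<n. R ^ k * h k y) x = (\<Sum>k<n. R ^ Suc k * J (h k) x)"
proof -
  have d: "dominated (\<lambda>y. R ^ k * h k y) (R ^ k * H k)" for k
    using h[of k] R by (intro dominated_cmult) auto
  have "J (\<lambda>y. \<Sum>k<n. R ^ k * h k y) x = (\<Sum>k<n. R ^ k * J (h k) x)"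
    using J_sum[where I = "{..<n}", OF d x] by (simp add: J_scale)
  then show ?thesis by (simp add: sum_distrib_left mult_ac)
qed

text \<open>The partial sums are the iterates of \<open>g \<mapsto> 1\<^sub>C + R J g\<close> from \<open>0\<close>, and \<open>V\<close> is a supersolution. The limit says
\<open>E\<^sub>x R\<^sup>\<sigma> \<le> V x\<close>.\<close>

lemma hit_gf_le_V: "x \<in> space S \<Longrightarrow> (\<Sum>k<n. R ^ k * hit k x) \<le> V x"
proof (induction n arbitrary: x)
  case 0 then show ?case using V_pos by (simp add: less_imp_le)
next
  case (Suc n)
  have d: "dominated (\<lambda>y. \<Sum>k<n. R ^ k * hit k y) (\<Sum>k<n. R ^ k * l ^ k)"
    using R by (intro dominated_sum dominated_cmult dominated_hit) auto
  have "(\<Sum>k<Suc n. R ^ k * hit k x) = indicator C x + R * J (\<lambda>y. \<Sum>k<n. R ^ k * hit k y) x"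
    unfolding sum.lessThan_Suc_shift J_weighted_sum[OF dominated_hit Suc.prems] by (simp add: hit_0 hit_Suc)
  also have "\<dots> \<le> V x" by (rule V_supersolution[OF d Suc.IH Suc.prems])
  finally show ?case .
qed

text \<open>The left-hand sides are the iterates of \<open>g \<mapsto> 1\<^sub>C + R J g\<close> from the constant \<open>1\<close>, because \<open>1\<^sub>C + R J 1 = 1 + (R - 1) J 1\<close>.\<close>

lemma avoid_gf_le_V: "x \<in> space S \<Longrightarrow> 1 + (R - 1) * (\<Sum>m<n. R ^ m * avoid (Suc m) x) \<le> V x"
proof (induction n arbitrary: x)
  case 0 then show ?case using V_ge_1 by simp
next
  case (Suc n)
  let ?g = "\<lambda>y. 1 + (R - 1) * (\<Sum>m<n. R ^ m * avoid (Suc m) y)"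
  have d0: "dominated (\<lambda>y. R ^ m * avoid (Suc m) y) (R ^ m * l ^ Suc m)" for m
    using R by (intro dominated_cmult dominated_avoid) auto
  have d1: "dominated (\<lambda>y. \<Sum>m<n. R ^ m * avoid (Suc m) y) (\<Sum>m<n. R ^ m * l ^ Suc m)"
    by (intro dominated_sum d0)
  have d2: "dominated (\<lambda>y. (R - 1) * (\<Sum>m<n. R ^ m * avoid (Suc m) y)) ((R - 1) * (\<Sum>m<n. R ^ m * l ^ Suc m))"
    using R by (intro dominated_cmult d1) auto
  have d: "dominated ?g (norm (1::real) + (R - 1) * (\<Sum>m<n. R ^ m * l ^ Suc m))"
    by (intro dominated_add dominated_const d2)
  have "J ?g x = J (\<lambda>_. 1) x + J (\<lambda>y. (R - 1) * (\<Sum>m<n. R ^ m * avoid (Suc m) y)) x"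
    by (rule J_add[OF dominated_const[of "1::real"] d2 Suc.prems])
  then have "R * J ?g x = R * J (\<lambda>_. 1) x + (R - 1) * (R * J (\<lambda>y. \<Sum>m<n. R ^ m * avoid (Suc m) y) x)"
    unfolding J_scale by (simp only: ring_distribs mult_ac)
  also have "R * J (\<lambda>y. \<Sum>m<n. R ^ m * avoid (Suc m) y) x = (\<Sum>m<n. R ^ Suc m * avoid (Suc (Suc m)) x)"
    using J_weighted_sum[OF dominated_avoid Suc.prems, of Suc n] by (simp only: avoid_Suc)
  finally have e1: "R * J ?g x = R * J (\<lambda>_. 1) x + (R - 1) * (\<Sum>m<n. R ^ Suc m * avoid (Suc (Suc m)) x)" .
  have e2: "(\<Sum>m<Suc n. R ^ m * avoid (Suc m) x) = J (\<lambda>_. 1) x + (\<Sum>m<n. R ^ Suc m * avoid (Suc (Suc m)) x)"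
    unfolding sum.lessThan_Suc_shift by (simp add: avoid_Suc avoid_0)
  have "1 + (R - 1) * (\<Sum>m<Suc n. R ^ m * avoid (Suc m) x) = indicator C x + R * J ?g x"
    unfolding e1 e2 J_1[OF Suc.prems] by (simp add: algebra_simps)
  also have "\<dots> \<le> V x" by (rule V_supersolution[OF d Suc.IH Suc.prems])
  finally show ?case .
qed

lemma nu_avoid: "(\<integral>x. avoid n x \<partial>\<nu>) = survival ret n"
proof -
  interpret nu: prob_space \<nu> by (rule nu_prob)
  have "(\<integral>x. avoid n x \<partial>\<nu>) = (\<integral>x. 1 - (\<Sum>k<n. hit k x) \<partial>\<nu>)"
    by (intro Bochner_Integration.integral_cong) (auto simp: avoid_eq)
  also have "\<dots> = 1 - (\<Sum>k<n. ret k)"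
    using dominated_nu[OF dominated_hit]
    by (subst Bochner_Integration.integral_diff) (auto simp: ret_def nu.prob_space[simplified])
  finally show ?thesis by (simp add: survival_def)
qed

lemma ret_nonneg: "0 \<le> ret n"
  unfolding ret_def using hit_nonneg by (intro Bochner_Integration.integral_nonneg) simp

lemma survival_ret_nonneg: "0 \<le> survival ret n"
  unfolding nu_avoid[symmetric] using avoid_nonneg by (intro Bochner_Integration.integral_nonneg) simp

text \<open>\<open>avoid_gf_le_V\<close> integrated against \<open>\<nu>\<close>, with \<open>\<nu>(V) \<le> K\<close>.\<close>

lemma survival_ret_weighted: "(\<Sum>n<N. survival ret (Suc n) * R ^ Suc n) \<le> R * (K - 1) / (R - 1)"
proof -
  interpret nu: prob_space \<nu> by (rule nu_prob)
  have i: "integrable \<nu> (\<lambda>x. \<Sum>m<N. R ^ m * avoid (Suc m) x)"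
    using dominated_nu[OF dominated_avoid] by auto
  have "(\<integral>x. 1 + (R - 1) * (\<Sum>m<N. R ^ m * avoid (Suc m) x) \<partial>\<nu>) \<le> (\<integral>x. V x \<partial>\<nu>)"
    using i nu_V avoid_gf_le_V by (intro integral_mono) auto
  also have "\<dots> \<le> K" by (rule nu_V)
  also have "(\<integral>x. 1 + (R - 1) * (\<Sum>m<N. R ^ m * avoid (Suc m) x) \<partial>\<nu>)
     = 1 + (R - 1) * (\<Sum>m<N. R ^ m * survival ret (Suc m))"
    using i dominated_nu[OF dominated_avoid] by (simp add: nu.prob_space[simplified] nu_avoid)
  finally have "(\<Sum>m<N. R ^ m * survival ret (Suc m)) \<le> (K - 1) / (R - 1)"
    using R by (simp add: pos_le_divide_eq algebra_simps)
  then have "R * (\<Sum>m<N. R ^ m * survival ret (Suc m)) \<le> R * ((K - 1) / (R - 1))"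
    using R by (intro mult_left_mono) auto
  then show ?thesis by (simp add: sum_distrib_left mult_ac)
qed

text \<open>Decomposition at the first visit to the atom: iterate \<open>P = J + 1\<^sub>C \<otimes> \<nu>\<close>.\<close>

lemma markov_op_pow_decomp:
  fixes g :: "'a \<Rightarrow> 'b::{banach, second_countable_topology}"
  assumes g: "dominated g G" and x: "x \<in> space S"
  shows "(markov_op P ^^ n) g x
    = (J ^^ n) g x + (\<Sum>k<n. hit k x *\<^sub>R (\<integral>y. (markov_op P ^^ (n - 1 - k)) g y \<partial>\<nu>))"
  using x
proof (induction n arbitrary: x)
  case (Suc n)
  let ?w = "\<lambda>m. \<integral>y. (markov_op P ^^ m) g y \<partial>\<nu>"
  have d: "dominated (\<lambda>y. hit k y *\<^sub>R ?w (n - 1 - k)) (l ^ k * norm (?w (n - 1 - k)))" for k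
    by (intro dominated_scaleR_right dominated_hit)
  have "J ((markov_op P ^^ n) g) x = J (\<lambda>y. (J ^^ n) g y + (\<Sum>k<n. hit k y *\<^sub>R ?w (n - 1 - k))) x"
    using Suc by (intro J_cong) auto
  also have "\<dots> = J ((J ^^ n) g) x + J (\<lambda>y. \<Sum>k<n. hit k y *\<^sub>R ?w (n - 1 - k)) x"
    by (rule J_add[OF dominated_J_pow[OF g] dominated_sum[OF d] Suc.prems])
  also have "\<dots> = (J ^^ Suc n) g x + (\<Sum>k<n. hit (Suc k) x *\<^sub>R ?w (n - 1 - k))"
  proof -
    have "J (\<lambda>y. hit k y *\<^sub>R a) x = hit (Suc k) x *\<^sub>R a" for k and a :: 'b
      using dominated_P[OF dominated_hit Suc.prems, of k] by (auto simp: hit_Suc J_def markov_op_def)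
    then show ?thesis unfolding J_sum[OF d Suc.prems] by simp
  qed
  finally have "(markov_op P ^^ Suc n) g x
     = (J ^^ Suc n) g x + (\<Sum>k<n. hit (Suc k) x *\<^sub>R ?w (n - 1 - k)) + indicator C x *\<^sub>R ?w n"
    by (simp add: markov_op_eq[of "(markov_op P ^^ n) g"])
  then show ?case
    unfolding sum.lessThan_Suc_shift by (simp add: hit_0 add_ac)
qed simp

lemma nu_markov_op_pow:
  fixes g :: "'a \<Rightarrow> 'b::{banach, second_countable_topology}"
  assumes g: "dominated g G"
  shows "(\<integral>y. (markov_op P ^^ n) g y \<partial>\<nu>)
    = (\<Sum>j\<le>n. renewal_seq ret (n - j) *\<^sub>R (\<integral>y. (J ^^ j) g y \<partial>\<nu>))"
proof (rule renewal_equation_solution)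
  fix n
  let ?w = "\<lambda>m. \<integral>y. (markov_op P ^^ m) g y \<partial>\<nu>"
  have "?w n = (\<integral>y. (J ^^ n) g y + (\<Sum>k<n. hit k y *\<^sub>R ?w (n - 1 - k)) \<partial>\<nu>)"
    using markov_op_pow_decomp[OF g] by (intro Bochner_Integration.integral_cong) auto
  also have "\<dots> = (\<integral>y. (J ^^ n) g y \<partial>\<nu>) + (\<Sum>k<n. ret k *\<^sub>R ?w (n - 1 - k))"
    using dominated_nu[OF dominated_J_pow[OF g]] dominated_nu[OF dominated_hit]
    by (subst Bochner_Integration.integral_add) (auto simp: ret_def)
  finally show "?w n = (\<integral>y. (J ^^ n) g y \<partial>\<nu>) + (\<Sum>k<n. ret k *\<^sub>R ?w (n - 1 - k))" .
qed

end

section \<open>The stationary distribution and convergence of the chain\<close>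

locale stationary_atomic_chain = atomic_drift_chain S P \<nu> C V l K
  for S :: "'a measure" and P :: "'a \<Rightarrow> 'a measure" and \<nu> :: "'a measure"
    and C :: "'a set" and V :: "'a \<Rightarrow> real" and l K :: real +
  fixes \<mu> :: "'a measure" and b :: real
  assumes stat: "stationary S P \<mu>" and b_range: "0 < b" "b < 1" and aperiodic: "b \<le> measure \<nu> C"
begin

lemma mu_prob: "prob_space \<mu>" and mu_sets: "sets \<mu> = sets S"
  using stat by (auto simp: stationary_def)

lemma mu_space [simp]: "space \<mu> = space S" by (rule sets_eq_imp_space_eq[OF mu_sets])

lemma mu_bind: "\<mu> \<bind> P = \<mu>"
proof -
  interpret mu: prob_space \<mu> by (rule mu_prob)
  have P: "P \<in> \<mu> \<rightarrow>\<^sub>M subprob_algebra S"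
    using kernel_sub mu_sets by (simp cong: measurable_cong_sets)
  show ?thesis
  proof (rule measure_eqI)
    show 1: "sets (\<mu> \<bind> P) = sets \<mu>"
      using mu.not_empty by (subst sets_bind[where N = S]) (auto simp: mu_sets)
    fix A assume "A \<in> sets (\<mu> \<bind> P)"
    then have A: "A \<in> sets S" by (simp add: 1 mu_sets)
    then show "emeasure (\<mu> \<bind> P) A = emeasure \<mu> A"
      using stat mu.not_empty by (subst emeasure_bind[OF _ P A]) (auto simp: stationary_def)
  qed
qed

text \<open>Invariance of \<open>\<mu>\<close> is known for indicators. It is extended to bounded functions here, then to \<open>V\<close> in \<open>mu_V\<close>, and only
then to the whole weighted space in \<open>mu_invariant\<close>, where \<open>V\<close> serves as an integrable majorant.\<close>

lemma mu_markov_op_bounded: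
  assumes h: "(h :: 'a \<Rightarrow> real) \<in> borel_measurable S" and bd: "\<And>x. x \<in> space S \<Longrightarrow> \<bar>h x\<bar> \<le> c"
  shows "(\<integral>x. markov_op P h x \<partial>\<mu>) = (\<integral>x. h x \<partial>\<mu>)"
proof -
  interpret mu: prob_space \<mu> by (rule mu_prob)
  have P: "P \<in> \<mu> \<rightarrow>\<^sub>M subprob_algebra S"
    using kernel_sub mu_sets by (simp cong: measurable_cong_sets)
  have "(\<integral>x. h x \<partial>(\<mu> \<bind> P)) = (\<integral>x. (\<integral>y. h y \<partial>P x) \<partial>\<mu>)"
    by (rule integral_bind[OF h bd P, where B' = 1])
       (use prob_space.emeasure_space_1[OF P_prob] in \<open>auto intro!: AE_I2 mu.finite_measure_axioms\<close>)
  then show ?thesis by (simp add: mu_bind markov_op_def)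
qed

lemma markov_op_bounded:
  assumes h: "(h :: 'a \<Rightarrow> real) \<in> borel_measurable S" and bd: "\<And>x. x \<in> space S \<Longrightarrow> \<bar>h x\<bar> \<le> c"
    and x: "x \<in> space S"
  shows "\<bar>markov_op P h x\<bar> \<le> c"
proof -
  interpret p: prob_space "P x" by (rule P_prob[OF x])
  have i: "integrable (P x) h"
    using h bd x by (intro p.integrable_const_bound[where B = c] AE_I2) (auto simp: borel_P)
  have "norm (\<integral>y. h y \<partial>P x) \<le> (\<integral>y. c \<partial>P x)"
    using bd x by (intro norm_integral_le i) auto
  then show ?thesis using p.prob_space x by (simp add: markov_op_def)
qed

lemma mu_markov_op_pow_bounded:
  assumes h: "(h :: 'a \<Rightarrow> real) \<in> borel_measurable S" and bd: "\<And>x. x \<in> space S \<Longrightarrow> \<bar>h x\<bar> \<le> c"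
  shows "(markov_op P ^^ n) h \<in> borel_measurable S"
    and "\<And>x. x \<in> space S \<Longrightarrow> \<bar>(markov_op P ^^ n) h x\<bar> \<le> c"
    and "(\<integral>x. (markov_op P ^^ n) h x \<partial>\<mu>) = (\<integral>x. h x \<partial>\<mu>)"
proof (induction n)
  case (Suc n)
  { case 1 show ?case using Suc(1) by simp }
  { case 2 then show ?case using markov_op_bounded[OF Suc(1,2)] by simp }
  { case 3 show ?case using mu_markov_op_bounded[OF Suc(1,2)] Suc(3) by simp }
qed (use h bd in auto)

lemma markov_op_pow_V:
  "x \<in> space S \<Longrightarrow> (markov_op P ^^ n) V x \<le> l ^ n * V x + K * (\<Sum>i<n. l ^ i)"
proof (induction n arbitrary: x)
  case (Suc n)
  obtain H where H: "dominated ((markov_op P ^^ n) V) H"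
    using dominated_markov_op_pow[OF dominated_V] by blast
  interpret p: prob_space "P x" by (rule P_prob[OF Suc.prems])
  have 1: "markov_op P V x \<le> l * V x + K"
    using J_V_le[OF Suc.prems] nu_V(2) K_ge_1 unfolding markov_op_eq[of V]
    by (auto split: split_indicator)
  have "(markov_op P ^^ Suc n) V x = (\<integral>y. (markov_op P ^^ n) V y \<partial>P x)" by (simp add: markov_op_def)
  also have "\<dots> \<le> (\<integral>y. l ^ n * V y + K * (\<Sum>i<n. l ^ i) \<partial>P x)"
    using dominated_P[OF H Suc.prems] P_V[OF Suc.prems] Suc by (intro integral_mono) auto
  also have "\<dots> = l ^ n * markov_op P V x + K * (\<Sum>i<n. l ^ i)"
    using P_V[OF Suc.prems] p.prob_space Suc.prems by (simp add: markov_op_def)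
  also have "\<dots> \<le> l ^ n * (l * V x + K) + K * (\<Sum>i<n. l ^ i)"
    using 1 l_range by (intro add_right_mono mult_left_mono) auto
  also have "\<dots> = l ^ Suc n * V x + K * (\<Sum>i<Suc n. l ^ i)" by (simp add: algebra_simps)
  finally show ?case .
qed simp

lemma geom_sum_le: "K * (\<Sum>i<n. l ^ i) \<le> K / (1 - l)"
proof -
  have "(\<Sum>i<n. l ^ i) \<le> (\<Sum>i. l ^ i)" using l_range by (intro sum_le_suminf summable_geometric) auto
  also have "\<dots> = 1 / (1 - l)" using l_range by (intro suminf_geometric) auto
  finally show ?thesis using mult_left_mono[of "\<Sum>i<n. l ^ i" "1 / (1 - l)" K] K_ge_1 by simp
qed

text \<open>Invariance applies to the bounded function \<open>min V m\<close>, and \<open>P\<^sup>n (min V m) \<le> min (l\<^sup>n V + K / (1 - l)) m\<close>. The right-hand side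
is bounded by \<open>m\<close> and tends to \<open>min (K / (1 - l)) m\<close>, so that dominated convergence applies before \<open>V\<close> is known to be
integrable.\<close>

lemma mu_truncated_V_le: 
  assumes "0 \<le> m" shows "(\<integral>x. min (V x) m \<partial>\<mu>) \<le> K / (1 - l)"
proof -
  interpret mu: prob_space \<mu> by (rule mu_prob)
  let ?k = "K / (1 - l)"
  let ?h = "\<lambda>x. min (V x) m"
  have hm: "?h \<in> borel_measurable S" using V_meas by measurable
  have hb: "\<bar>?h x\<bar> \<le> m" if "x \<in> space S" for x using V_pos[OF that] assms by auto
  have hd: "dominated ?h 1" unfolding dominated_def using hm V_pos assms by (force simp: less_imp_le)
  have k0: "0 \<le> ?k" using K_ge_1 l_range by simp
  let ?s = "\<lambda>n x. min (l ^ n * V x + ?k) m"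
  have sm: "?s n \<in> borel_measurable \<mu>" for n
    using V_meas mu_sets by (simp cong: measurable_cong_sets)
  have sb: "\<bar>?s n x\<bar> \<le> m" if "x \<in> space S" for n x
  proof -
    have "0 \<le> l ^ n * V x + ?k" using V_pos[OF that] l_range k0 by simp
    then show ?thesis using assms by auto
  qed
  have "(\<integral>x. ?h x \<partial>\<mu>) \<le> (\<integral>x. ?s n x \<partial>\<mu>)" for n
  proof -
    have mono: "(markov_op P ^^ n) ?h x \<le> (markov_op P ^^ n) V x" if "x \<in> space S" for x
      using that
    proof (induction n arbitrary: x)
      case (Suc n)
      obtain H1 where H1: "dominated ((markov_op P ^^ n) V) H1"
        using dominated_markov_op_pow[OF dominated_V] by blast
      obtain H2 where H2: "dominated ((markov_op P ^^ n) ?h) H2"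
        using dominated_markov_op_pow[OF hd] by blast
      have "(\<integral>y. (markov_op P ^^ n) ?h y \<partial>P x) \<le> (\<integral>y. (markov_op P ^^ n) V y \<partial>P x)"
        using dominated_P[OF H1 Suc.prems] dominated_P[OF H2 Suc.prems] Suc by (intro integral_mono) auto
      then show ?case by (simp add: markov_op_def[of P _ x])
    qed simp
    have le: "(markov_op P ^^ n) ?h x \<le> ?s n x" if "x \<in> space S" for x
      using mono[OF that] markov_op_pow_V[OF that, of n] geom_sum_le[of n]
        mu_markov_op_pow_bounded(2)[OF hm hb that, of n] by auto
    have "(\<integral>x. ?h x \<partial>\<mu>) = (\<integral>x. (markov_op P ^^ n) ?h x \<partial>\<mu>)"
      using mu_markov_op_pow_bounded(3)[OF hm hb] by simp
    also have "\<dots> \<le> (\<integral>x. ?s n x \<partial>\<mu>)"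
    proof (rule integral_mono)
      show "integrable \<mu> ((markov_op P ^^ n) ?h)"
        using mu_markov_op_pow_bounded(1,2)[OF hm hb] mu_sets
        by (intro mu.integrable_const_bound[where B = m] AE_I2) (auto cong: measurable_cong_sets)
      show "integrable \<mu> (?s n)"
        using sb sm by (intro mu.integrable_const_bound[where B = m] AE_I2) auto
    qed (use le in auto)
    finally show ?thesis .
  qed
  moreover have "(\<lambda>n. \<integral>x. ?s n x \<partial>\<mu>) \<longlonglongrightarrow> (\<integral>x. min ?k m \<partial>\<mu>)"
  proof (rule integral_dominated_convergence[where w = "\<lambda>_. m"])
    show "AE x in \<mu>. (\<lambda>n. ?s n x) \<longlonglongrightarrow> min ?k m"
    proof (rule AE_I2)
      fix x
      have "(\<lambda>n. l ^ n) \<longlonglongrightarrow> 0" using l_range by (intro LIMSEQ_realpow_zero) auto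
      then have "(\<lambda>n. ?s n x) \<longlonglongrightarrow> min (0 * V x + ?k) m"
        by (intro tendsto_min tendsto_add tendsto_mult tendsto_const)
      then show "(\<lambda>n. ?s n x) \<longlonglongrightarrow> min ?k m" by simp
    qed
    show "AE x in \<mu>. norm (?s n x) \<le> m" for n using sb by (intro AE_I2) simp
  qed (use sm in auto)
  ultimately have "(\<integral>x. ?h x \<partial>\<mu>) \<le> (\<integral>x. min ?k m \<partial>\<mu>)"
    by (intro LIMSEQ_le_const) auto
  then show ?thesis using mu.prob_space by simp
qed

lemma mu_V: "integrable \<mu> V" and mu_V_le: "(\<integral>x. V x \<partial>\<mu>) \<le> K / (1 - l)"
proof -
  interpret mu: prob_space \<mu> by (rule mu_prob)
  let ?h = "\<lambda>n x. min (V x) (real n)"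
  have hm: "?h n \<in> borel_measurable \<mu>" for n
    using V_meas mu_sets by (simp cong: measurable_cong_sets)
  have i: "integrable \<mu> (?h n)" for n
  proof (rule mu.integrable_const_bound[where B = "real n", OF AE_I2 hm])
    fix x assume "x \<in> space \<mu>"
    then show "norm (?h n x) \<le> real n" using V_pos[of x] by simp
  qed
  have inc: "incseq (\<lambda>n. \<integral>x. ?h n x \<partial>\<mu>)" by (intro incseq_SucI integral_mono i) auto
  obtain L where L: "(\<lambda>n. \<integral>x. ?h n x \<partial>\<mu>) \<longlonglongrightarrow> L"
  proof -
    have "\<forall>n. (\<integral>x. ?h n x \<partial>\<mu>) \<le> K / (1 - l)" using mu_truncated_V_le by simp
    from incseq_convergent[OF inc this] show ?thesis using that by blast
  qed
  have 1: "AE x in \<mu>. mono (\<lambda>n. ?h n x)" by (intro AE_I2) (auto simp: mono_def min_le_iff_disj)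
  have 2: "AE x in \<mu>. (\<lambda>n. ?h n x) \<longlonglongrightarrow> V x"
  proof (rule AE_I2)
    fix x
    obtain N where N: "V x \<le> real N" using real_arch_simple by blast
    have "eventually (\<lambda>n. ?h n x = V x) sequentially"
      using N by (intro eventually_sequentiallyI[of N]) auto
    then show "(\<lambda>n. ?h n x) \<longlonglongrightarrow> V x" by (rule tendsto_eventually)
  qed
  have 3: "V \<in> borel_measurable \<mu>" using V_meas mu_sets by (simp cong: measurable_cong_sets)
  show "integrable \<mu> V" by (rule integrable_monotone_convergence[OF i 1 2 L 3])
  have "(\<integral>x. V x \<partial>\<mu>) = L" by (rule integral_monotone_convergence[OF i 1 2 L 3])
  also have "L \<le> K / (1 - l)" using L mu_truncated_V_le by (intro LIMSEQ_le_const2[OF L]) auto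
  finally show "(\<integral>x. V x \<partial>\<mu>) \<le> K / (1 - l)" .
qed

lemma dominated_mu: "dominated g G \<Longrightarrow> integrable \<mu> g"
  by (rule dominated_integrable(1)[OF _ mu_sets mu_V])

lemma norm_mu_le:
  assumes "dominated g G" shows "norm (\<integral>y. g y \<partial>\<mu>) \<le> G * (K / (1 - l))"
  using dominated_integrable(2)[OF assms mu_sets mu_V] mult_left_mono[OF mu_V_le dominatedD(2)[OF assms]]
  by linarith

lemma mu_invariant_real:
  assumes g: "dominated (g :: 'a \<Rightarrow> real) G"
  shows "(\<integral>x. markov_op P g x \<partial>\<mu>) = (\<integral>x. g x \<partial>\<mu>)"
proof -
  let ?t = "\<lambda>n x. if V x \<le> real n then g x else 0"
  have gm: "g \<in> borel_measurable S" and G0: "0 \<le> G" by (rule dominatedD[OF g])+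
  have tm [measurable]: "?t n \<in> borel_measurable S" for n using gm V_meas by measurable
  have tg: "\<bar>?t n x\<bar> \<le> G * V x" if "x \<in> space S" for n x
    using dominatedD(3)[OF g that] G0 V_pos[OF that] by auto
  have td: "dominated (?t n) G" for n unfolding dominated_def using G0 tg tm by simp
  have bd: "\<bar>?t n x\<bar> \<le> G * real n" if "x \<in> space S" for n x
    using dominatedD(3)[OF g that] mult_left_mono[of "V x" "real n" G] G0 by auto
  have lim: "(\<lambda>n. ?t n x) \<longlonglongrightarrow> g x" for x
  proof -
    obtain N where N: "V x \<le> real N" using real_arch_simple by blast
    have "eventually (\<lambda>n. ?t n x = g x) sequentially"
      using N by (intro eventually_sequentiallyI[of N]) auto
    then show ?thesis by (rule tendsto_eventually)
  qed
  have meas: "f \<in> borel_measurable S \<Longrightarrow> f \<in> borel_measurable \<mu>" for f :: "'a \<Rightarrow> real"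
    using mu_sets by (simp cong: measurable_cong_sets)
  have 1: "(\<lambda>n. \<integral>x. ?t n x \<partial>\<mu>) \<longlonglongrightarrow> (\<integral>x. g x \<partial>\<mu>)"
    using mu_V lim tg
    by (intro integral_dominated_convergence[where w = "\<lambda>x. G * V x"] meas gm tm AE_I2) auto
  have 2: "(\<lambda>n. markov_op P (?t n) x) \<longlonglongrightarrow> markov_op P g x" if x: "x \<in> space S" for x
    unfolding markov_op_def using P_V[OF x] lim tg x gm tm
    by (intro integral_dominated_convergence[where w = "\<lambda>x. G * V x"] AE_I2) (auto simp: borel_P)
  have dV: "dominated (markov_op P V) (l * 1 + norm (\<integral>y. V y \<partial>\<nu>))"
    by (rule dominated_markov_op[OF dominated_V])
  have 3: "(\<lambda>n. \<integral>x. markov_op P (?t n) x \<partial>\<mu>) \<longlonglongrightarrow> (\<integral>x. markov_op P g x \<partial>\<mu>)"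
  proof (rule integral_dominated_convergence[where w = "\<lambda>x. G * markov_op P V x"])
    show "integrable \<mu> (\<lambda>x. G * markov_op P V x)" using dominated_mu[OF dV] by simp
    show "AE x in \<mu>. (\<lambda>n. markov_op P (?t n) x) \<longlonglongrightarrow> markov_op P g x" using 2 by (intro AE_I2) simp
    show "AE x in \<mu>. norm (markov_op P (?t n) x) \<le> G * markov_op P V x" for n
    proof (rule AE_I2)
      fix x assume "x \<in> space \<mu>"
      then have x: "x \<in> space S" by simp
      have "norm (\<integral>y. ?t n y \<partial>P x) \<le> (\<integral>y. G * V y \<partial>P x)"
        using tg x P_V[OF x] by (intro norm_integral_le dominated_P[OF td]) auto
      then show "norm (markov_op P (?t n) x) \<le> G * markov_op P V x" by (simp add: markov_op_def)
    qed
  qed (use gm in \<open>auto intro!: meas\<close>)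
  have "(\<integral>x. markov_op P (?t n) x \<partial>\<mu>) = (\<integral>x. ?t n x \<partial>\<mu>)" for n
    by (rule mu_markov_op_bounded[OF tm bd])
  with 3 have "(\<lambda>n. \<integral>x. ?t n x \<partial>\<mu>) \<longlonglongrightarrow> (\<integral>x. markov_op P g x \<partial>\<mu>)" by simp
  from LIMSEQ_unique[OF this 1] show ?thesis .
qed

text \<open>Componentwise, so that real and complex functions are covered together.\<close>

lemma mu_invariant:
  fixes g :: "'a \<Rightarrow> 'b::euclidean_space"
  assumes g: "dominated g G"
  shows "(\<integral>x. markov_op P g x \<partial>\<mu>) = (\<integral>x. g x \<partial>\<mu>)"
proof (rule euclidean_eqI)
  fix e :: 'b assume e: "e \<in> Basis"
  have ge: "dominated (\<lambda>x. g x \<bullet> e) G"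
    unfolding dominated_def
  proof (intro conjI ballI)
    show "(\<lambda>x. g x \<bullet> e) \<in> borel_measurable S" using dominatedD(1)[OF g] by measurable
    show "norm (g x \<bullet> e) \<le> G * V x" if "x \<in> space S" for x
      using Basis_le_norm[OF e, of "g x"] dominatedD(3)[OF g that] by simp
  qed (rule dominatedD(2)[OF g])
  have "(\<integral>x. markov_op P g x \<partial>\<mu>) \<bullet> e = (\<integral>x. markov_op P g x \<bullet> e \<partial>\<mu>)"
    using dominated_mu[OF dominated_markov_op[OF g]] by simp
  also have "\<dots> = (\<integral>x. markov_op P (\<lambda>y. g y \<bullet> e) x \<partial>\<mu>)"
    using dominated_P[OF g] by (intro Bochner_Integration.integral_cong) (auto simp: markov_op_def)
  also have "\<dots> = (\<integral>x. g x \<bullet> e \<partial>\<mu>)" by (rule mu_invariant_real[OF ge])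
  also have "\<dots> = (\<integral>x. g x \<partial>\<mu>) \<bullet> e" using dominated_mu[OF g] by simp
  finally show "(\<integral>x. markov_op P g x \<partial>\<mu>) \<bullet> e = (\<integral>x. g x \<partial>\<mu>) \<bullet> e" .
qed

lemma mu_markov_op_pow:
  fixes g :: "'a \<Rightarrow> 'b::euclidean_space"
  assumes g: "dominated g G"
  shows "(\<integral>x. (markov_op P ^^ n) g x \<partial>\<mu>) = (\<integral>x. g x \<partial>\<mu>)"
proof (induction n)
  case (Suc n)
  obtain H where "dominated ((markov_op P ^^ n) g) H" using dominated_markov_op_pow[OF g] by blast
  from mu_invariant[OF this] Suc show ?case by simp
qed simp

text \<open>The occupation formula \<open>\<pi>(g) = \<pi>(C) \<Sum>\<^sub>k \<nu>(J\<^sup>k g)\<close>: iterate \<open>\<pi>(g) = \<pi>(P g) = \<pi>(J g) + \<pi>(C) \<nu>(g)\<close>; the remainder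
\<open>\<pi>(J\<^sup>n g)\<close> is of order \<open>l\<^sup>n\<close>.\<close>

lemma mu_occupation:
  fixes g :: "'a \<Rightarrow> 'b::euclidean_space"
  assumes g: "dominated g G"
  shows "(\<lambda>k. measure \<mu> C *\<^sub>R (\<integral>x. (J ^^ k) g x \<partial>\<nu>)) sums (\<integral>x. g x \<partial>\<mu>)"
proof -
  interpret mu: prob_space \<mu> by (rule mu_prob)
  let ?\<gamma> = "\<lambda>k. \<integral>x. (J ^^ k) g x \<partial>\<nu>"
  have CS: "C \<subseteq> space \<mu>" "C \<in> sets \<mu>" using C_space C_meas mu_sets by auto
  have step: "(\<integral>x. h x \<partial>\<mu>) = (\<integral>x. J h x \<partial>\<mu>) + measure \<mu> C *\<^sub>R (\<integral>x. h x \<partial>\<nu>)" if h: "dominated h H" for h :: "'a \<Rightarrow> 'b" and H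
  proof -
    have "(\<integral>x. h x \<partial>\<mu>) = (\<integral>x. J h x + indicator C x *\<^sub>R (\<integral>x. h x \<partial>\<nu>) \<partial>\<mu>)"
      using mu_invariant[OF h] by (simp add: markov_op_eq)
    also have "\<dots> = (\<integral>x. J h x \<partial>\<mu>) + measure \<mu> C *\<^sub>R (\<integral>x. h x \<partial>\<nu>)"
      using dominated_mu[OF dominated_J[OF h]] CS
      by (subst Bochner_Integration.integral_add) (auto simp: mu.emeasure_eq_measure Int_absorb2)
    finally show ?thesis .
  qed
  have partial: "(\<integral>x. g x \<partial>\<mu>) = (\<integral>x. (J ^^ n) g x \<partial>\<mu>) + (\<Sum>k<n. measure \<mu> C *\<^sub>R ?\<gamma> k)" for n
  proof (induction n)
    case (Suc n)
    then show ?case using step[OF dominated_J_pow[OF g, of n]] by (simp add: add_ac)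
  qed simp
  have "(\<lambda>n. \<integral>x. (J ^^ n) g x \<partial>\<mu>) \<longlonglongrightarrow> 0"
  proof (rule Lim_null_comparison)
    show "\<forall>\<^sub>F n in sequentially. norm (\<integral>x. (J ^^ n) g x \<partial>\<mu>) \<le> l ^ n * G * (K / (1 - l))"
      using norm_mu_le[OF dominated_J_pow[OF g]] by (intro always_eventually) auto
    have "(\<lambda>n. l ^ n) \<longlonglongrightarrow> 0" using l_range by (intro LIMSEQ_realpow_zero) auto
    then have "(\<lambda>n. l ^ n * G * (K / (1 - l))) \<longlonglongrightarrow> 0 * G * (K / (1 - l))"
      by (intro tendsto_mult tendsto_const)
    then show "(\<lambda>n. l ^ n * G * (K / (1 - l))) \<longlonglongrightarrow> 0" by simp
  qed
  then have "(\<lambda>n. (\<integral>x. g x \<partial>\<mu>) - (\<integral>x. (J ^^ n) g x \<partial>\<mu>)) \<longlonglongrightarrow> (\<integral>x. g x \<partial>\<mu>) - 0"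
    by (intro tendsto_intros)
  moreover have "(\<integral>x. g x \<partial>\<mu>) - (\<integral>x. (J ^^ n) g x \<partial>\<mu>) = (\<Sum>k<n. measure \<mu> C *\<^sub>R ?\<gamma> k)" for n
    by (subst partial[of n]) simp
  ultimately show ?thesis by (simp add: sums_def)
qed

lemma ret_0: "ret 0 = measure \<nu> C"
proof -
  have "C \<subseteq> space \<nu>" "C \<in> sets \<nu>" using C_space C_meas nu_sets by auto
  then show ?thesis by (simp add: ret_def hit_0 Int_absorb2)
qed

text \<open>This is \<open>N - 1\<close>.\<close>

definition B :: real where "B = R * (K - 1) / (R - 1)"

sublocale ren: aperiodic_renewal ret R B b
  using ret_nonneg b_range aperiodic R survival_ret_nonneg survival_ret_weighted
  by unfold_locales (auto simp: ret_0 B_def)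

text \<open>Kac's formula: the mean return time is \<open>1 / \<pi>(C)\<close>.\<close>

lemma mu_C: "measure \<mu> C = 1 / (1 + ren.A)"
proof -
  interpret mu: prob_space \<mu> by (rule mu_prob)
  have "(\<lambda>k. measure \<mu> C *\<^sub>R survival ret k) sums 1"
    using mu_occupation[OF dominated_const[of "1::real"]] mu.prob_space nu_avoid
    by (simp add: avoid_def)
  then have "measure \<mu> C * (1 + ren.A) = 1"
    using sums_mult[OF summable_sums[OF ren.summable_c], of "measure \<mu> C"] ren.suminf_c
    by (simp add: sums_iff)
  moreover have "1 + ren.A > 0" using ren.A_nonneg by simp
  ultimately show ?thesis by (simp add: field_simps)
qed

lemma B_scaled: "B / (R - 1) = l * (K - 1) / (1 - l)\<^sup>2" and one_plus_B: "1 + B = (K - l) / (1 - l)"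
  and inverse_R_minus_1: "1 / (R - 1) = l / (1 - l)"
proof -
  have r: "R - 1 = (1 - l) / l" using l_range by (simp add: R_def field_simps)
  have l: "0 < l" "0 < 1 - l" using l_range by auto
  show "1 / (R - 1) = l / (1 - l)" unfolding r using l by simp
  have Bl: "B = (K - 1) / (1 - l)" unfolding B_def r using l by (simp add: R_def)
  show "B / (R - 1) = l * (K - 1) / (1 - l)\<^sup>2" unfolding Bl r by (simp add: power2_eq_square mult.commute)
  show "1 + B = (K - l) / (1 - l)" unfolding Bl using l by (simp add: field_simps)
qed

text \<open>With \<open>\<gamma>\<^sub>j = \<nu>(J\<^sup>j g)\<close>, \<open>w\<^sub>m = \<nu>(P\<^sup>m g)\<close> and \<open>p = \<pi>(C)\<close>, the first-visit decomposition and the occupation formula give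
\<open>P\<^sup>n g - \<pi>(g) = J\<^sup>n g - (J\<^sup>n 1) \<pi>(g) + \<Sum>\<^bsub>k<n\<^esub> hit\<^sub>k (w\<^bsub>n-1-k\<^esub> - \<pi>(g))\<close> and
\<open>w\<^sub>m - \<pi>(g) = \<Sum>\<^bsub>j\<le>m\<^esub> (u\<^bsub>m-j\<^esub> - p) \<gamma>\<^sub>j - p \<Sum>\<^bsub>j>m\<^esub> \<gamma>\<^sub>j\<close>.
The factor \<open>r\<close> in the last term comes from the step that is spent leaving the atom: the times \<open>k\<close> and \<open>n - 1 - k\<close>
add up to \<open>n - 1\<close>.\<close>

lemma markov_op_pow_error:
  fixes g :: "'a \<Rightarrow> 'b::euclidean_space"
  assumes g: "dominated g G" and x: "x \<in> space S" and n: "1 \<le> n" and r: "1 < r" "r \<le> R"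
    and K0: "\<And>n. \<bar>renewal_seq ret n - measure \<mu> C\<bar> * r ^ n \<le> K0"
    and summ: "summable (\<lambda>j. norm (\<integral>y. (J ^^ j) g y \<partial>\<nu>) * r ^ j)"
    and \<Gamma>: "(\<Sum>j. norm (\<integral>y. (J ^^ j) g y \<partial>\<nu>) * r ^ j) \<le> \<Gamma>"
    and \<Delta>: "\<And>m. (\<Sum>j. norm (\<integral>y. (J ^^ (j + Suc m)) g y \<partial>\<nu>)) * r ^ m \<le> \<Delta>"
  shows "norm ((markov_op P ^^ n) g x - (\<integral>y. g y \<partial>\<mu>)) * r ^ n
    \<le> norm ((J ^^ n) g x) * r ^ n + avoid n x * r ^ n * norm (\<integral>y. g y \<partial>\<mu>) + r * V x * (K0 * \<Gamma> + \<Delta>)"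
proof -
  define p where "p = measure \<mu> C"
  define \<gamma> where "\<gamma> j = (\<integral>y. (J ^^ j) g y \<partial>\<nu>)" for j
  define \<pi>g where "\<pi>g = (\<integral>y. g y \<partial>\<mu>)"
  define w where "w m = (\<integral>y. (markov_op P ^^ m) g y \<partial>\<nu>)" for m
  define u where "u = renewal_seq ret"
  have p: "0 < p" "p \<le> 1" using ren.A_nonneg by (auto simp: p_def mu_C)
  have summ': "summable (\<lambda>j. norm (\<gamma> j) * r ^ j)" using summ by (simp add: \<gamma>_def)
  have sn: "summable (\<lambda>j. norm (\<gamma> j))"
  proof (rule summable_comparison_test'[OF summ'])
    show "norm (norm (\<gamma> j)) \<le> norm (\<gamma> j) * r ^ j" if "j \<ge> 0" for j
      using mult_left_mono[OF one_le_power[of r j], of "norm (\<gamma> j)"] r by simp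
  qed
  have s\<gamma>: "summable \<gamma>" by (rule summable_norm_cancel[OF sn])
  have \<pi>g: "\<pi>g = p *\<^sub>R (\<Sum>j. \<gamma> j)"
    using mu_occupation[OF g] sums_scaleR_right[OF summable_sums[OF s\<gamma>], of p]
    by (simp add: \<pi>g_def p_def \<gamma>_def[abs_def] sums_iff)
  have K00: "0 \<le> K0" using K0[of 0] by (rule order_trans[rotated]) simp
  have w_err: "norm (w m - \<pi>g) * r ^ m \<le> K0 * \<Gamma> + \<Delta>" for m
  proof -
    have "(\<Sum>j. \<gamma> j) = (\<Sum>j. \<gamma> (j + Suc m)) + (\<Sum>j\<le>m. \<gamma> j)"
      using suminf_split_initial_segment[OF s\<gamma>, of "Suc m"] by (simp add: lessThan_Suc_atMost)
    then have "w m - \<pi>g = (\<Sum>j\<le>m. (u (m - j) - p) *\<^sub>R \<gamma> j) - p *\<^sub>R (\<Sum>j. \<gamma> (j + Suc m))"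
      using nu_markov_op_pow[OF g, of m]
      by (simp add: w_def \<pi>g u_def \<gamma>_def[symmetric] scaleR_diff_left sum_subtractf scaleR_add_right scaleR_sum_right)
    then have "norm (w m - \<pi>g) \<le> norm (\<Sum>j\<le>m. (u (m - j) - p) *\<^sub>R \<gamma> j) + norm (p *\<^sub>R (\<Sum>j. \<gamma> (j + Suc m)))"
      by (metis norm_triangle_ineq4)
    also have "\<dots> \<le> (\<Sum>j\<le>m. \<bar>u (m - j) - p\<bar> * norm (\<gamma> j)) + (\<Sum>j. norm (\<gamma> (j + Suc m)))"
    proof (rule add_mono)
      show "norm (\<Sum>j\<le>m. (u (m - j) - p) *\<^sub>R \<gamma> j) \<le> (\<Sum>j\<le>m. \<bar>u (m - j) - p\<bar> * norm (\<gamma> j))"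
        by (rule order_trans[OF norm_sum]) simp
      have "norm (p *\<^sub>R (\<Sum>j. \<gamma> (j + Suc m))) \<le> 1 * norm (\<Sum>j. \<gamma> (j + Suc m))"
        using p by (simp add: mult_left_le_one_le)
      also have "\<dots> \<le> (\<Sum>j. norm (\<gamma> (j + Suc m)))"
        unfolding mult_1 by (intro summable_norm summable_ignore_initial_segment[OF sn])
      finally show "norm (p *\<^sub>R (\<Sum>j. \<gamma> (j + Suc m))) \<le> (\<Sum>j. norm (\<gamma> (j + Suc m)))" .
    qed
    finally have "norm (w m - \<pi>g) * r ^ m
        \<le> ((\<Sum>j\<le>m. \<bar>u (m - j) - p\<bar> * norm (\<gamma> j)) + (\<Sum>j. norm (\<gamma> (j + Suc m)))) * r ^ m"
      using r by (intro mult_right_mono) auto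
    also have "\<dots> = (\<Sum>j\<le>m. (\<bar>u (m - j) - p\<bar> * r ^ (m - j)) * (norm (\<gamma> j) * r ^ j))
        + (\<Sum>j. norm (\<gamma> (j + Suc m))) * r ^ m"
    proof -
      have "(\<Sum>j\<le>m. \<bar>u (m - j) - p\<bar> * norm (\<gamma> j)) * r ^ m
        = (\<Sum>j\<le>m. (\<bar>u (m - j) - p\<bar> * r ^ (m - j)) * (norm (\<gamma> j) * r ^ j))"
        unfolding sum_distrib_right
      proof (rule sum.cong[OF refl])
        fix j assume "j \<in> {..m}"
        then have "r ^ m = r ^ (m - j) * r ^ j" unfolding power_add[symmetric] by simp
        then show "\<bar>u (m - j) - p\<bar> * norm (\<gamma> j) * r ^ m
          = (\<bar>u (m - j) - p\<bar> * r ^ (m - j)) * (norm (\<gamma> j) * r ^ j)" by (simp only: mult_ac)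
      qed
      then show ?thesis by (simp add: distrib_right)
    qed
    also have "\<dots> \<le> (\<Sum>j\<le>m. K0 * (norm (\<gamma> j) * r ^ j)) + \<Delta>"
      using K0 \<Delta>[of m] r by (intro add_mono sum_mono mult_right_mono) (auto simp: u_def p_def \<gamma>_def)
    also have "(\<Sum>j\<le>m. K0 * (norm (\<gamma> j) * r ^ j)) \<le> K0 * \<Gamma>"
    proof -
      have "(\<Sum>j\<le>m. norm (\<gamma> j) * r ^ j) \<le> (\<Sum>j. norm (\<gamma> j) * r ^ j)"
        using r by (intro sum_le_suminf summ') auto
      also have "\<dots> \<le> \<Gamma>" using \<Gamma> by (simp add: \<gamma>_def)
      finally show ?thesis unfolding sum_distrib_left[symmetric] using K00 by (rule mult_left_mono)
    qed
    finally show ?thesis by simp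
  qed
  define M where "M = K0 * \<Gamma> + \<Delta>"
  have M0: "0 \<le> M" using w_err[of 0] unfolding M_def by (rule order_trans[rotated]) simp
  have "(markov_op P ^^ n) g x - \<pi>g
      = (J ^^ n) g x - avoid n x *\<^sub>R \<pi>g + (\<Sum>k<n. hit k x *\<^sub>R (w (n - 1 - k) - \<pi>g))"
    unfolding markov_op_pow_decomp[OF g x] avoid_eq[OF x]
    by (simp add: w_def scaleR_diff_right sum_subtractf scaleR_sum_left scaleR_diff_left)
  then have "norm ((markov_op P ^^ n) g x - \<pi>g)
      \<le> norm ((J ^^ n) g x) + norm (avoid n x *\<^sub>R \<pi>g) + norm (\<Sum>k<n. hit k x *\<^sub>R (w (n - 1 - k) - \<pi>g))"
    using norm_triangle_ineq[of "(J ^^ n) g x - avoid n x *\<^sub>R \<pi>g" "\<Sum>k<n. hit k x *\<^sub>R (w (n - 1 - k) - \<pi>g)"]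
      norm_triangle_ineq4[of "(J ^^ n) g x" "avoid n x *\<^sub>R \<pi>g"] by simp
  also have "\<dots> \<le> norm ((J ^^ n) g x) + avoid n x * norm \<pi>g + (\<Sum>k<n. hit k x * norm (w (n - 1 - k) - \<pi>g))"
  proof -
    have "norm (\<Sum>k<n. hit k x *\<^sub>R (w (n - 1 - k) - \<pi>g)) \<le> (\<Sum>k<n. hit k x * norm (w (n - 1 - k) - \<pi>g))"
      by (rule order_trans[OF norm_sum]) (simp add: hit_nonneg[OF x])
    then show ?thesis by (simp add: avoid_nonneg[OF x])
  qed
  finally have "norm ((markov_op P ^^ n) g x - \<pi>g) * r ^ n
     \<le> (norm ((J ^^ n) g x) + avoid n x * norm \<pi>g + (\<Sum>k<n. hit k x * norm (w (n - 1 - k) - \<pi>g))) * r ^ n"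
    using r by (intro mult_right_mono) auto
  also have "\<dots> = norm ((J ^^ n) g x) * r ^ n + avoid n x * r ^ n * norm \<pi>g
     + r * (\<Sum>k<n. (r ^ k * hit k x) * (norm (w (n - 1 - k) - \<pi>g) * r ^ (n - 1 - k)))"
  proof -
    have "(\<Sum>k<n. hit k x * norm (w (n - 1 - k) - \<pi>g)) * r ^ n
      = r * (\<Sum>k<n. (r ^ k * hit k x) * (norm (w (n - 1 - k) - \<pi>g) * r ^ (n - 1 - k)))"
      unfolding sum_distrib_right sum_distrib_left
    proof (rule sum.cong[OF refl])
      fix k assume "k \<in> {..<n}"
      then have "n = Suc (k + (n - 1 - k))" by simp
      then have "r ^ n = r * (r ^ k * r ^ (n - 1 - k))" by (metis power_Suc power_add)
      then show "hit k x * norm (w (n - 1 - k) - \<pi>g) * r ^ n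
        = r * ((r ^ k * hit k x) * (norm (w (n - 1 - k) - \<pi>g) * r ^ (n - 1 - k)))" by (simp only: mult_ac)
    qed
    then show ?thesis by (simp only: distrib_right) (simp add: mult_ac)
  qed
  also have "(\<Sum>k<n. (r ^ k * hit k x) * (norm (w (n - 1 - k) - \<pi>g) * r ^ (n - 1 - k)))
      \<le> (\<Sum>k<n. (R ^ k * hit k x) * M)"
    using w_err r M0 hit_nonneg[OF x]
    by (intro sum_mono mult_mono power_mono) (auto simp: M_def)
  also have "\<dots> \<le> V x * M"
    unfolding sum_distrib_right[symmetric] using M0 by (intro mult_right_mono hit_gf_le_V x)
  finally show ?thesis using r by (simp add: \<pi>g_def M_def mult.assoc)
qed

text \<open>For \<open>\<parallel>g\<parallel>\<^sub>V \<le> G\<close> all killed quantities decay like \<open>l\<^sup>n\<close>, which beats \<open>r\<^sup>n\<close> as \<open>l r < 1\<close>. The constant \<open>M\<close> does not depend on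
\<open>g\<close>, \<open>x\<close> and \<open>n\<close>.\<close>

lemma V_convergence:
  assumes r: "1 < r" "r < R"
    and K0: "\<And>n. \<bar>renewal_seq ret n - measure \<mu> C\<bar> * r ^ n \<le> K0"
  defines "M \<equiv> 1 + K / (1 - l) + r * ((K0 + 1) * (K / (1 - l * r)))"
  assumes g: "dominated (g :: 'a \<Rightarrow> 'b::euclidean_space) G" and x: "x \<in> space S" and n: "1 \<le> n"
  shows "norm ((markov_op P ^^ n) g x - (\<integral>y. g y \<partial>\<mu>)) * r ^ n \<le> M * G * V x"
proof -
  have lr: "0 < l * r" "l * r < 1" using l_range r R mult_strict_left_mono[of r R l] by (auto simp: mult.commute)
  have G0: "0 \<le> G" by (rule dominatedD(2)[OF g])
  have V0: "0 < V x" by (rule V_pos[OF x])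
  let ?\<gamma> = "\<lambda>j. norm (\<integral>y. (J ^^ j) g y \<partial>\<nu>)"
  have \<gamma>: "?\<gamma> j * r ^ j \<le> G * K * (l * r) ^ j" for j
    using mult_right_mono[OF norm_nu_le[OF dominated_J_pow[OF g]], of "r ^ j" j] r
    by (simp add: mult_ac power_mult_distrib)
  have sgeo: "summable (\<lambda>j. G * K * (l * r) ^ j)" using lr by (intro summable_mult summable_geometric) auto
  have summ: "summable (\<lambda>j. ?\<gamma> j * r ^ j)"
    by (rule summable_comparison_test'[OF sgeo, of 0]) (use \<gamma> r in auto)
  define \<Gamma> where "\<Gamma> = G * (K / (1 - l * r))"
  have \<Gamma>: "(\<Sum>j. ?\<gamma> j * r ^ j) \<le> \<Gamma>"
  proof -
    have "(\<Sum>j. ?\<gamma> j * r ^ j) \<le> (\<Sum>j. G * K * (l * r) ^ j)" by (intro suminf_le summ sgeo \<gamma>)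
    also have "\<dots> = G * K * (1 / (1 - l * r))"
      using lr by (subst suminf_mult) (auto intro!: summable_geometric simp: suminf_geometric)
    finally show ?thesis by (simp add: \<Gamma>_def)
  qed
  have \<Delta>: "(\<Sum>j. ?\<gamma> (j + Suc m)) * r ^ m \<le> \<Gamma>" for m
  proof -
    have le: "?\<gamma> (j + Suc m) * r ^ m \<le> ?\<gamma> (j + Suc m) * r ^ (j + Suc m)" for j
      using r by (intro mult_left_mono power_increasing) auto
    have s1: "summable (\<lambda>j. ?\<gamma> (j + Suc m) * r ^ (j + Suc m))"
      using summable_ignore_initial_segment[OF summ, of "Suc m"] .
    have s2: "summable (\<lambda>j. ?\<gamma> (j + Suc m) * r ^ m)"
      by (rule summable_comparison_test'[OF s1, of 0]) (use le r in auto)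
    have s3: "summable (\<lambda>j. ?\<gamma> (j + Suc m))"
      using s2 r summable_mult2[OF s2, of "1 / r ^ m"] by simp
    have "(\<Sum>j. ?\<gamma> (j + Suc m)) * r ^ m = (\<Sum>j. ?\<gamma> (j + Suc m) * r ^ m)" by (rule suminf_mult2[OF s3])
    also have "\<dots> \<le> (\<Sum>j. ?\<gamma> (j + Suc m) * r ^ (j + Suc m))" by (intro suminf_le s1 s2 le)
    also have "\<dots> \<le> (\<Sum>j. ?\<gamma> j * r ^ j)"
    proof -
      have "0 \<le> (\<Sum>j<Suc m. ?\<gamma> j * r ^ j)" using r by (intro sum_nonneg) auto
      then show ?thesis using suminf_split_initial_segment[OF summ, of "Suc m"] by linarith
    qed
    finally show ?thesis using \<Gamma> by linarith
  qed
  have pow1: "(l * r) ^ n \<le> 1" using lr by (intro power_le_one) auto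
  have "norm ((markov_op P ^^ n) g x - (\<integral>y. g y \<partial>\<mu>)) * r ^ n
    \<le> norm ((J ^^ n) g x) * r ^ n + avoid n x * r ^ n * norm (\<integral>y. g y \<partial>\<mu>) + r * V x * (K0 * \<Gamma> + \<Gamma>)"
    using r by (intro markov_op_pow_error[OF g x n _ _ K0 summ \<Gamma> \<Delta>]) auto
  also have "norm ((J ^^ n) g x) * r ^ n \<le> G * V x"
  proof -
    have "norm ((J ^^ n) g x) * r ^ n \<le> l ^ n * G * V x * r ^ n"
      using r by (intro mult_right_mono dominatedD(3)[OF dominated_J_pow[OF g] x]) auto
    also have "\<dots> = (l * r) ^ n * (G * V x)" by (simp add: power_mult_distrib)
    also have "\<dots> \<le> 1 * (G * V x)" using pow1 G0 V0 by (intro mult_right_mono) auto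
    finally show ?thesis by simp
  qed
  also have "avoid n x * r ^ n * norm (\<integral>y. g y \<partial>\<mu>) \<le> V x * (G * (K / (1 - l)))"
  proof (rule mult_mono[OF _ norm_mu_le[OF g]])
    have "avoid n x * r ^ n \<le> l ^ n * V x * r ^ n"
      using r dominatedD(3)[OF dominated_avoid x, of n] by (intro mult_right_mono) auto
    also have "\<dots> = (l * r) ^ n * V x" by (simp add: power_mult_distrib)
    also have "\<dots> \<le> 1 * V x" using pow1 V0 by (intro mult_right_mono) auto
    finally show "avoid n x * r ^ n \<le> V x" by simp
  qed (use V0 in auto)
  also have "G * V x + V x * (G * (K / (1 - l))) + r * V x * (K0 * \<Gamma> + \<Gamma>) = M * G * V x" by (simp add: M_def \<Gamma>_def algebra_simps add_divide_distrib)
  finally show ?thesis by simp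
qed

text \<open>For bounded \<open>g\<close> the sharper estimates \<open>\<bar>J\<^sup>n g\<bar> \<le> s Pr(\<sigma> \<ge> n)\<close> and \<open>\<bar>\<nu>(J\<^sup>j g)\<bar> \<le> s c\<^sub>j\<close> are available. The summands
of \<open>M1_bound\<close> arise as follows: \<open>J\<^sup>n g\<close> and \<open>(J\<^sup>n 1) \<pi>(g)\<close> contribute \<open>r / (R - 1)\<close> each, the tails \<open>\<Sum>\<^bsub>j>m\<^esub> c\<^sub>j\<close> contribute
\<open>r B / (R - 1)\<close>, and the error of the renewal sequence contributes \<open>r N K\<^sub>0\<close>.\<close>

lemma bounded_convergence:
  assumes r: "1 < r" "r < R"
    and K0: "\<And>n. \<bar>renewal_seq ret n - measure \<mu> C\<bar> * r ^ n \<le> K0"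
    and g: "g \<in> borel_measurable S" and bd: "\<And>x. x \<in> space S \<Longrightarrow> norm (g x) \<le> s" and s: "0 \<le> s"
    and x: "x \<in> space S" and n: "1 \<le> n"
  shows "norm ((markov_op P ^^ n) (g :: 'a \<Rightarrow> 'b::euclidean_space) x - (\<integral>y. g y \<partial>\<mu>)) * r ^ n
    \<le> M1_bound l K K0 r * s * V x"
proof -
  interpret mu: prob_space \<mu> by (rule mu_prob)
  have gd: "dominated g s"
    unfolding dominated_def
  proof (intro conjI ballI g s)
    fix x assume x: "x \<in> space S"
    show "norm (g x) \<le> s * V x" using bd[OF x] mult_left_mono[OF V_ge_1[OF x] s] by simp
  qed
  have sd: "dominated (\<lambda>_. s) s" using dominated_const[of s] s by simp
  have Js: "(J ^^ n) (\<lambda>_. s) x = s * avoid n x" if "x \<in> space S" for x n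
    using that
  proof (induction n arbitrary: x)
    case (Suc n)
    have "(J ^^ Suc n) (\<lambda>_. s) x = J (\<lambda>y. s * avoid n y) x" using Suc by (auto intro!: J_cong)
    then show ?case by (simp add: J_scale avoid_Suc)
  qed (simp add: avoid_0)
  have Jg: "norm ((J ^^ n) g x) \<le> s * avoid n x" if "x \<in> space S" for x n
    using norm_J_pow_le[OF gd sd bd that] Js[OF that] by simp
  let ?c = "survival ret"
  let ?\<gamma> = "\<lambda>j. norm (\<integral>y. (J ^^ j) g y \<partial>\<nu>)"
  have \<gamma>: "?\<gamma> j \<le> s * ?c j" for j
  proof -
    have "?\<gamma> j \<le> (\<integral>y. s * avoid j y \<partial>\<nu>)"
      using Jg dominated_nu[OF dominated_avoid] by (intro norm_integral_le dominated_nu[OF dominated_J_pow[OF gd]]) auto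
    then show ?thesis by (simp add: nu_avoid)
  qed
  have sc: "summable (\<lambda>j. s * (?c j * r ^ j))"
    using r by (intro summable_mult ren.c_summable_real) auto
  have \<gamma>r: "?\<gamma> j * r ^ j \<le> s * (?c j * r ^ j)" for j
    using mult_right_mono[OF \<gamma>[of j], of "r ^ j"] r by (simp add: mult.assoc)
  have summ: "summable (\<lambda>j. ?\<gamma> j * r ^ j)"
    by (rule summable_comparison_test'[OF sc, of 0]) (use \<gamma>r r in auto)
  have \<Gamma>: "(\<Sum>j. ?\<gamma> j * r ^ j) \<le> s * (1 + B)"
  proof -
    have "(\<Sum>j. ?\<gamma> j * r ^ j) \<le> (\<Sum>j. s * (?c j * R ^ j))"
    proof (intro suminf_le summ summable_mult ren.c_summable_R)
      fix j show "?\<gamma> j * r ^ j \<le> s * (?c j * R ^ j)"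
        using r s survival_ret_nonneg by (intro order_trans[OF \<gamma>r] mult_left_mono power_mono) auto
    qed
    also have "\<dots> = s * (\<Sum>j. ?c j * R ^ j)" by (rule suminf_mult[OF ren.c_summable_R])
    also have "\<dots> \<le> s * (1 + B)"
      using ren.suminf_c_power[of R] R ren.tail_R_le_B s by (intro mult_left_mono) auto
    finally show ?thesis .
  qed
  have \<Delta>: "(\<Sum>j. ?\<gamma> (j + Suc m)) * r ^ m \<le> s * (B / (R - 1))" for m
  proof -
    have st: "summable (\<lambda>j. ?c (Suc (j + m)) * R ^ Suc (j + m))"
      using summable_ignore_initial_segment[OF ren.tail_summable_R, of m] .
    have le: "?\<gamma> (j + Suc m) * r ^ m \<le> s / (R - 1) * (?c (Suc (j + m)) * R ^ Suc (j + m))" for j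
    proof -
      \<comment> \<open>Every \<open>j > m\<close> has \<open>(R - 1) r\<^sup>m \<le> R\<^sup>j\<close>, so the tail is controlled by \<open>\<Sum> c\<^sub>j R\<^sup>j\<close>.\<close>
      have "(R - 1) * r ^ m \<le> R * R ^ m" using r by (intro mult_mono power_mono) auto
      also have "\<dots> \<le> R ^ Suc (j + m)" using R power_increasing[of "Suc m" "Suc (j + m)" R] by simp
      finally have "r ^ m \<le> R ^ Suc (j + m) / (R - 1)" using R by (simp add: pos_le_divide_eq mult.commute)
      then have "?\<gamma> (j + Suc m) * r ^ m \<le> (s * ?c (j + Suc m)) * (R ^ Suc (j + m) / (R - 1))"
        using r s survival_ret_nonneg by (intro mult_mono \<gamma>) auto
      then show ?thesis by (simp add: mult_ac)
    qed
    have s2: "summable (\<lambda>j. ?\<gamma> (j + Suc m) * r ^ m)"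
      by (rule summable_comparison_test'[OF summable_mult[OF st, of "s / (R - 1)"], of 0]) (use le r in auto)
    have s3: "summable (\<lambda>j. ?\<gamma> (j + Suc m))"
      using r summable_mult2[OF s2, of "1 / r ^ m"] by simp
    have "(\<Sum>j. ?\<gamma> (j + Suc m)) * r ^ m = (\<Sum>j. ?\<gamma> (j + Suc m) * r ^ m)" by (rule suminf_mult2[OF s3])
    also have "\<dots> \<le> (\<Sum>j. s / (R - 1) * (?c (Suc (j + m)) * R ^ Suc (j + m)))"
      by (intro suminf_le s2 summable_mult st le)
    also have "\<dots> = s / (R - 1) * (\<Sum>j. ?c (Suc (j + m)) * R ^ Suc (j + m))" by (rule suminf_mult[OF st])
    also have "\<dots> \<le> s / (R - 1) * B"
    proof (rule mult_left_mono)
      have "0 \<le> (\<Sum>j<m. ?c (Suc j) * R ^ Suc j)"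
        using R survival_ret_nonneg by (intro sum_nonneg mult_nonneg_nonneg) auto
      then show "(\<Sum>j. ?c (Suc (j + m)) * R ^ Suc (j + m)) \<le> B"
        using suminf_split_initial_segment[OF ren.tail_summable_R, of m] ren.tail_R_le_B by linarith
    qed (use s R in auto)
    finally show ?thesis by simp
  qed
  have mug: "norm (\<integral>y. g y \<partial>\<mu>) \<le> s"
    using norm_integral_le[OF dominated_mu[OF gd] dominated_mu[OF sd]] bd mu.prob_space by simp
  have av: "avoid n x * r ^ n \<le> r * V x / (R - 1)"
  proof -
    obtain m where m: "n = Suc m" using n by (cases n) auto
    have "(\<Sum>i<Suc m. R ^ i * avoid (Suc i) x) \<ge> R ^ m * avoid n x"
      using avoid_nonneg[OF x] R by (auto simp: m intro!: sum_nonneg)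
    then have "(R - 1) * (R ^ m * avoid n x) \<le> (R - 1) * (\<Sum>i<Suc m. R ^ i * avoid (Suc i) x)"
      using R by (intro mult_left_mono) auto
    also have "\<dots> \<le> V x" using avoid_gf_le_V[OF x, of "Suc m"] by simp
    finally have 1: "R ^ m * avoid n x \<le> V x / (R - 1)" using R by (simp add: pos_le_divide_eq mult.commute)
    have "r ^ m * avoid n x \<le> R ^ m * avoid n x"
      using r avoid_nonneg[OF x] by (intro mult_right_mono power_mono) auto
    with 1 have "r * (r ^ m * avoid n x) \<le> r * (V x / (R - 1))" using r by (intro mult_left_mono) auto
    then show ?thesis by (simp add: m mult_ac)
  qed
  have "norm ((markov_op P ^^ n) g x - (\<integral>y. g y \<partial>\<mu>)) * r ^ n
    \<le> norm ((J ^^ n) g x) * r ^ n + avoid n x * r ^ n * norm (\<integral>y. g y \<partial>\<mu>)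
      + r * V x * (K0 * (s * (1 + B)) + s * (B / (R - 1)))"
    using r by (intro markov_op_pow_error[OF gd x n _ _ K0 summ \<Gamma> \<Delta>]) auto
  also have "norm ((J ^^ n) g x) * r ^ n \<le> s * (r * V x / (R - 1))"
  proof -
    have "norm ((J ^^ n) g x) * r ^ n \<le> s * avoid n x * r ^ n"
      using r Jg[OF x] by (intro mult_right_mono) auto
    also have "\<dots> \<le> s * (r * V x / (R - 1))"
      unfolding mult.assoc by (intro mult_left_mono av s)
    finally show ?thesis .
  qed
  also have "avoid n x * r ^ n * norm (\<integral>y. g y \<partial>\<mu>) \<le> r * V x / (R - 1) * s"
    using R V_pos[OF x] r by (intro mult_mono mug av) auto
  also have "s * (r * V x / (R - 1)) + r * V x / (R - 1) * s + r * V x * (K0 * (s * (1 + B)) + s * (B / (R - 1)))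
     = r * (2 * (1 / (R - 1)) + B / (R - 1) + (1 + B) * K0) * s * V x"
    by (simp add: algebra_simps)
  also have "r * (2 * (1 / (R - 1)) + B / (R - 1) + (1 + B) * K0) = M1_bound l K K0 r"
    unfolding B_scaled one_plus_B inverse_R_minus_1 by (simp add: M1_bound_def algebra_simps)
  finally show ?thesis by simp
qed

end

section \<open>Weighted norms and the resolvent\<close>

context stationary_atomic_chain
begin

lemma V_norm_le_iff:
  "V_norm S V f \<le> ereal c \<longleftrightarrow> (\<forall>x\<in>space S. norm (f x) \<le> c * V x)"
  unfolding V_norm_def SUP_le_iff using V_pos by (auto simp: pos_divide_le_eq)

lemma space_nonempty: "space S \<noteq> {}"
  using C_nonempty C_space by auto

lemma BV_dominated:
  fixes g :: "'a \<Rightarrow> 'b::{banach, second_countable_topology}"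
  assumes "g \<in> BV S V"
  obtains v where "V_norm S V g = ereal v" "dominated g v"
proof -
  obtain x where x: "x \<in> space S" using space_nonempty by auto
  have fin: "V_norm S V g < \<infinity>" and m: "g \<in> borel_measurable S" using assms by (auto simp: BV_def)
  have "ereal 0 \<le> ereal (norm (g x) / V x)" using V_pos[OF x] by simp
  also have "\<dots> \<le> V_norm S V g" unfolding V_norm_def using x by (rule SUP_upper)
  finally obtain v where v: "V_norm S V g = ereal v" "0 \<le> v"
    using fin by (cases "V_norm S V g") auto
  have "dominated g v"
    using V_norm_le_iff[of g v] v m by (simp add: dominated_def)
  with v show ?thesis using that by blast
qed

lemma dominated_BV: "dominated g G \<Longrightarrow> g \<in> BV S V"
  using V_norm_le_iff[of g G] le_less_trans[of "V_norm S V g" "ereal G" \<infinity>]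
  by (auto simp: BV_def dominated_def)

lemma markov_op_pow_diff:
  assumes "dominated f F" "dominated g G" "x \<in> space S"
  shows "(markov_op P ^^ n) (\<lambda>y. a * f y - g y :: complex) x
    = a * (markov_op P ^^ n) f x - (markov_op P ^^ n) g x"
  using assms(3)
proof (induction n arbitrary: x)
  case (Suc n)
  obtain F' G' where d: "dominated ((markov_op P ^^ n) f) F'" "dominated ((markov_op P ^^ n) g) G'"
    using dominated_markov_op_pow[OF assms(1)] dominated_markov_op_pow[OF assms(2)] by metis
  have "(markov_op P ^^ Suc n) (\<lambda>y. a * f y - g y) x
      = (\<integral>y. a * (markov_op P ^^ n) f y - (markov_op P ^^ n) g y \<partial>P x)"
    using Suc by (auto simp: markov_op_def[of P _ x] intro!: Bochner_Integration.integral_cong)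
  also have "\<dots> = a * (markov_op P ^^ Suc n) f x - (markov_op P ^^ Suc n) g x"
    using dominated_P[OF d(1) Suc.prems] dominated_P[OF d(2) Suc.prems]
    by (simp add: markov_op_def[of P _ x])
  finally show ?case .
qed simp

lemma markov_op_pow_const: "x \<in> space S \<Longrightarrow> (markov_op P ^^ n) (\<lambda>_. a :: complex) x = a"
proof (induction n arbitrary: x)
  case (Suc n)
  interpret p: prob_space "P x" by (rule P_prob[OF Suc.prems])
  have "(\<integral>y. (markov_op P ^^ n) (\<lambda>_. a) y \<partial>P x) = (\<integral>y. a \<partial>P x)"
    using Suc by (intro Bochner_Integration.integral_cong) auto
  then show ?case using p.prob_space Suc.prems by (simp add: markov_op_def[of P _ x])
qed simp

abbreviation T :: "('a \<Rightarrow> complex) \<Rightarrow> 'a \<Rightarrow> complex" where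
  "T \<equiv> \<lambda>g x. markov_op P g x - (\<integral>y. g y \<partial>\<mu>)"

text \<open>The inverse of \<open>z - T\<close>, where \<open>T = P - 1 \<otimes> \<pi>\<close>, is the Neumann series \<open>\<Sum>\<^sub>n z\<^bsup>-n-1\<^esup> T\<^sup>n\<close>. As \<open>T\<^sup>n h = P\<^sup>n h - \<pi>(h)\<close> for
\<open>n \<ge> 1\<close> only, the term \<open>h / z\<close> is kept apart and \<open>F h n\<close> is the term of index \<open>n + 1\<close>.\<close>

lemma resolvent_set:
  assumes r: "1 < r" "r < R" and K0: "\<And>n. \<bar>renewal_seq ret n - measure \<mu> C\<bar> * r ^ n \<le> K0"
    and z: "1 < r * cmod z"
  shows "z \<in> BV_resolvent_set S V T"
proof -
  interpret mu: prob_space \<mu> by (rule mu_prob)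
  define M where "M = 1 + K / (1 - l) + r * ((K0 + 1) * (K / (1 - l * r)))"
  define F where "F h n x = ((markov_op P ^^ Suc n) h x - (\<integral>y. h y \<partial>\<mu>)) / z ^ (n + 2)"
    for h :: "'a \<Rightarrow> complex" and n x
  define A where "A h x = h x / z + (\<Sum>n. F h n x)" for h x
  define \<theta> where "\<theta> = 1 / (r * cmod z)"
  have z0: "z \<noteq> 0" using z by auto
  have th: "0 < \<theta>" "\<theta> < 1" using z by (auto simp: \<theta>_def)
  have conv: "norm ((markov_op P ^^ Suc n) h x - (\<integral>y. h y \<partial>\<mu>)) * r ^ Suc n \<le> M * G * V x"
    if "dominated h G" "x \<in> space S" for h :: "'a \<Rightarrow> complex" and G x n
    unfolding M_def using r by (intro V_convergence K0 that) auto
  have M0: "0 \<le> M"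
  proof -
    obtain x where x: "x \<in> space S" using space_nonempty by auto
    have "0 \<le> M * norm (1::complex) * V x"
      using r by (rule_tac order_trans[OF _ conv[OF dominated_const x, of 0]]) simp
    then show ?thesis using V_pos[OF x] by (simp add: zero_le_mult_iff)
  qed
  define E where "E = M / cmod z"
  have E0: "0 \<le> E" using M0 by (simp add: E_def)
  have F_le: "norm (F h n x) \<le> E * \<theta> ^ Suc n * G * V x" if "dominated h G" "x \<in> space S" for h G n x
  proof -
    have "norm (F h n x) = norm ((markov_op P ^^ Suc n) h x - (\<integral>y. h y \<partial>\<mu>)) * r ^ Suc n / (r ^ Suc n * cmod z ^ (n + 2))"
      using r by (simp add: F_def norm_divide norm_power norm_mult)
    also have "\<dots> \<le> M * G * V x / (r ^ Suc n * cmod z ^ (n + 2))"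
      using r by (intro divide_right_mono conv that) auto
    also have "\<dots> = E * \<theta> ^ Suc n * G * V x" using r z0 by (simp add: E_def \<theta>_def power_divide power_mult_distrib)
    finally show ?thesis .
  qed
  have F_dom: "dominated (F h n) (E * \<theta> ^ Suc n * G)" if h: "dominated h G" for h G n
    unfolding dominated_def
  proof (intro conjI ballI)
    obtain H where H: "dominated ((markov_op P ^^ Suc n) h) H" using dominated_markov_op_pow[OF h] by blast
    show "F h n \<in> borel_measurable S" using dominatedD(1)[OF H] unfolding F_def[abs_def] by measurable
    show "0 \<le> E * \<theta> ^ Suc n * G" using E0 th dominatedD(2)[OF h] by simp
  qed (rule F_le[OF h])
  have sgeo: "summable (\<lambda>n. E * \<theta> ^ Suc n * c)" for c
    using th by (intro summable_mult2 summable_mult) (simp add: summable_geometric summable_Suc_iff)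
  have F_norm_summable: "summable (\<lambda>n. norm (F h n x))" if h: "dominated h G" and x: "x \<in> space S" for h G x
    by (rule summable_comparison_test'[OF sgeo[of "G * V x"], of 0]) (use F_le[OF h x] in \<open>simp add: mult_ac\<close>)
  note F_summable = summable_norm_cancel[OF F_norm_summable]
  define c where "c = (\<Sum>n. E * \<theta> ^ Suc n)"
  have c_sum: "summable (\<lambda>n. E * \<theta> ^ Suc n)" using sgeo[of 1] by simp
  have sumF_le: "norm (\<Sum>n. F h n x) \<le> c * G * V x" if h: "dominated h G" and x: "x \<in> space S" for h G x
  proof -
    have "norm (\<Sum>n. F h n x) \<le> (\<Sum>n. E * \<theta> ^ Suc n * (G * V x))"
      using F_le[OF h x] by (intro norm_suminf_le sgeo) (simp add: mult_ac)
    also have "\<dots> = c * (G * V x)" unfolding c_def by (rule suminf_mult2[OF c_sum, symmetric])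
    finally show ?thesis by (simp add: mult_ac)
  qed
  have A_dom: "dominated (A h) ((1 / cmod z + c) * G)" if h: "dominated h G" for h G
    unfolding dominated_def
  proof (intro conjI ballI)
    have [measurable]: "F h n \<in> borel_measurable S" "h \<in> borel_measurable S" for n
      using dominatedD(1)[OF F_dom[OF h]] dominatedD(1)[OF h] by auto
    show "A h \<in> borel_measurable S" unfolding A_def[abs_def] by measurable
    have "0 \<le> c" unfolding c_def using E0 th by (intro suminf_nonneg c_sum) auto
    then show "0 \<le> (1 / cmod z + c) * G" using dominatedD(2)[OF h] by simp
    fix x assume x: "x \<in> space S"
    have "norm (A h x) \<le> norm (h x) / cmod z + c * G * V x"
      unfolding A_def using sumF_le[OF h x] by (intro norm_triangle_le) (simp add: norm_divide)
    also have "\<dots> \<le> G * V x / cmod z + c * G * V x"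
      using dominatedD(3)[OF h x] by (intro add_right_mono divide_right_mono) auto
    finally show "norm (A h x) \<le> (1 / cmod z + c) * G * V x" by (simp add: algebra_simps)
  qed
  have integral_A: "(\<integral>y. A h y \<partial>Q) = (\<integral>y. h y \<partial>Q) / z + (\<Sum>n. \<integral>y. F h n y \<partial>Q)"
    if h: "dominated h G" and Q: "sets Q = sets S" "integrable Q V" for h G Q
  proof -
    have sp: "space Q = space S" by (rule sets_eq_imp_space_eq[OF Q(1)])
    have iF: "integrable Q (F h n)" for n by (rule dominated_integrable(1)[OF F_dom[OF h] Q])
    have "norm (\<integral>y. norm (F h n y) \<partial>Q) \<le> E * \<theta> ^ Suc n * (G * (\<integral>y. V y \<partial>Q))" for n
    proof -
      have "norm (\<integral>y. norm (F h n y) \<partial>Q) \<le> (\<integral>y. E * \<theta> ^ Suc n * G * V y \<partial>Q)"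
        using F_le[OF h] Q sp by (intro norm_integral_le integrable_norm iF) auto
      then show ?thesis by (simp add: mult_ac)
    qed
    then have s: "summable (\<lambda>n. \<integral>y. norm (F h n y) \<partial>Q)"
      by (intro summable_comparison_test'[OF sgeo]) auto
    have ae: "AE y in Q. summable (\<lambda>n. norm (F h n y))"
      using F_norm_summable[OF h] by (intro AE_I2) (simp add: sp)
    have "integrable Q (\<lambda>y. \<Sum>n. F h n y)" by (rule integrable_suminf[OF iF ae s])
    then show "(\<integral>y. A h y \<partial>Q) = (\<integral>y. h y \<partial>Q) / z + (\<Sum>n. \<integral>y. F h n y \<partial>Q)"
      unfolding A_def using dominated_integrable(1)[OF h Q] integral_suminf[OF iF ae s]
      by (subst Bochner_Integration.integral_add) auto
  qed
  have P_F: "(\<integral>y. F h n y \<partial>P x) = z * F h (Suc n) x" if h: "dominated h G" and x: "x \<in> space S" for h G n x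
  proof -
    interpret p: prob_space "P x" by (rule P_prob[OF x])
    obtain H where H: "dominated ((markov_op P ^^ Suc n) h) H" using dominated_markov_op_pow[OF h] by blast
    have "(\<integral>y. F h n y \<partial>P x) = (\<integral>y. (markov_op P ^^ Suc n) h y - (\<integral>y. h y \<partial>\<mu>) \<partial>P x) / z ^ (n + 2)"
      by (simp add: F_def)
    also have "(\<integral>y. (markov_op P ^^ Suc n) h y - (\<integral>y. h y \<partial>\<mu>) \<partial>P x)
       = (markov_op P ^^ Suc (Suc n)) h x - (\<integral>y. h y \<partial>\<mu>)"
      using dominated_P[OF H x] p.prob_space x
      by (subst Bochner_Integration.integral_diff) (auto simp: markov_op_def[of P _ x])
    finally show ?thesis using z0 by (simp add: F_def)
  qed
  have mu_F: "(\<integral>y. F h n y \<partial>\<mu>) = 0" if h: "dominated h G" for h G n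
  proof -
    obtain H where H: "dominated ((markov_op P ^^ Suc n) h) H" using dominated_markov_op_pow[OF h] by blast
    have "(\<integral>y. F h n y \<partial>\<mu>) = (\<integral>y. (markov_op P ^^ Suc n) h y - (\<integral>y. h y \<partial>\<mu>) \<partial>\<mu>) / z ^ (n + 2)"
      by (simp add: F_def)
    also have "(\<integral>y. (markov_op P ^^ Suc n) h y - (\<integral>y. h y \<partial>\<mu>) \<partial>\<mu>) = 0"
      using dominated_mu[OF H] mu_markov_op_pow[OF h, of "Suc n"] mu.prob_space
      by (subst Bochner_Integration.integral_diff) auto
    finally show ?thesis by simp
  qed
  have zF0: "z * F h 0 x = T h x / z" for h x using z0 by (simp add: F_def power2_eq_square)
  have right: "z * A h x - T (A h) x = h x" if h: "dominated h G" and x: "x \<in> space S" for h G x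
  proof -
    have sF: "summable (\<lambda>n. F h n x)" by (rule F_summable[OF h x])
    have "(\<integral>y. A h y \<partial>P x) = markov_op P h x / z + (\<Sum>n. z * F h (Suc n) x)"
      using integral_A[OF h P_sets[OF x] P_V[OF x]] P_F[OF h x] by (simp add: markov_op_def)
    moreover have "(\<Sum>n. z * F h (Suc n) x) = z * ((\<Sum>n. F h n x) - F h 0 x)"
    proof -
      have "summable (\<lambda>n. F h (Suc n) x)" using sF summable_Suc_iff[of "\<lambda>n. F h n x"] by simp
      from suminf_mult[OF this, of z] show ?thesis using suminf_split_head[OF sF] by simp
    qed
    moreover have "(\<integral>y. A h y \<partial>\<mu>) = (\<integral>y. h y \<partial>\<mu>) / z"
      using integral_A[OF h mu_sets mu_V] mu_F[OF h] by simp
    ultimately have "T (A h) x = T h x / z + z * (\<Sum>n. F h n x) - z * F h 0 x"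
      by (simp add: markov_op_def[of P "A h"] right_diff_distrib diff_divide_distrib)
    then have "T (A h) x = z * (\<Sum>n. F h n x)" by (simp add: zF0)
    then show ?thesis using z0 by (simp add: A_def distrib_left)
  qed
  have left: "A (\<lambda>y. z * f y - T f y) x = f x" if f: "dominated f G" and x: "x \<in> space S" for f G x
  proof -
    let ?k = "\<lambda>y. z * f y - T f y"
    obtain H where H: "dominated (T f) H"
      using dominated_diff[OF dominated_markov_op[OF f] dominated_const] by blast
    have Fk: "F ?k n x = z * F f n x - z * F f (Suc n) x" for n
    proof -
      have "(markov_op P ^^ Suc n) (T f) x
          = (markov_op P ^^ Suc n) (\<lambda>y. 1 * markov_op P f y - (\<integral>y. f y \<partial>\<mu>)) x" by simp
      also have "\<dots> = (markov_op P ^^ Suc n) (markov_op P f) x - (\<integral>y. f y \<partial>\<mu>)"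
        by (subst markov_op_pow_diff[OF dominated_markov_op[OF f] dominated_const x])
          (simp add: markov_op_pow_const[OF x] del: funpow.simps)
      also have "(markov_op P ^^ Suc n) (markov_op P f) x = (markov_op P ^^ Suc (Suc n)) f x"
        by (simp only: funpow_Suc_right o_def)
      finally have 1: "(markov_op P ^^ Suc n) (T f) x = (markov_op P ^^ Suc (Suc n)) f x - (\<integral>y. f y \<partial>\<mu>)" .
      have "(\<integral>y. T f y \<partial>\<mu>) = 0"
        using dominated_mu[OF dominated_markov_op[OF f]] mu_invariant[OF f] mu.prob_space
        by (subst Bochner_Integration.integral_diff) auto
      then have 2: "(\<integral>y. ?k y \<partial>\<mu>) = z * (\<integral>y. f y \<partial>\<mu>)"
        using dominated_mu[OF f] dominated_mu[OF H] by (subst Bochner_Integration.integral_diff) auto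
      have "(markov_op P ^^ Suc n) ?k x - (\<integral>y. ?k y \<partial>\<mu>)
        = z * ((markov_op P ^^ Suc n) f x - (\<integral>y. f y \<partial>\<mu>)) - ((markov_op P ^^ Suc (Suc n)) f x - (\<integral>y. f y \<partial>\<mu>))"
        unfolding markov_op_pow_diff[OF f H x] 1 2 by (simp add: algebra_simps del: funpow.simps)
      moreover have "(z * a - d) / z ^ (n + 2) = z * (a / z ^ (n + 2)) - z * (d / z ^ (Suc n + 2))" for a d
        using z0 by (simp add: diff_divide_distrib)
      ultimately show ?thesis unfolding F_def[of ?k] F_def[of f] by (simp only:)
    qed
    have sF: "summable (\<lambda>n. F f n x)" by (rule F_summable[OF f x])
    have "(\<lambda>n. F f n x) \<longlonglongrightarrow> 0" by (rule summable_LIMSEQ_zero[OF sF])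
    then have "(\<lambda>n. z * F f n x) \<longlonglongrightarrow> z * 0" by (intro tendsto_mult tendsto_const)
    from telescope_sums'[OF this] have "(\<Sum>n. F ?k n x) = z * F f 0 x"
      unfolding Fk by (simp add: sums_iff)
    then show ?thesis unfolding A_def zF0 using z0 by (simp add: field_simps)
  qed
  show ?thesis
    unfolding BV_resolvent_set_def mem_Collect_eq
  proof (intro exI[of _ A] conjI ballI)
    show "A h \<in> BV S V" if "h \<in> BV S V" for h
      using that by (rule BV_dominated) (rule dominated_BV[OF A_dom])
    show "\<exists>C. \<forall>h\<in>BV S V. V_norm S V (A h) \<le> ereal C * V_norm S V h"
    proof (intro exI[of _ "1 / cmod z + c"] ballI)
      fix h :: "'a \<Rightarrow> complex" assume "h \<in> BV S V"
      then obtain v where v: "V_norm S V h = ereal v" "dominated h v" by (rule BV_dominated)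
      show "V_norm S V (A h) \<le> ereal (1 / cmod z + c) * V_norm S V h"
        using dominatedD(3)[OF A_dom[OF v(2)]] unfolding v(1) times_ereal.simps(1) V_norm_le_iff by blast
    qed
    show "z * A h x - T (A h) x = h x" if h: "h \<in> BV S V" and "x \<in> space S" for h x
      using h by (rule BV_dominated) (rule right[OF _ \<open>x \<in> space S\<close>])
    show "A (\<lambda>y. z * f y - T f y) x = f x" if f: "f \<in> BV S V" and "x \<in> space S" for f x
      using f by (rule BV_dominated) (rule left[OF _ \<open>x \<in> space S\<close>])
  qed
qed

lemma rho_V_le:
  assumes r0: "1 < r0" "r0 \<le> R"
    and rate: "\<And>r. 1 < r \<Longrightarrow> r < r0 \<Longrightarrow> \<exists>K0. \<forall>n. \<bar>renewal_seq ret n - measure \<mu> C\<bar> * r ^ n \<le> K0"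
  shows "rho_V S P \<mu> V \<le> ereal (inverse r0)"
  unfolding rho_V_def BV_spectral_radius_def
proof (rule SUP_least)
  fix z assume z: "z \<in> BV_spectrum S V T"
  show "ereal (cmod z) \<le> ereal (inverse r0)"
  proof (rule ccontr)
    assume "\<not> ereal (cmod z) \<le> ereal (inverse r0)"
    then have lt: "inverse r0 < cmod z" by simp
    then have z0: "0 < cmod z" using r0 by (smt (verit) inverse_positive_iff_positive)
    have "1 / cmod z < r0" using lt z0 r0 by (simp add: field_simps)
    then obtain r where r: "max 1 (1 / cmod z) < r" "r < r0"
      using dense[of "max 1 (1 / cmod z)" r0] r0 by auto
    then obtain K0 where "\<And>n. \<bar>renewal_seq ret n - measure \<mu> C\<bar> * r ^ n \<le> K0" using rate[of r] by auto
    then have "z \<in> BV_resolvent_set S V T"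
      using r r0 z0 by (intro resolvent_set[of r K0]) (auto simp: field_simps)
    then show False using z by (simp add: BV_spectrum_def)
  qed
qed

lemma geometrically_ergodicI:
  assumes r: "1 < r" "r < R" and K0: "\<And>n. \<bar>renewal_seq ret n - measure \<mu> C\<bar> * r ^ n \<le> K0"
  shows "geometrically_ergodic S P \<mu> V"
proof -
  define M where "M = 1 + K / (1 - l) + r * ((K0 + 1) * (K / (1 - l * r)))"
  show ?thesis
    unfolding geometrically_ergodic_def
  proof (rule exI[of _ "1 / r"], rule exI[of _ M], intro conjI ballI allI impI)
    fix g :: "'a \<Rightarrow> real" and n :: nat assume g: "g \<in> BV S V" and n: "1 \<le> n"
    obtain v where v: "V_norm S V g = ereal v" "dominated g v" using g by (rule BV_dominated)
    have "norm ((markov_op P ^^ n) g x - (\<integral>y. g y \<partial>\<mu>)) \<le> M * (1 / r) ^ n * v * V x" if "x \<in> space S" for x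
    proof -
      have "norm ((markov_op P ^^ n) g x - (\<integral>y. g y \<partial>\<mu>)) * r ^ n \<le> M * v * V x"
        unfolding M_def by (rule V_convergence[OF r K0 v(2) that n])
      then show ?thesis using r by (simp add: power_divide pos_le_divide_eq)
    qed
    then show "V_norm S V (\<lambda>x. (markov_op P ^^ n) g x - (\<integral>y. g y \<partial>\<mu>)) \<le> ereal (M * (1 / r) ^ n) * V_norm S V g"
      unfolding v(1) times_ereal.simps(1) V_norm_le_iff by blast
  qed (use r in auto)
qed

lemma M1_leI:
  assumes r: "1 < r" "r < R" and K0: "\<And>n. \<bar>renewal_seq ret n - measure \<mu> C\<bar> * r ^ n \<le> K0"
  shows "M1 S P \<mu> V r \<le> ereal (M1_bound l K K0 r)"
  unfolding M1_def
proof (rule Inf_lower, simp only: mem_Collect_eq, intro ballI impI allI)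
  fix g :: "'a \<Rightarrow> real" and n :: nat
  assume g: "g \<in> borel_measurable S" and fin: "sup_norm S g < \<infinity>" and n: "1 \<le> n"
  obtain x where x: "x \<in> space S" using space_nonempty by auto
  have up: "ereal (norm (g x)) \<le> sup_norm S g" if "x \<in> space S" for x
    unfolding sup_norm_def using that by (rule SUP_upper)
  have "ereal 0 \<le> sup_norm S g" by (rule order_trans[OF _ up[OF x]]) simp
  then obtain s where s: "sup_norm S g = ereal s" "0 \<le> s" using fin by (cases "sup_norm S g") auto
  have bd: "norm (g x) \<le> s" if "x \<in> space S" for x using up[OF that] by (simp add: s(1))
  have "norm ((markov_op P ^^ n) g x - (\<integral>y. g y \<partial>\<mu>)) \<le> M1_bound l K K0 r * (1 / r ^ n) * s * V x"
    if "x \<in> space S" for x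
    using bounded_convergence[OF r K0 g bd s(2) that n] r by (simp add: pos_le_divide_eq)
  then show "V_norm S V (\<lambda>x. (markov_op P ^^ n) g x - (\<integral>y. g y \<partial>\<mu>))
    \<le> ereal (M1_bound l K K0 r) * ereal (1 / r ^ n) * sup_norm S g"
    unfolding s(1) times_ereal.simps(1) V_norm_le_iff by blast
qed

end

section \<open>The two pairs of constants\<close>

lemma powr_less_of_less_root:
  fixes r x k :: real
  assumes "0 < k" "0 < r" "0 < x" "r < x powr (1 / k)"
  shows "r powr k < x"
proof -
  have "r powr k < (x powr (1 / k)) powr k" using assms by (intro powr_less_mono2) auto
  then show ?thesis using assms by (simp add: powr_powr)
qed

text \<open>Bernoulli's inequality with a real exponent, from Young's inequality for \<open>R = (R\<^sup>a)\<^bsup>1/a\<^esup>\<close>.\<close>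

lemma real_Bernoulli:
  fixes R a :: real
  assumes "1 \<le> a" "0 < R" shows "1 + a * (R - 1) \<le> R powr a"
proof -
  have "(R powr a) powr (1 / a) * 1 powr (1 - 1 / a) \<le> (1 / a) * R powr a + (1 - 1 / a) * 1"
    using assms by (intro Youngs_inequality_0) auto
  then have "a * R \<le> a * ((1 / a) * R powr a + (1 - 1 / a))" using assms by (simp add: powr_powr)
  then show ?thesis using assms by (simp add: algebra_simps)
qed

lemma continuous_on_D_fun: "continuous_on {1..u} (D_fun b)"
proof -
  have 1: "1 + \<alpha> \<noteq> 0" if "\<alpha> \<in> {1..u}" for \<alpha> :: real using that by auto
  have 2: "cmod (1 - exp (\<i> * complex_of_real (pi / (1 + \<alpha>)))) \<noteq> 0" if "\<alpha> \<in> {1..u}" for \<alpha>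
    using half_angle_pos[of \<alpha>] norm_one_minus_cis[of "pi / (1 + \<alpha>)"] that by (simp add: cis_conv_exp)
  show ?thesis
    unfolding D_fun_def[abs_def] using 1 2 by (intro continuous_intros ballI) auto
qed

context stationary_atomic_chain
begin

lemma R_const_eq: "R_const l = R"
  by (simp add: R_const_def R_def inverse_eq_divide)

lemma L_const_eq: "L_const l K = R * K"
  by (simp add: L_const_def R_def inverse_eq_divide)

lemma L_eq: "R * K - R = B * (R - 1)"
proof -
  have "B * (R - 1) = R * (K - 1)" using R by (simp add: B_def)
  then show ?thesis by (simp add: right_diff_distrib)
qed

lemma N_const_eq: "N_const l K - 1 = B"
proof -
  have "R * K - 1 = (1 + B) * (R - 1)" using L_eq by (simp add: algebra_simps)
  then show ?thesis using R by (simp add: N_const_def L_const_eq R_const_eq)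
qed

lemma kappa_eq: "kappa b l K \<alpha> = ln (B / ((1 - b) * \<alpha>)) / ln R"
  by (simp add: kappa_def N_const_eq R_const_eq)

lemma kappa_ge_1:
  assumes "0 < \<alpha>" "(1 - b) * \<alpha> * R \<le> B" shows "1 \<le> kappa b l K \<alpha>"
proof -
  have "R \<le> B / ((1 - b) * \<alpha>)" using assms b_range by (simp add: pos_le_divide_eq mult_ac)
  then show ?thesis unfolding kappa_eq using R by simp
qed

lemma rate_base_gt_1:
  assumes "0 < \<alpha>" "(1 - b) * \<alpha> * R \<le> B"
  shows "1 < (1 + D_fun b \<alpha> / \<alpha>) powr (1 / kappa b l K \<alpha>)"
  using D_fun_pos[OF b_range assms(1)] kappa_ge_1[OF assms] assms(1) by (intro gr_one_powr) auto

text \<open>Unfolds the condition \<open>r < r\<^sub>0\<close> to the one under which the rates of the renewal sequence were derived.\<close>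

lemma rate_base_small:
  assumes "0 < \<alpha>" "(1 - b) * \<alpha> * R \<le> B" "1 < r"
    and "r < (1 + D_fun b \<alpha> / \<alpha>) powr (1 / kappa b l K \<alpha>)"
  shows "r powr kappa b l K \<alpha> < 1 + D_fun b \<alpha> / \<alpha>"
  using assms D_fun_pos[OF b_range assms(1)] kappa_ge_1[OF assms(1,2)]
  by (intro powr_less_of_less_root) (auto intro: add_pos_pos)

lemma mu_C_less_1_iff: "measure \<mu> C < 1 \<longleftrightarrow> 0 < ren.A"
  using ren.A_nonneg by (simp add: mu_C)

lemma alpha_pi_eq: "(1 - b) * alpha_pi b (measure \<mu> C) = ren.A"
  using b_range by (simp add: alpha_pi_def mu_C)

lemma alpha_pi_props:
  assumes "measure \<mu> C < 1"
  shows "0 < alpha_pi b (measure \<mu> C)" "(1 - b) * alpha_pi b (measure \<mu> C) * R \<le> B"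
proof -
  have "0 < (1 - b) * alpha_pi b (measure \<mu> C)" using assms by (simp add: alpha_pi_eq mu_C_less_1_iff)
  then show "0 < alpha_pi b (measure \<mu> C)" using b_range by (simp add: zero_less_mult_iff)
  show "(1 - b) * alpha_pi b (measure \<mu> C) * R \<le> B"
    using ren.RA_le_B by (simp add: alpha_pi_eq mult.commute)
qed

lemma r0_pi_bounds:
  assumes "measure \<mu> C < 1"
  shows "1 < r0_pi b l K (measure \<mu> C)" "r0_pi b l K (measure \<mu> C) \<le> R"
  using rate_base_gt_1[OF alpha_pi_props[OF assms]] R by (auto simp: r0_pi_def Let_def R_const_eq)

lemma rate_pi:
  assumes p: "measure \<mu> C < 1" and r: "1 < r" "r < r0_pi b l K (measure \<mu> C)"
  shows "\<bar>renewal_seq ret n - measure \<mu> C\<bar> * r ^ n \<le> K0_pi b l K (measure \<mu> C) r"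
proof -
  let ?\<alpha> = "alpha_pi b (measure \<mu> C)"
  have rR: "r < R" and rb: "r < (1 + D_fun b ?\<alpha> / ?\<alpha>) powr (1 / kappa b l K ?\<alpha>)"
    using r(2) by (auto simp: r0_pi_def Let_def R_const_eq)
  have "r powr kappa b l K ?\<alpha> < 1 + D_fun b ?\<alpha> / ?\<alpha>"
    by (rule rate_base_small[OF alpha_pi_props[OF p] r(1) rb])
  from ren.renewal_seq_rate[OF alpha_pi_props(1)[OF p] alpha_pi_eq[symmetric] r(1) rR this[unfolded kappa_eq], of n]
  show ?thesis by (simp add: K0_pi_def Let_def kappa_eq mu_C)
qed

text \<open>If \<open>\<pi>(C) = 1\<close> the first pair is not defined, but then the return time is constantly \<open>1\<close> and there is no error at all.\<close>

lemma exists_rate: "\<exists>r K0. 1 < r \<and> r < R \<and> (\<forall>n. \<bar>renewal_seq ret n - measure \<mu> C\<bar> * r ^ n \<le> K0)"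
proof (cases "measure \<mu> C < 1")
  case True
  obtain r where r: "1 < r" "r < r0_pi b l K (measure \<mu> C)" using dense[OF r0_pi_bounds(1)[OF True]] by blast
  moreover have "r < R" using r r0_pi_bounds(2)[OF True] by simp
  ultimately show ?thesis using rate_pi[OF True r] by blast
next
  case False
  then have A0: "ren.A = 0" using ren.A_nonneg mu_C_less_1_iff by simp
  have "summable (\<lambda>n. survival ret (Suc n))" using ren.summable_c by (simp add: summable_Suc_iff)
  then have z: "survival ret (Suc n) = 0" for n
    using A0 survival_ret_nonneg suminf_eq_zero_iff[of "\<lambda>n. survival ret (Suc n)"] by (simp add: ren.A_def)
  obtain r where r: "1 < r" "r < R" using dense[OF R(1)] by blast
  have "\<bar>renewal_seq ret n - 1 / (1 + ren.A)\<bar> * r ^ n \<le> 0 / (r * (1 - 0))" for n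
    using r by (intro ren.renewal_seq_rate_contraction) (auto simp: z)
  then show ?thesis using r by (auto simp: mu_C)
qed

lemma alpha0_powr: "(1 - b) * R * R powr alpha0 b l K = R * K - b * R"
proof -
  have "R \<le> R * K" using R K_ge_1 by simp
  moreover have "b * R < R" using R b_range by simp
  ultimately have "0 < (R * K - b * R) / ((1 - b) * R)" using R b_range by simp
  then have "R powr alpha0 b l K = (R * K - b * R) / ((1 - b) * R)"
    using R by (simp add: alpha0_def L_const_eq R_const_eq powr_def)
  then show ?thesis using R b_range by simp
qed

text \<open>\<open>\<alpha>\<^sub>0\<close> satisfies \<open>L = b R + (1 - b) R\<^bsup>1 + \<alpha>\<^sub>0\<^esup>\<close>, so \<open>B (R - 1) = L - R = (1 - b) R (R\<^bsup>\<alpha>\<^sub>0\<^esup> - 1) \<ge> (1 - b) R \<alpha>\<^sub>0 (R - 1)\<close> by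
Bernoulli's inequality. Hence \<open>\<kappa>(\<alpha>) \<ge> 1\<close> on the whole range of \<open>\<alpha>\<close>.\<close>

lemma alpha_range_B:
  assumes "1 \<le> alpha0 b l K" "\<alpha> \<le> alpha0 b l K" shows "(1 - b) * \<alpha> * R \<le> B"
proof -
  have "(1 - b) * R * (alpha0 b l K * (R - 1)) \<le> (1 - b) * R * (R powr alpha0 b l K - 1)"
    using real_Bernoulli[OF assms(1), of R] R b_range by (intro mult_left_mono) auto
  also have "\<dots> = B * (R - 1)" using alpha0_powr L_eq by (simp add: algebra_simps)
  finally have "(1 - b) * R * alpha0 b l K * (R - 1) \<le> B * (R - 1)" by (simp add: mult.assoc)
  then have "(1 - b) * R * alpha0 b l K \<le> B" using R by (simp add: mult_le_cancel_right_pos)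
  moreover have "(1 - b) * R * \<alpha> \<le> (1 - b) * R * alpha0 b l K"
    using assms R b_range by (intro mult_left_mono) auto
  ultimately show ?thesis by (simp add: mult_ac)
qed

lemma continuous_on_kappa: "continuous_on {1..u} (kappa b l K)" if "0 < B"
  unfolding kappa_eq[abs_def] using that b_range R by (intro continuous_intros ballI) auto

text \<open>By continuity on a compact interval the infimum is attained. It is therefore larger than \<open>1\<close>, as each of its
terms is.\<close>

lemma r0_opt_bounds:
  assumes a0: "1 \<le> alpha0 b l K"
  shows "1 < r0_opt b l K" "r0_opt b l K \<le> R"
    "\<And>\<alpha>. \<alpha> \<in> {1..alpha0 b l K} \<Longrightarrow> r0_opt b l K \<le> (1 + D_fun b \<alpha> / \<alpha>) powr (1 / kappa b l K \<alpha>)"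
proof -
  let ?I = "{1..alpha0 b l K}" and ?f = "\<lambda>\<alpha>. (1 + D_fun b \<alpha> / \<alpha>) powr (1 / kappa b l K \<alpha>)"
  have pr: "0 < \<alpha>" "(1 - b) * \<alpha> * R \<le> B" if "\<alpha> \<in> ?I" for \<alpha> using alpha_range_B[OF a0] that by auto
  have "0 < (1 - b) * R" using b_range R by simp
  then have B0: "0 < B" using pr(2)[of 1] a0 by simp
  have D0: "0 < 1 + D_fun b \<alpha> / \<alpha>" if "\<alpha> \<in> ?I" for \<alpha>
    using D_fun_pos[OF b_range pr(1)[OF that]] pr(1)[OF that] by (intro add_pos_pos) auto
  have "continuous_on ?I ?f"
  proof (rule continuous_on_powr)
    show "continuous_on ?I (\<lambda>\<alpha>. 1 + D_fun b \<alpha> / \<alpha>)"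
      by (intro continuous_intros continuous_on_D_fun) auto
    have "kappa b l K \<alpha> \<noteq> 0" if "\<alpha> \<in> ?I" for \<alpha> using kappa_ge_1[OF pr[OF that]] by simp
    then show "continuous_on ?I (\<lambda>\<alpha>. 1 / kappa b l K \<alpha>)"
      by (intro continuous_on_divide continuous_on_const continuous_on_kappa B0) auto
    show "\<forall>\<alpha>\<in>?I. 1 + D_fun b \<alpha> / \<alpha> \<noteq> 0" using D0 by force
  qed
  then obtain \<alpha>' where a': "\<alpha>' \<in> ?I" "\<And>\<alpha>. \<alpha> \<in> ?I \<Longrightarrow> ?f \<alpha>' \<le> ?f \<alpha>"
    using continuous_attains_inf[of ?I ?f] a0 by auto
  have inf: "(INF \<alpha>\<in>?I. ?f \<alpha>) = ?f \<alpha>'"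
    using a' by (intro cInf_eq_minimum) auto
  show "1 < r0_opt b l K" using rate_base_gt_1[OF pr[OF a'(1)]] R by (simp add: r0_opt_def R_const_eq inf)
  show "r0_opt b l K \<le> R" by (simp add: r0_opt_def R_const_eq)
  show "r0_opt b l K \<le> ?f \<alpha>" if "\<alpha> \<in> ?I" for \<alpha> using a'(2)[OF that] by (simp add: r0_opt_def inf)
qed

text \<open>By compactness the supremum is that of a bounded set, so that it dominates its terms.\<close>

lemma K0_opt_upper:
  assumes a0: "1 \<le> alpha0 b l K" and r: "1 < r" "r < r0_opt b l K" and \<alpha>: "\<alpha> \<in> {1..alpha0 b l K}"
  shows "r powr kappa b l K \<alpha> < 1 + D_fun b \<alpha> / \<alpha>"
    "(r powr kappa b l K \<alpha> - 1) / ((r - 1) * (D_fun b \<alpha> / \<alpha> - r powr kappa b l K \<alpha> + 1)) \<le> K0_opt b l K r"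
proof -
  let ?I = "{1..alpha0 b l K}"
  let ?g = "\<lambda>\<alpha>. (r powr kappa b l K \<alpha> - 1) / ((r - 1) * (D_fun b \<alpha> / \<alpha> - r powr kappa b l K \<alpha> + 1))"
  have pr: "0 < \<alpha>" "(1 - b) * \<alpha> * R \<le> B" if "\<alpha> \<in> ?I" for \<alpha> using alpha_range_B[OF a0] that by auto
  have "0 < (1 - b) * R" using b_range R by simp
  then have B0: "0 < B" using pr(2)[of 1] a0 by simp
  have small: "r powr kappa b l K \<alpha> < 1 + D_fun b \<alpha> / \<alpha>" if "\<alpha> \<in> ?I" for \<alpha>
    using r r0_opt_bounds(3)[OF a0 that] by (intro rate_base_small pr that) auto
  show "r powr kappa b l K \<alpha> < 1 + D_fun b \<alpha> / \<alpha>" by (rule small[OF \<alpha>])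
  have "continuous_on ?I ?g"
  proof (rule continuous_on_divide)
    have ck: "continuous_on ?I (\<lambda>\<alpha>. r powr kappa b l K \<alpha>)"
      using r by (intro continuous_on_powr continuous_on_const continuous_on_kappa B0) auto
    then show "continuous_on ?I (\<lambda>\<alpha>. r powr kappa b l K \<alpha> - 1)"
      by (intro continuous_on_diff continuous_on_const)
    have "continuous_on ?I (\<lambda>\<alpha>. D_fun b \<alpha> / \<alpha>)"
      by (intro continuous_on_divide continuous_on_D_fun continuous_on_id) auto
    then show "continuous_on ?I (\<lambda>\<alpha>. (r - 1) * (D_fun b \<alpha> / \<alpha> - r powr kappa b l K \<alpha> + 1))"
      by (intro continuous_on_mult continuous_on_add continuous_on_diff continuous_on_const ck)
    show "\<forall>\<alpha>\<in>?I. (r - 1) * (D_fun b \<alpha> / \<alpha> - r powr kappa b l K \<alpha> + 1) \<noteq> 0"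
      using small r by force
  qed
  then have "compact (?g ` ?I)" by (intro compact_continuous_image) auto
  then have "bdd_above (?g ` ?I)" by (intro bounded_imp_bdd_above compact_imp_bounded)
  then show "?g \<alpha> \<le> K0_opt b l K r" unfolding K0_opt_def using \<alpha> by (intro cSUP_upper)
qed

lemma alpha_le_alpha0: "alpha_pi b (measure \<mu> C) \<le> alpha0 b l K"
proof -
  let ?\<alpha> = "alpha_pi b (measure \<mu> C)"
  have "(1 - b) * R powr (1 + ?\<alpha>) \<le> 1 + (R - 1) * (1 + B) - b * R"
    by (rule ren.mean_excess_le[OF alpha_pi_eq[symmetric]])
  also have "\<dots> = (1 - b) * R * R powr alpha0 b l K" using alpha0_powr L_eq by (simp add: algebra_simps)
  finally have "R powr ?\<alpha> \<le> R powr alpha0 b l K" using R b_range by (simp add: powr_add)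
  then show ?thesis using R by simp
qed

text \<open>The true value of \<open>\<alpha>\<close> lies below \<open>\<alpha>\<^sub>0\<close>, but it may be smaller than \<open>1\<close>; that case is compared with \<open>\<alpha> = 1\<close>.\<close>

lemma rate_opt:
  assumes a0: "1 \<le> alpha0 b l K" and r: "1 < r" "r < r0_opt b l K"
  shows "\<bar>renewal_seq ret n - measure \<mu> C\<bar> * r ^ n \<le> K0_opt b l K r"
proof -
  let ?\<alpha> = "alpha_pi b (measure \<mu> C)"
  let ?g = "\<lambda>\<alpha>. (r powr kappa b l K \<alpha> - 1) / ((r - 1) * (D_fun b \<alpha> / \<alpha> - r powr kappa b l K \<alpha> + 1))"
  have rR: "r < R" using r r0_opt_bounds(2)[OF a0] by simp
  show ?thesis
  proof (cases "1 \<le> ?\<alpha>")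
    case True
    then have a: "?\<alpha> \<in> {1..alpha0 b l K}" "0 < ?\<alpha>" using alpha_le_alpha0 by auto
    note small = K0_opt_upper(1)[OF a0 r a(1)]
    have k: "1 \<le> kappa b l K ?\<alpha>" using alpha_range_B[OF a0] a by (intro kappa_ge_1) auto
    have g0: "0 \<le> ?g ?\<alpha>"
      using small r k ge_one_powr_ge_zero[of r "kappa b l K ?\<alpha>"] by (intro divide_nonneg_nonneg mult_nonneg_nonneg) auto
    have "\<bar>renewal_seq ret n - measure \<mu> C\<bar> * r ^ n \<le> measure \<mu> C * ?g ?\<alpha>"
      using ren.renewal_seq_rate[OF a(2) alpha_pi_eq[symmetric] r(1) rR small[unfolded kappa_eq], of n]
      by (simp add: kappa_eq mu_C)
    also have "\<dots> \<le> 1 * ?g ?\<alpha>"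
      using g0 ren.A_nonneg by (intro mult_right_mono) (auto simp: mu_C)
    also have "\<dots> \<le> K0_opt b l K r" using K0_opt_upper(2)[OF a0 r a(1)] by simp
    finally show ?thesis .
  next
    case False
    have A: "ren.A \<le> 1 - b" using False b_range mult_left_mono[of ?\<alpha> 1 "1 - b"] by (simp add: alpha_pi_eq)
    have one: "1 \<in> {1..alpha0 b l K}" using a0 by simp
    have BR: "(1 - b) * R \<le> B" using alpha_range_B[OF a0 a0] by simp
    have small: "r powr (ln (B / (1 - b)) / ln R) < 1 + D_fun b 1"
      using K0_opt_upper(1)[OF a0 r one] by (simp add: kappa_eq)
    have "\<bar>renewal_seq ret n - measure \<mu> C\<bar> * r ^ n \<le> ?g 1"
      using ren.renewal_seq_rate_short[OF A BR r(1) rR small, of n] by (simp add: kappa_eq mu_C)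
    also have "\<dots> \<le> K0_opt b l K r" by (rule K0_opt_upper(2)[OF a0 r one])
    finally show ?thesis .
  qed
qed

end

theorem theorem2p4:
  fixes S :: "'a measure" and P :: "'a \<Rightarrow> 'a measure" and \<mu> \<nu> :: "'a measure"
    and C :: "'a set" and V :: "'a \<Rightarrow> real" and b l K :: real
  assumes kernel: "P \<in> S \<rightarrow>\<^sub>M prob_algebra S"
    and stat: "stationary S P \<mu>"
    and stat_unique: "\<And>\<mu>'. stationary S P \<mu>' \<Longrightarrow> \<mu>' = \<mu>"
    and C_meas: "C \<in> sets S"
    and nu_prob: "prob_space \<nu>" and nu_sets: "sets \<nu> = sets S"
    and minorization: "\<And>x A. x \<in> C \<Longrightarrow> A \<in> sets S \<Longrightarrow> emeasure (P x) A = emeasure \<nu> A"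
    and V_meas: "V \<in> borel_measurable S"
    and V_ge_1: "\<And>x. x \<in> space S \<Longrightarrow> 1 \<le> V x"
    and l_range: "0 < l" "l < 1"
    and drift_out: "\<And>x. x \<in> space S - C \<Longrightarrow> (\<integral>\<^sup>+ y. ennreal (V y) \<partial>(P x)) \<le> ennreal (l * V x)"
    and drift_in: "\<And>x. x \<in> C \<Longrightarrow> (\<integral>\<^sup>+ y. ennreal (V y) \<partial>(P x)) \<le> ennreal K"
    and aperiodic: "b \<le> measure \<nu> C"
    and b_range: "0 < b" "b < 1"
  shows "geometrically_ergodic S P \<mu> V \<and>
    (measure \<mu> C < 1 \<longrightarrow>
       rho_V S P \<mu> V \<le> ereal (inverse (r0_pi b l K (measure \<mu> C))) \<and>
       (\<forall>r. 1 < r \<and> r < r0_pi b l K (measure \<mu> C) \<longrightarrow>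
          M1 S P \<mu> V r \<le> ereal (M1_bound l K (K0_pi b l K (measure \<mu> C) r) r))) \<and>
    (1 \<le> alpha0 b l K \<longrightarrow>
       rho_V S P \<mu> V \<le> ereal (inverse (r0_opt b l K)) \<and>
       (\<forall>r. 1 < r \<and> r < r0_opt b l K \<longrightarrow>
          M1 S P \<mu> V r \<le> ereal (M1_bound l K (K0_opt b l K r) r)))"
proof -
  have C_nonempty: "C \<noteq> {}" using aperiodic b_range by auto
  interpret atomic_drift_chain S P \<nu> C V l K
    by (rule atomic_drift_chain.intro) (fact assms C_nonempty)+
  interpret stationary_atomic_chain S P \<nu> C V l K \<mu> b
    by unfold_locales (fact assms)+
  show ?thesis
  proof (intro conjI impI allI)
    show "geometrically_ergodic S P \<mu> V" using exists_rate geometrically_ergodicI by blast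
  next
    assume p: "measure \<mu> C < 1"
    show "rho_V S P \<mu> V \<le> ereal (inverse (r0_pi b l K (measure \<mu> C)))"
      using rate_pi[OF p] by (intro rho_V_le r0_pi_bounds p) blast
    fix r assume "1 < r \<and> r < r0_pi b l K (measure \<mu> C)"
    then show "M1 S P \<mu> V r \<le> ereal (M1_bound l K (K0_pi b l K (measure \<mu> C) r) r)"
      using r0_pi_bounds[OF p] by (intro M1_leI rate_pi p) auto
  next
    assume a: "1 \<le> alpha0 b l K"
    show "rho_V S P \<mu> V \<le> ereal (inverse (r0_opt b l K))"
      using rate_opt[OF a] by (intro rho_V_le r0_opt_bounds a) blast
    fix r assume "1 < r \<and> r < r0_opt b l K"
    then show "M1 S P \<mu> V r \<le> ereal (M1_bound l K (K0_opt b l K r) r)"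
      using r0_opt_bounds(1,2)[OF a] by (intro M1_leI rate_opt a) auto
  qed
qed

end
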